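(* Let $X_1,X_2,\dots$ be i.i.d. with a monotone decreasing probability mass function $p$ on $\mathbb N$. Then, for any $2\le k\le\infty$, as $n\to\infty$, $$\sqrt n\|\widehat p_n-p\|_k=\|Y_n\|_k\to_d\|Y\|_k,$$ $$\sqrt n\|\widehat p_n^R-p\|_k=\|Y_n^R\|_k\to_d\|Y\|_k,$$ $$\sqrt n\|\widehat p_n^G-p\|_k=\|Y_n^G\|_k\to_d\|Y^G\|_k\le_S\|Y\|_k.$$ If $p$ is not strictly monotone, then $\le_S$ may be replaced with $<_S$. The convergence also holds in expectation, that is, $E[\|Y_n\|_k^k]\to E[\|Y\|_k^k]$, $E[\|Y_n^R\|_k^k]\to E[\|Y\|_k^k]$ and $E[\|Y_n^G\|_k^k]\to E[\|Y^G\|_k^k]$ (for $k=\infty$, read $\|\cdot\|_\infty$ in place of $\|\cdot\|_k^k$). Furthermore, $$E[\|Y^G\|_2^2]\le E[\|Y\|_2^2]=\sum_{x\ge0}p_x(1-p_x),$$ with equality if and only if $p$ is strictly monotone.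
   Context: $\mathbb N=\{0,1,2,\dots\}$. $p$ is monotone decreasing if $p_x\ge p_{x+1}$ for all $x\in\mathbb N$; it is called strictly monotone here if it is strictly decreasing on its support, i.e. $p_x>p_{x+1}$ for every $x$ with $p_x>0$. The empirical estimator is $\widehat p_{n,x}=n^{-1}\#\{i\le n:X_i=x\}$. For a finite vector $w=(w_0,\dots,w_m)$, $\mathrm{rear}(w)$ is the vector of entries of $w$ sorted in nonincreasing order, and $\mathrm{gren}(w)$ is the vector of the $m+1$ left slopes, at $j=0,\dots,m$, of the least concave majorant of the points $\{(j,\sum_{i=0}^jw_i):j=-1,0,\dots,m\}$ (empty sum $=0$). For a vector indexed by $r,\dots,s$ these are defined in the same way after shifting indices. The rearrangement estimator is $\widehat p_n^R=\mathrm{rear}(\widehat p_n)$ and the Grenander estimator (MLE) is $\widehat p_n^G=\mathrm{gren}(\widehat p_n)$; both operators are applied to the finite vector $(\widehat p_{n,x})_{0\le x\le\max_{i\le n}X_i}$, and the results are extended by $0$ to $\mathbb N$. $Y_n=\sqrt n(\widehat p_n-p)$, $Y_n^R=\sqrt n(\widehat p_n^R-p)$, $Y_n^G=\sqrt n(\widehat p_n^G-p)$. $Y=(Y_x)_{x\in\mathbb N}$ is the mean-zero Gaussian process in $\ell_2$ with $\mathrm{cov}(Y_x,Y_{x'})=p_x\delta_{x,x'}-p_xp_{x'}$. $Y^G$ is obtained from $Y$ by setting $(Y^G_r,\dots,Y^G_s)=\mathrm{gren}(Y_r,\dots,Y_s)$ for all $r<s$ with $p_{r-1}>p_r=\dots=p_s>p_{s+1}$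 (convention $p_{-1}=+\infty$), and $Y^G_x=Y_x$ for all other $x$. $\|v\|_k=(\sum_{x\ge0}|v_x|^k)^{1/k}$ for $k<\infty$ and $\|v\|_\infty=\sup_{x\ge0}|v_x|$. $Z_1\le_SZ_2$ denotes stochastic ordering, i.e. $P(Z_1>x)\le P(Z_2>x)$ for all $x\in\mathbb R$; the ordering is strict, written $Z_1<_SZ_2$, if the inequality is replaced with a strict one, i.e. $P(Z_1>x)<P(Z_2>x)$ for all $x\in\mathbb R$.
   Formalization: The strict ordering <_S is proved as P(Z1>x) ≤ P(Z2>x) for all real x and strict for all x>0; strictness for all real x is impossible for norms (both sides are 1 for x<0) and at x=0 fails in general, e.g. p=(1/2,1/4,1/4). *)

theory Defs
  imports "HOL-Probability.Probability"
begin

section \<open>Rearrangement and least concave majorants of finite vectors\<close>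

definition rear :: "real list \<Rightarrow> real list" where
  "rear w = rev (sort w)"

text \<open>Abscissae are shifted by one: the point over \<open>j = -1, 0, \<dots>, m\<close> sits at \<open>t = j + 1\<close>,
  so that the left slope belonging to the entry \<open>w ! j\<close> is taken at \<open>Suc j\<close>.\<close>

definition cum_points :: "real list \<Rightarrow> (real \<times> real) set" where
  "cum_points w = {(real t, sum_list (take t w)) | t. t \<le> length w}"

text \<open>The majorant of a point set is a function on the convex hull of the abscissae; its values
  off that hull are meaningless.\<close>

definition least_concave_majorant :: "(real \<times> real) set \<Rightarrow> real \<Rightarrow> real" where
  "least_concave_majorant A x =
     Inf {g x | g. concave_on (convex hull (fst ` A)) g \<and> (\<forall>(u, v) \<in> A. v \<le> g u)}"

definition left_slope :: "(real \<Rightarrow> real) \<Rightarrow> real \<Rightarrow> real" where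
  "left_slope f x = (THE D. (f has_real_derivative D) (at_left x))"

definition gren :: "real list \<Rightarrow> real list" where
  "gren w = map (\<lambda>j. left_slope (least_concave_majorant (cum_points w)) (real (Suc j)))
              [0..<length w]"

section \<open>Estimators from a sample path \<open>xs 1, xs 2, \<dots>\<close>\<close>

definition emp_est :: "(nat \<Rightarrow> nat) \<Rightarrow> nat \<Rightarrow> nat \<Rightarrow> real" where
  "emp_est xs n x = real (card {i \<in> {1..n}. xs i = x}) / real n"

definition emp_vec :: "(nat \<Rightarrow> nat) \<Rightarrow> nat \<Rightarrow> real list" where
  "emp_vec xs n = map (emp_est xs n) [0..<Suc (Max (xs ` {1..n}))]"

definition extend_zero :: "real list \<Rightarrow> nat \<Rightarrow> real" where
  "extend_zero w x = (if x < length w then w ! x else 0)"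

definition rear_est :: "(nat \<Rightarrow> nat) \<Rightarrow> nat \<Rightarrow> nat \<Rightarrow> real" where
  "rear_est xs n = extend_zero (rear (emp_vec xs n))"

definition gren_est :: "(nat \<Rightarrow> nat) \<Rightarrow> nat \<Rightarrow> nat \<Rightarrow> real" where
  "gren_est xs n = extend_zero (gren (emp_vec xs n))"

text \<open>\<open>scaled_err p est xs n\<close> is \<open>Y\<^sub>n\<close>, \<open>Y\<^sub>n\<^sup>R\<close>, \<open>Y\<^sub>n\<^sup>G\<close> for \<open>est\<close> the empirical, rearrangement
  and Grenander estimator.\<close>

definition scaled_err ::
  "(nat \<Rightarrow> real) \<Rightarrow> ((nat \<Rightarrow> nat) \<Rightarrow> nat \<Rightarrow> nat \<Rightarrow> real) \<Rightarrow> (nat \<Rightarrow> nat) \<Rightarrow> nat \<Rightarrow> nat \<Rightarrow> real" where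
  "scaled_err p est xs n x = sqrt (real n) * (est xs n x - p x)"

section \<open>Monotone mass functions and the limit process\<close>

definition monotone_decreasing :: "(nat \<Rightarrow> real) \<Rightarrow> bool" where
  "monotone_decreasing p \<longleftrightarrow> (\<forall>x. p x \<ge> p (Suc x))"

definition strictly_monotone :: "(nat \<Rightarrow> real) \<Rightarrow> bool" where
  "strictly_monotone p \<longleftrightarrow> (\<forall>x. p x > 0 \<longrightarrow> p x > p (Suc x))"

text \<open>The disjunct \<open>r = 0\<close> encodes the convention that \<open>p\<close> at \<open>-1\<close> is infinite.\<close>

definition flat_block :: "(nat \<Rightarrow> real) \<Rightarrow> nat \<Rightarrow> nat \<Rightarrow> bool" where
  "flat_block p r s \<longleftrightarrow>
     r < s \<and> (r = 0 \<or> p (r - 1) > p r) \<and> (\<forall>x \<in> {r..s}. p x = p r) \<and> p s > p (Suc s)"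

text \<open>Distinct flat blocks are disjoint, so the block containing \<open>x\<close> is unique if it exists.\<close>

definition gren_blocks :: "(nat \<Rightarrow> real) \<Rightarrow> (nat \<Rightarrow> real) \<Rightarrow> nat \<Rightarrow> real" where
  "gren_blocks p y x =
     (if \<exists>r s. flat_block p r s \<and> x \<in> {r..s}
      then (let (r, s) = (THE (r, s). flat_block p r s \<and> x \<in> {r..s})
            in gren (map y [r..<Suc s]) ! (x - r))
      else y x)"

text \<open>Normal laws may be degenerate (variance zero).\<close>

definition gaussian_rv :: "'b measure \<Rightarrow> ('b \<Rightarrow> real) \<Rightarrow> bool" where
  "gaussian_rv N Z \<longleftrightarrow> Z \<in> borel_measurable N \<and>
     (\<exists>\<mu>. (AE \<omega> in N. Z \<omega> = \<mu>) \<or> (\<exists>\<sigma>>0. distributed N lborel Z (normal_density \<mu> \<sigma>)))"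

definition gaussian_process :: "'b measure \<Rightarrow> (nat \<Rightarrow> 'b \<Rightarrow> real) \<Rightarrow> bool" where
  "gaussian_process N Y \<longleftrightarrow>
     (\<forall>J a. finite J \<longrightarrow> gaussian_rv N (\<lambda>\<omega>. \<Sum>x\<in>J. a x * Y x \<omega>))"

definition cov :: "'b measure \<Rightarrow> ('b \<Rightarrow> real) \<Rightarrow> ('b \<Rightarrow> real) \<Rightarrow> real" where
  "cov N U V = (\<integral>\<omega>. (U \<omega> - (\<integral>\<omega>'. U \<omega>' \<partial>N)) * (V \<omega> - (\<integral>\<omega>'. V \<omega>' \<partial>N)) \<partial>N)"

definition limit_process :: "(nat \<Rightarrow> real) \<Rightarrow> 'b measure \<Rightarrow> (nat \<Rightarrow> 'b \<Rightarrow> real) \<Rightarrow> bool" where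
  "limit_process p N Y \<longleftrightarrow>
     gaussian_process N Y \<and>
     (\<forall>\<omega> \<in> space N. summable (\<lambda>x. (Y x \<omega>)\<^sup>2)) \<and>
     (\<forall>x. (\<integral>\<omega>. Y x \<omega> \<partial>N) = 0) \<and>
     (\<forall>x x'. cov N (Y x) (Y x') = (if x = x' then p x else 0) - p x * p x')"

section \<open>Norms, convergence and stochastic order\<close>

definition lnorm :: "ereal \<Rightarrow> (nat \<Rightarrow> real) \<Rightarrow> real" where
  "lnorm k v =
     (if k = \<infinity> then (SUP x. \<bar>v x\<bar>)
      else (\<Sum>x. \<bar>v x\<bar> powr real_of_ereal k) powr (1 / real_of_ereal k))"

definition lnorm_pow :: "ereal \<Rightarrow> (nat \<Rightarrow> real) \<Rightarrow> real" where
  "lnorm_pow k v = (if k = \<infinity> then lnorm k v else lnorm k v powr real_of_ereal k)"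

definition conv_in_distr ::
  "'a measure \<Rightarrow> (nat \<Rightarrow> 'a \<Rightarrow> real) \<Rightarrow> 'b measure \<Rightarrow> ('b \<Rightarrow> real) \<Rightarrow> bool" where
  "conv_in_distr M Z N Z' \<longleftrightarrow> weak_conv_m (\<lambda>n. distr M borel (Z n)) (distr N borel Z')"

text \<open>Integrability is part of the notion, since the Bochner integral of a non-integrable
  function is \<open>0\<close> by convention.\<close>

definition conv_in_expectation ::
  "'a measure \<Rightarrow> (nat \<Rightarrow> 'a \<Rightarrow> real) \<Rightarrow> 'b measure \<Rightarrow> ('b \<Rightarrow> real) \<Rightarrow> bool" where
  "conv_in_expectation M Z N Z' \<longleftrightarrow>
     (\<forall>n. integrable M (Z n)) \<and> integrable N Z' \<and>
     (\<lambda>n. \<integral>\<omega>. Z n \<omega> \<partial>M) \<longlonglongrightarrow> (\<integral>\<omega>. Z' \<omega> \<partial>N)"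

definition stoch_le :: "'a measure \<Rightarrow> ('a \<Rightarrow> real) \<Rightarrow> 'b measure \<Rightarrow> ('b \<Rightarrow> real) \<Rightarrow> bool" where
  "stoch_le M Z N Z' \<longleftrightarrow>
     (\<forall>x. measure M {\<omega> \<in> space M. Z \<omega> > x} \<le> measure N {\<omega> \<in> space N. Z' \<omega> > x})"

text \<open>The strict order is only meaningful for nonnegative variables here. Both tail
  probabilities are \<open>1\<close> at every \<open>x < 0\<close>, and possibly also at \<open>x = 0\<close>, so strictness is
  demanded at every \<open>x > 0\<close>.\<close>

definition stoch_less :: "'a measure \<Rightarrow> ('a \<Rightarrow> real) \<Rightarrow> 'b measure \<Rightarrow> ('b \<Rightarrow> real) \<Rightarrow> bool" where
  "stoch_less M Z N Z' \<longleftrightarrow> stoch_le M Z N Z' \<and>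
     (\<forall>x>0. measure M {\<omega> \<in> space M. Z \<omega> > x} < measure N {\<omega> \<in> space N. Z' \<omega> > x})"

end

theory Submission
  imports Defs
begin

text \<open>The vector \<open>gren w\<close> is characterised by its partial sums: they dominate those of \<open>w\<close>, agree at
  the right end, and where they are strictly larger the two adjacent slopes coincide. By summation by
  parts this gives the contraction properties of the Grenander estimator, and since an estimator close
  to \<open>p\<close> must drop wherever \<open>p\<close> does, it splits along the flat blocks of \<open>p\<close>. So on an event of
  probability tending to one the norms of the estimation errors equal, up to a uniformly small tail,
  Lipschitz functionals of \<open>Y\<^sub>n\<close> in \<open>\<ell>\<^sub>2\<close>. Convergence in law of such functionals follows from the
  one-dimensional central limit theorem, because trigonometric polynomials are dense (Stone and
  Weierstrass); convergence of moments follows from \<open>E \<parallel>Y\<^sub>n\<parallel>\<^sup>2\<^sup>q = O(1)\<close>.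

  Strictness: if \<open>p r = p (Suc r) > 0\<close>, the difference \<open>Y r - Y (Suc r)\<close> is independent of the
  process in which both coordinates are replaced by their average. With positive probability the
  latter is small (small ball) while the difference is very negative, and then \<open>gren\<close> does not
  see the difference at all.\<close>

section \<open>Least concave majorants of finite sums\<close>

text \<open>The norms are not continuous for coordinatewise convergence, which is all that a
  one-dimensional central limit theorem delivers. What rescues them is a bound on the second moment
  of coordinate \<open>x\<close> by \<open>p x\<close>, uniform in \<open>n\<close> and summable in
  \<open>x\<close>: up to a small error a Lipschitz functional depends on finitely many coordinates,
  and these stay in a compact cube with high probability. If the support is infinite, the drops of
  \<open>p\<close> have infimum zero, so the splitting along flat blocks is available only in front
  of a cut \<open>M\<close>; behind it, contraction bounds every error by the tail of the empirical
  process. Moments of all orders are needed because \<open>k\<close> is arbitrary; they come from a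
  recursion in \<open>n\<close> for the squared norm, whose increment has conditional mean at most
  one. No density or series expansion of the limit process is used: laws are compared through
  cosines of linear forms, and independence is realised by two copies on a product space.\<close>

text \<open>The optimality conditions for the Euclidean projection of \<open>w\<close> onto the
  vectors with \<open>g (Suc t) \<le> g t\<close> whenever \<open>Q t\<close>: the differences of
  partial sums are the multipliers and the third clause is complementary slackness. \<open>Q\<close>
  constantly true gives the slopes of the least concave majorant; \<open>Q = flat p\<close> gives
  the same operation inside each flat block and the identity elsewhere.\<close>

definition kkt :: "(nat \<Rightarrow> bool) \<Rightarrow> (nat \<Rightarrow> real) \<Rightarrow> (nat \<Rightarrow> real) \<Rightarrow> nat \<Rightarrow> bool" where
  "kkt Q w g m \<longleftrightarrow>
     (\<forall>t\<le>m. sum w {..<t} \<le> sum g {..<t}) \<and> sum g {..<m} = sum w {..<m} \<and>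
     (\<forall>t. Suc t < m \<longrightarrow> sum w {..<Suc t} < sum g {..<Suc t} \<longrightarrow> Q t \<and> g (Suc t) = g t) \<and>
     (\<forall>t. Suc t < m \<longrightarrow> Q t \<longrightarrow> g (Suc t) \<le> g t)"

lemma sum_lessThan_add: "sum f {..<a + (b::nat)} = sum f {..<a} + sum (\<lambda>x. f (a + x)) {..<b}"
  for f :: "nat \<Rightarrow> real"
  by (induction b) auto

text \<open>The first linear piece of the majorant ends at the prefix \<open>b\<close> with the
  largest average \<open>\<theta>\<close>; the remaining vector is treated by induction. The second
  conjunct is carried along for the junction: no prefix average of the remainder exceeds
  \<open>\<theta>\<close>, hence its first slope does not either.\<close>

lemma kkt_exists:
  "\<exists>g. kkt (\<lambda>_. True) w g m \<and>
     (\<forall>\<theta>::real. (\<forall>t\<le>m. sum w {..<t} \<le> \<theta> * t) \<longrightarrow> 0 < m \<longrightarrow> g 0 \<le> \<theta>)"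
proof (induction m arbitrary: w rule: less_induct)
  case (less m)
  show ?case
  proof (cases "m = 0")
    case True
    then show ?thesis by (auto simp: kkt_def)
  next
    case False
    define f where "f b = sum w {..<b} / real b" for b
    have "finite {1..m}" "{1..m} \<noteq> {}" using False by auto
    then have "Max (f ` {1..m}) \<in> f ` {1..m}" by (intro Max_in) auto
    then obtain b where b: "b \<in> {1..m}" and "f b = Max (f ` {1..m})" by auto
    then have b_max: "f t \<le> f b" if "t \<in> {1..m}" for t
      using that by simp
    define \<theta> where "\<theta> = f b"
    have Wb: "sum w {..<b} = \<theta> * b" using b by (auto simp: \<theta>_def f_def)
    have W: "sum w {..<t} \<le> \<theta> * t" if "t \<le> m" for t
    proof (cases "t = 0")
      case False
      then have "f t \<le> \<theta>" using b_max[of t] that by (auto simp: \<theta>_def)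
      then show ?thesis using False by (simp add: f_def field_simps)
    qed auto
    define w' where "w' x = w (b + x)" for x
    have w': "sum w' {..<t} = sum w {..<b + t} - \<theta> * b" for t
      by (simp add: sum_lessThan_add w'_def[abs_def] Wb)
    have "m - b < m" using b by auto
    from less.IH[OF this, of w'] obtain g' where g': "kkt (\<lambda>_. True) w' g' (m - b)"
      and g'0: "\<forall>\<theta>::real. (\<forall>t\<le>m-b. sum w' {..<t} \<le> \<theta> * t) \<longrightarrow> 0 < m - b \<longrightarrow> g' 0 \<le> \<theta>"
      by (elim exE conjE)
    have g'\<theta>: "g' 0 \<le> \<theta>" if "0 < m - b"
    proof -
      have "sum w' {..<t} \<le> \<theta> * t" if "t \<le> m - b" for t
        using that W[of "b + t"] b by (auto simp: w' algebra_simps)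
      then show ?thesis using g'0 that by simp
    qed
    define g where "g x = (if x < b then \<theta> else g' (x - b))" for x
    have G1: "sum g {..<t} = \<theta> * t" if "t \<le> b" for t
    proof -
      have "sum g {..<t} = sum (\<lambda>_. \<theta>) {..<t}" using that by (intro sum.cong) (auto simp: g_def)
      then show ?thesis by simp
    qed
    have G2: "sum g {..<b + t} = \<theta> * b + sum g' {..<t}" for t
      by (simp add: sum_lessThan_add G1) (simp add: g_def)
    have "kkt (\<lambda>_. True) w g m"
      unfolding kkt_def
    proof (intro conjI allI impI TrueI)
      fix t assume t: "t \<le> m"
      show "sum w {..<t} \<le> sum g {..<t}"
      proof (cases "t \<le> b")
        case True then show ?thesis using W t by (simp add: G1)
      next
        case False
        then obtain u where u: "t = b + u" by (metis le_add_diff_inverse nat_le_linear)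
        then have "sum w' {..<u} \<le> sum g' {..<u}" using g' t by (auto simp: kkt_def)
        then show ?thesis using w'[of u] G2[of u] u by simp
      qed
    next
      have "sum w' {..<m-b} = sum g' {..<m-b}" using g' by (auto simp: kkt_def)
      then show "sum g {..<m} = sum w {..<m}" using w'[of "m-b"] G2[of "m-b"] b by simp
    next
      fix t assume t: "Suc t < m" "sum w {..<Suc t} < sum g {..<Suc t}"
      consider "Suc t < b" | "Suc t = b" | "b < Suc t" by linarith
      then show "g (Suc t) = g t"
      proof cases
        case 1 then show ?thesis by (auto simp: g_def)
      next
        \<comment> \<open>At the junction both partial sums equal \<open>\<theta> * b\<close>, so
          the assumed strict inequality is contradictory.\<close>
        case 2 then show ?thesis using t G1[of b] Wb by simp
      next
        case 3
        then obtain u where u: "t = b + u" by (metis le_add_diff_inverse less_Suc_eq_le)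
        then have "sum w' {..<Suc u} < sum g' {..<Suc u}" 
          using t w'[of "Suc u"] G2[of "Suc u"] by simp
        moreover have "Suc u < m - b" using t u by auto
        ultimately have "g' (Suc u) = g' u" using g' unfolding kkt_def by blast
        then show ?thesis using u by (simp add: g_def)
      qed
    next
      fix t assume t: "Suc t < m"
      consider "Suc t < b" | "Suc t = b" | "b < Suc t" by linarith
      then show "g (Suc t) \<le> g t"
      proof cases
        case 1 then show ?thesis by (auto simp: g_def)
      next
        case 2 then show ?thesis using t g'\<theta> by (auto simp: g_def)
      next
        case 3
        then obtain u where u: "t = b + u" by (metis le_add_diff_inverse less_Suc_eq_le)
        moreover have "Suc u < m - b" using t u by auto
        ultimately have "g' (Suc u) \<le> g' u" using g' unfolding kkt_def by blast
        then show ?thesis using u by (simp add: g_def)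
      qed
    qed
    moreover have "g 0 \<le> \<theta>'" if "\<forall>t\<le>m. sum w {..<t} \<le> \<theta>' * t" for \<theta>' :: real
    proof -
      have "\<theta> * b \<le> \<theta>' * b" using that b Wb by auto
      then show ?thesis using b by (auto simp: g_def)
    qed
    ultimately show ?thesis by blast
  qed
qed

lemma sum_list_take_eq_sum: "t \<le> length w \<Longrightarrow> sum_list (take t w) = sum (nth w) {..<t}"
  by (simp add: sum_list_sum_nth atLeast0LessThan)

text \<open>The interpolant of the partial sums of \<open>g\<close> is concave and dominates the
  points. It is the least such function because around \<open>x\<close> it is linear between two
  abscissae where it meets the points, and a concave function lies above its chords.\<close>

lemma lcm_eq:
  fixes w :: "real list" and g :: "nat \<Rightarrow> real"
  assumes kkt: "kkt (\<lambda>_. True) (nth w) g (length w)"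
    and j: "j < length w" and x: "real j \<le> x" "x \<le> real (Suc j)"
  shows "least_concave_majorant (cum_points w) x = sum g {..<j} + (x - j) * g j"
proof -
  define m where "m = length w"
  define G where "G t = sum g {..<t}" for t
  define W where "W t = sum (nth w) {..<t}" for t
  have GS: "G (Suc t) = G t + g t" for t by (simp add: G_def)
  have WG: "W t \<le> G t" if "t \<le> m" for t
    using kkt that unfolding kkt_def W_def G_def m_def by blast
  have dec: "g t \<le> g s" if "s \<le> t" "t < m" for s t
    using that
  proof (induction t rule: dec_induct)
    case (step t)
    then have "g (Suc t) \<le> g t" using kkt by (auto simp: kkt_def m_def)
    then show ?case using step by auto
  qed auto
  define A where "A i y = G i + (y - real i) * g i" for i y
  have GA: "G t \<le> A i (real t)" if "i < m" "t \<le> m" for i t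
  proof (cases "i \<le> t")
    case True
    then show ?thesis using that(2)
    proof (induction t rule: dec_induct)
      case base then show ?case by (simp add: A_def)
    next
      case (step t)
      then show ?case using dec[of i t] GS[of t] by (auto simp: A_def algebra_simps)
    qed
  next
    case False
    then have "t \<le> i" by auto
    then show ?thesis
    proof (induction t rule: inc_induct)
      case base then show ?case by (simp add: A_def)
    next
      case (step t)
      then show ?case using dec[of t i] GS[of t] that by (auto simp: A_def algebra_simps)
    qed
  qed
  have AA: "A i' y \<le> A i y" if i: "i < m" "i' < m" and y: "real i' \<le> y" "y \<le> real (Suc i')" for i i' y
  proof -
    have 1: "A i' i' \<le> A i i'" using GA[of i i'] i by (simp add: A_def)
    have 2: "A i' (Suc i') \<le> A i (Suc i')" using GA[of i "Suc i'"] i by (simp add: A_def GS)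
    define s where "s = y - real i'"
    have s: "0 \<le> s" "s \<le> 1" using y by (auto simp: s_def)
    have *: "A l y = (1 - s) * A l i' + s * A l (Suc i')" for l
      by (simp add: A_def s_def algebra_simps)
    show ?thesis unfolding * using s 1 2 by (intro add_mono mult_left_mono) auto
  qed
  \<comment> \<open>Taking the minimum of all the lines, instead of gluing pieces, makes concavity
    immediate; by \<open>AA\<close> the minimum over the \<open>i\<close>-th interval is the
    \<open>i\<close>-th line.\<close>
  define L where "L y = Min ((\<lambda>i. A i y) ` {..<m})" for y
  have ne: "{..<m} \<noteq> {}" using j by (auto simp: m_def)
  have L_le: "L y \<le> A i y" if "i < m" for i y
    unfolding L_def using that by (intro Min_le) auto
  have L_eq: "L y = A i y" if "i < m" "real i \<le> y" "y \<le> real (Suc i)" for i y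
    unfolding L_def using AA that by (intro Min_eqI) auto
  have conc: "concave_on UNIV L"
    unfolding concave_on_iff
  proof (intro conjI ballI allI impI)
    fix y z u v :: real assume uv: "0 \<le> u" "0 \<le> v" "u + v = 1"
    have "u * L y + v * L z \<le> A i (u * y + v * z)" if "i < m" for i
    proof -
      have "A i (u * y + v * z) = u * A i y + v * A i z"
        using uv(3) unfolding A_def by algebra
      then show ?thesis using uv L_le[OF that] by (auto intro!: add_mono mult_left_mono)
    qed
    then show "u * L y + v * L z \<le> L (u *\<^sub>R y + v *\<^sub>R z)"
      using ne unfolding L_def by (subst Min_ge_iff) auto
  qed auto
  let ?H = "convex hull (fst ` cum_points w)"
  have inH: "real t \<in> ?H" if "t \<le> m" for t
    using that by (intro hull_inc) (force simp: cum_points_def m_def image_iff)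
  have LG: "L (real t) = G t" if "t \<le> m" for t
  proof (cases "t = m")
    case True
    then show ?thesis using ne L_eq[of "m-1" m] GS[of "m-1"] by (auto simp: A_def of_nat_diff Suc_leI)
  next
    case False then show ?thesis using that L_eq[of t t] by (auto simp: A_def)
  qed
  let ?S = "{h x | h. concave_on ?H h \<and> (\<forall>(u, v) \<in> cum_points w. v \<le> h u)}"
  have in_S: "A j x \<in> ?S"
  proof -
    have "\<forall>(u, v) \<in> cum_points w. v \<le> L u"
      by (use WG in \<open>auto simp: cum_points_def sum_list_take_eq_sum LG m_def W_def\<close>)
    moreover have "concave_on ?H L" 
      using conc unfolding concave_on_def by (rule convex_on_subset) auto
    moreover have "L x = A j x" using L_eq j x by (auto simp: m_def)
    ultimately show ?thesis unfolding mem_Collect_eq by (intro exI[of _ L]) auto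
  qed
  have low: "A j x \<le> h x" if h: "concave_on ?H h" "\<forall>(u, v) \<in> cum_points w. v \<le> h u" for h
  proof -
    have hW: "W t \<le> h t" if "t \<le> m" for t
    proof -
      have "(real t, sum_list (take t w)) \<in> cum_points w"
        unfolding cum_points_def mem_Collect_eq using that by (intro exI[of _ t]) (simp add: m_def)
      from bspec[OF h(2) this] have "sum_list (take t w) \<le> h t" by simp
      then show ?thesis using that by (simp add: W_def m_def sum_list_take_eq_sum)
    qed
    \<comment> \<open>\<open>T t\<close> marks a contact between the points and the majorant;
      \<open>a\<close> and \<open>b\<close> are the contacts nearest to the interval from
      \<open>j\<close> to \<open>Suc j\<close>. Strictly between them there is none, so slackness
      makes \<open>g\<close> constant there.\<close>
    define T where "T t \<longleftrightarrow> W t = G t" for t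
    have T0: "T 0" by (simp add: T_def W_def G_def)
    have Tm: "T m" using kkt by (auto simp: T_def W_def G_def m_def kkt_def)
    define a where "a = Max {t. t \<le> j \<and> T t}"
    have fin: "finite {t. t \<le> j \<and> T t}" by (rule finite_subset[of _ "{..j}"]) auto
    then have "a \<in> {t. t \<le> j \<and> T t}" unfolding a_def using T0 by (intro Max_in) auto
    then have a: "a \<le> j \<and> T a" by simp
    have a': "t \<le> a" if "t \<le> j" "T t" for t
      unfolding a_def using that fin by (intro Max_ge) auto
    define b where "b = (LEAST t. Suc j \<le> t \<and> T t)"
    have ex: "Suc j \<le> m \<and> T m" using Tm j by (simp add: m_def)
    have b: "Suc j \<le> b \<and> T b"
      unfolding b_def by (rule LeastI[where P = "\<lambda>t. Suc j \<le> t \<and> T t", OF ex])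
    have b': "b \<le> t" if "Suc j \<le> t" "T t" for t
      unfolding b_def by (rule Least_le[where P = "\<lambda>t. Suc j \<le> t \<and> T t"]) (use that in simp)
    have bm: "b \<le> m" using b'[of m] Tm j by (auto simp: m_def)
    have gS: "g (Suc t) = g t" if "a \<le> t" "Suc t < b" for t
    proof -
      have "\<not> T (Suc t)" using a'[of "Suc t"] b'[of "Suc t"] that by (cases "Suc t \<le> j") auto
      moreover have "W (Suc t) \<le> G (Suc t)" using WG that bm by simp
      ultimately have "W (Suc t) < G (Suc t)" by (auto simp: T_def)
      then show ?thesis using kkt that bm by (auto simp: kkt_def W_def G_def m_def)
    qed
    have ga: "g t = g a" if "a \<le> t" "t < b" for t
      using that by (induction t rule: dec_induct) (use gS in auto)
    have Ga: "G t = G a + (real t - a) * g a" if "a \<le> t" "t \<le> b" for t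
      using that
    proof (induction t rule: dec_induct)
      case (step t)
      then show ?case using ga[of t] by (simp add: GS algebra_simps)
    qed simp
    have gj: "g j = g a" using ga[of j] a b by auto
    have Aa: "A j y = G a + (y - a) * g a" for y
      using Ga[of j] a b by (simp add: A_def gj algebra_simps)
    have ab: "real a < real b" using a b by auto
    define s where "s = (x - a) / (real b - a)"
    have s: "0 \<le> s" "s \<le> 1" using x a b ab by (auto simp: s_def field_simps)
    have sba: "s * (real b - a) = x - a" using ab by (simp add: s_def)
    then have xs: "x = (1 - s) * a + s * b" by (simp add: algebra_simps)
    have "h ((1 - s) *\<^sub>R real a + s *\<^sub>R real b) \<ge> (1 - s) * h a + s * h b"
      using h(1) s inH[of a] inH[of b] a b bm j unfolding concave_on_iff by (auto simp: m_def)
    moreover have "(1 - s) * h a + s * h b \<ge> (1 - s) * G a + s * G b"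
      using hW[of a] hW[of b] a b bm j s by (intro add_mono mult_left_mono) (auto simp: T_def m_def)
    moreover have "(1 - s) * G a + s * G b = A j x"
    proof -
      have "G b = G a + (real b - real a) * g a" using Ga[of b] a b by simp
      then have "(1 - s) * G a + s * G b = G a + (s * (real b - a)) * g a" by algebra
      then show ?thesis by (simp add: sba Aa)
    qed
    ultimately show ?thesis using xs by simp
  qed
  have "Inf ?S = A j x"
    using in_S low by (intro cInf_eq_minimum) auto
  then show ?thesis by (simp add: least_concave_majorant_def A_def G_def)
qed

text \<open>A left derivative depends only on the value at the point and on a left neighbourhood,
  and there the majorant is the line with slope \<open>g j\<close>.\<close>

lemma gren_nth_eq:
  assumes kkt: "kkt (\<lambda>_. True) (nth w) g (length w)" and j: "j < length w"
  shows "gren w ! j = g j"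
proof -
  let ?f = "least_concave_majorant (cum_points w)" and ?x = "real (Suc j)"
  let ?A = "\<lambda>x::real. sum g {..<j} + (x - j) * g j"
  have eq: "?f y = ?A y" if "real j \<le> y" "y \<le> ?x" for y
    using lcm_eq[OF kkt j] that by auto
  have "(?A has_real_derivative g j) (at_left ?x)"
    by (auto intro!: derivative_eq_intros)
  moreover have "\<forall>\<^sub>F y in at_left ?x. ?f y = ?A y"
    using eq by (subst eventually_at_left[of "real j"]) (auto intro!: exI[of _ "real j"])
  ultimately have D: "(?f has_real_derivative g j) (at_left ?x)"
    using eq[of ?x] by (subst has_field_derivative_cong_eventually) auto
  have "left_slope ?f ?x = g j"
    unfolding left_slope_def
    by (rule the_equality) (use D in \<open>auto intro: has_field_derivative_unique\<close>)
  then show ?thesis using j by (simp add: gren_def)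
qed

lemma length_gren [simp]: "length (gren w) = length w"
  by (simp add: gren_def)

lemma kkt_gren: "kkt (\<lambda>_. True) (nth w) (nth (gren w)) (length w)"
proof -
  obtain g where g: "kkt (\<lambda>_. True) (nth w) g (length w)" using kkt_exists by blast
  have "gren w ! j = g j" if "j < length w" for j using gren_nth_eq[OF g that] .
  then have "sum (nth (gren w)) {..<t} = sum g {..<t}" if "t \<le> length w" for t
    using that by (intro sum.cong) auto
  then show ?thesis using g gren_nth_eq[OF g] unfolding kkt_def by (simp del: sum.lessThan_Suc)
qed

section \<open>Projection inequalities by summation by parts\<close>

lemma sum_abel:
  fixes c d :: "nat \<Rightarrow> real"
  shows "(\<Sum>i<Suc n. c i * d i) =
    c n * sum d {..<Suc n} - (\<Sum>i<n. (c (Suc i) - c i) * sum d {..<Suc i})"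
  by (induction n) (auto simp: algebra_simps)

text \<open>Summation by parts turns the sum into increments of \<open>c\<close> times differences
  of partial sums. Such a difference is nonzero only at a tie of \<open>g\<close> where
  \<open>Q\<close> holds, and there \<open>c\<close> is assumed not to decrease. Different choices
  of \<open>c\<close> yield all the contraction properties.\<close>

lemma kkt_inner_nonneg:
  assumes kkt: "kkt Q w g m"
    and c: "\<And>t. \<lbrakk>Suc t < m; Q t; g (Suc t) = g t\<rbrakk> \<Longrightarrow> c t \<le> c (Suc t)"
  shows "0 \<le> (\<Sum>i<m. c i * (w i - g i))"
proof (cases m)
  case (Suc n)
  let ?D = "\<lambda>t. sum (\<lambda>i. w i - g i) {..<t}"
  have D: "?D t = sum w {..<t} - sum g {..<t}" for t by (simp add: sum_subtractf)
  have "(c (Suc i) - c i) * ?D (Suc i) \<le> 0" if "i < n" for i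
  proof (cases "sum w {..<Suc i} < sum g {..<Suc i}")
    case True
    have "Suc i < m" using that Suc by simp
    then have "Q i \<and> g (Suc i) = g i" using kkt True unfolding kkt_def by blast
    then have "c i \<le> c (Suc i)" using c that Suc by simp
    then show ?thesis unfolding D using True by (intro mult_nonneg_nonpos) auto
  next
    case False
    have "Suc i \<le> m" using that Suc by simp
    then have "sum w {..<Suc i} \<le> sum g {..<Suc i}" using kkt unfolding kkt_def by blast
    then show ?thesis unfolding D using False by (simp del: sum.lessThan_Suc)
  qed
  then have "(\<Sum>i<n. (c (Suc i) - c i) * ?D (Suc i)) \<le> 0"
    by (intro sum_nonpos) auto
  moreover have "?D (Suc n) = 0" unfolding D using kkt Suc by (simp add: kkt_def)
  ultimately show ?thesis unfolding Suc sum_abel by (simp del: sum.lessThan_Suc)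
qed simp

text \<open>Here \<open>c\<close> is the subgradient at \<open>g\<close>. It takes equal values
  across a tie of \<open>g\<close>, so the assumption on \<open>c\<close> holds trivially.\<close>

lemma kkt_convex:
  assumes kkt: "kkt Q w g m" and s: "\<And>x y. \<phi> x + s x * (y - x) \<le> \<phi> y"
  shows "(\<Sum>i<m. \<phi> (g i)) \<le> (\<Sum>i<m. \<phi> (w i :: real) :: real)"
proof -
  have "0 \<le> (\<Sum>i<m. s (g i) * (w i - g i))"
    by (rule kkt_inner_nonneg[OF kkt]) simp
  also have "\<dots> \<le> (\<Sum>i<m. \<phi> (w i) - \<phi> (g i))"
    using s by (intro sum_mono) (simp add: le_diff_eq add.commute)
  finally show ?thesis by (simp add: sum_subtractf)
qed

text \<open>Here \<open>c\<close> is \<open>2 * (g - v)\<close>: across a tie of \<open>g\<close> it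
  grows by \<open>2 * (v t - v (Suc t))\<close>, which is nonnegative because \<open>v\<close> obeys
  the order constraints.\<close>

lemma kkt_sq_dist_le:
  assumes kkt: "kkt Q w g m" and v: "\<And>t. Suc t < m \<Longrightarrow> Q t \<Longrightarrow> v (Suc t) \<le> v t"
  shows "(\<Sum>i<m. (g i - v i)\<^sup>2) \<le> (\<Sum>i<m. (w i - v i)\<^sup>2)"
proof -
  have "0 \<le> (\<Sum>i<m. (2 * (g i - v i)) * (w i - g i))"
    by (rule kkt_inner_nonneg[OF kkt]) (use v in auto)
  also have "\<dots> \<le> (\<Sum>i<m. (w i - v i)\<^sup>2 - (g i - v i)\<^sup>2)"
  proof (rule sum_mono)
    fix i
    have "(w i - v i)\<^sup>2 - (g i - v i)\<^sup>2 - 2 * (g i - v i) * (w i - g i) = (w i - g i)\<^sup>2"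
      by (simp add: power2_eq_square algebra_simps)
    then show "2 * (g i - v i) * (w i - g i) \<le> (w i - v i)\<^sup>2 - (g i - v i)\<^sup>2"
      by (smt (verit) zero_le_power2)
  qed
  finally show ?thesis by (simp add: sum_subtractf)
qed

text \<open>Each projection serves as the comparison vector for the other, as for the projection
  onto any closed convex set; the two inequalities are added.\<close>

lemma kkt_nonexpansive:
  assumes kkt: "kkt Q w g m" and kkt': "kkt Q w' g' m"
  shows "(\<Sum>i<m. (g i - g' i)\<^sup>2) \<le> (\<Sum>i<m. (w i - w' i)\<^sup>2)"
proof -
  have 1: "0 \<le> (\<Sum>i<m. (2 * (g i - g' i)) * (w i - g i))"
    by (rule kkt_inner_nonneg[OF kkt]) (use kkt' in \<open>auto simp: kkt_def\<close>)
  have 2: "0 \<le> (\<Sum>i<m. (2 * (g' i - g i)) * (w' i - g' i))"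
    by (rule kkt_inner_nonneg[OF kkt']) (use kkt in \<open>auto simp: kkt_def\<close>)
  have "(\<Sum>i<m. (2 * (g i - g' i)) * (w i - g i)) + (\<Sum>i<m. (2 * (g' i - g i)) * (w' i - g' i))
     \<le> (\<Sum>i<m. (w i - w' i)\<^sup>2 - (g i - g' i)\<^sup>2)"
    unfolding sum.distrib[symmetric]
  proof (rule sum_mono)
    fix i
    have "(w i - w' i)\<^sup>2 - (g i - g' i)\<^sup>2 - (2 * (g i - g' i) * (w i - g i) + 2 * (g' i - g i) * (w' i - g' i))
        = (w i - w' i - (g i - g' i))\<^sup>2"
      by (simp add: power2_eq_square algebra_simps)
    then show "2 * (g i - g' i) * (w i - g i) + 2 * (g' i - g i) * (w' i - g' i)
        \<le> (w i - w' i)\<^sup>2 - (g i - g' i)\<^sup>2"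
      by (smt (verit) zero_le_power2)
  qed
  with 1 2 show ?thesis by (simp add: sum_subtractf)
qed

lemma kkt_unique:
  assumes "kkt Q w g m" "kkt Q w g' m" "i < m"
  shows "g i = g' i"
proof -
  have "(\<Sum>i<m. (g i - g' i)\<^sup>2) \<le> 0" using kkt_nonexpansive[OF assms(1,2)] by simp
  then have "(\<Sum>i<m. (g i - g' i)\<^sup>2) = 0" by (simp add: antisym sum_nonneg)
  then show ?thesis using assms(3) by (simp add: sum_nonneg_eq_0_iff)
qed

section \<open>Cutting and gluing at contact points\<close>

lemma kkt_cong:
  assumes "\<And>t. Suc t < m \<Longrightarrow> Q t = Q' t" "\<And>i. i < m \<Longrightarrow> w i = w' i" "\<And>i. i < m \<Longrightarrow> g i = g' i"
  shows "kkt Q w g m = kkt Q' w' g' m"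
proof -
  have w: "sum w {..<t} = sum w' {..<t}" if "t \<le> m" for t using that assms(2) by (intro sum.cong) auto
  have g: "sum g {..<t} = sum g' {..<t}" if "t \<le> m" for t using that assms(3) by (intro sum.cong) auto
  show ?thesis using assms w g by (auto simp: kkt_def simp del: sum.lessThan_Suc)
qed

text \<open>Two solutions may be juxtaposed if no order constraint links \<open>a - 1\<close> to
  \<open>a\<close>. The partial sums of the first one agree at \<open>a\<close>, so slackness asks
  nothing at the junction.\<close>

lemma kkt_append:
  assumes 1: "kkt Q w g a" and 2: "kkt (\<lambda>t. Q (a + t)) (\<lambda>i. w (a + i)) (\<lambda>i. g (a + i)) b"
    and Q: "a = 0 \<or> \<not> Q (a - 1)"
  shows "kkt Q w g (a + b)"
proof -
  have Wa: "sum g {..<a} = sum w {..<a}" using 1 by (simp add: kkt_def)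
  have d: "sum g {..<a + t} - sum w {..<a + t} = (\<Sum>i<t. g (a + i)) - (\<Sum>i<t. w (a + i))" for t
    by (simp add: sum_lessThan_add Wa)
  show ?thesis unfolding kkt_def
  proof (intro conjI allI impI)
    fix t assume t: "t \<le> a + b"
    show "sum w {..<t} \<le> sum g {..<t}"
    proof (cases "t \<le> a")
      case True then show ?thesis using 1 by (simp add: kkt_def)
    next
      case False
      then obtain u where u: "t = a + u" by (metis le_add_diff_inverse nat_le_linear)
      then have "(\<Sum>i<u. w (a + i)) \<le> (\<Sum>i<u. g (a + i))" using 2 t by (simp add: kkt_def)
      then show ?thesis using d[of u] u by simp
    qed
  next
    show "sum g {..<a + b} = sum w {..<a + b}" using 2 d[of b] by (simp add: kkt_def)
  next
    fix t assume t: "Suc t < a + b" "sum w {..<Suc t} < sum g {..<Suc t}"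
    consider "Suc t < a" | "Suc t = a" | "a \<le> t" by linarith
    then have "Q t \<and> g (Suc t) = g t"
    proof cases
      case 1
      then show ?thesis using assms(1) t unfolding kkt_def by blast
    next
      case 2
      then show ?thesis using Wa t by simp
    next
      case 3
      then obtain u where u: "t = a + u" by (metis le_add_diff_inverse)
      have "(\<Sum>i<Suc u. w (a + i)) < (\<Sum>i<Suc u. g (a + i))" using t d[of "Suc u"] u by simp
      moreover have "Suc u < b" using t u by simp
      ultimately have "Q (a + u) \<and> g (a + Suc u) = g (a + u)" using 2 unfolding kkt_def by blast
      then show ?thesis using u by simp
    qed
    then show "Q t" "g (Suc t) = g t" by auto
  next
    fix t assume t: "Suc t < a + b" "Q t"
    consider "Suc t < a" | "Suc t = a" | "a \<le> t" by linarith
    then show "g (Suc t) \<le> g t"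
    proof cases
      case 1
      then show ?thesis using assms(1) t unfolding kkt_def by blast
    next
      case 2
      then show ?thesis using Q t by auto
    next
      case 3
      then obtain u where u: "t = a + u" by (metis le_add_diff_inverse)
      moreover have "Suc u < b" using t u by simp
      ultimately have "g (a + Suc u) \<le> g (a + u)" using 2 t unfolding kkt_def by blast
      then show ?thesis using u by simp
    qed
  qed
qed

text \<open>Contact at \<open>M\<close> lets the contributions in front of \<open>M\<close> cancel,
  so the rest solves the same problem on its own.\<close>

lemma kkt_drop:
  assumes kkt: "kkt Q w g m" and "M \<le> m" and M: "sum g {..<M} = sum w {..<M}"
  shows "kkt (\<lambda>t. Q (M + t)) (\<lambda>i. w (M + i)) (\<lambda>i. g (M + i)) (m - M)"
proof -
  have d: "sum g {..<M + t} - sum w {..<M + t} = (\<Sum>i<t. g (M + i)) - (\<Sum>i<t. w (M + i))" for t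
    by (simp add: sum_lessThan_add M)
  show ?thesis unfolding kkt_def
  proof (intro conjI allI impI)
    fix t assume "t \<le> m - M"
    then have "M + t \<le> m" using assms(2) by simp
    then have "sum w {..<M + t} \<le> sum g {..<M + t}" using kkt by (simp add: kkt_def)
    then show "(\<Sum>i<t. w (M + i)) \<le> (\<Sum>i<t. g (M + i))" using d[of t] by simp
  next
    show "(\<Sum>i<m - M. g (M + i)) = (\<Sum>i<m - M. w (M + i))" 
      using kkt assms(2) d[of "m - M"] by (simp add: kkt_def)
  next
    fix t assume t: "Suc t < m - M" "(\<Sum>i<Suc t. w (M + i)) < (\<Sum>i<Suc t. g (M + i))"
    have "sum w {..<Suc (M + t)} < sum g {..<Suc (M + t)}" using t d[of "Suc t"] by simp
    moreover have "Suc (M + t) < m" using t by simp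
    ultimately have "Q (M + t) \<and> g (Suc (M + t)) = g (M + t)" using kkt unfolding kkt_def by blast
    then show "Q (M + t)" "g (M + Suc t) = g (M + t)" by auto
  next
    fix t assume t: "Suc t < m - M" "Q (M + t)"
    then have "Suc (M + t) < m" by simp
    then have "g (Suc (M + t)) \<le> g (M + t)" using kkt t unfolding kkt_def by blast
    then show "g (M + Suc t) \<le> g (M + t)" by simp
  qed
qed

text \<open>The bridge from the estimator to the limit functional. Subtracting \<open>p\<close>
  preserves ties and order only where \<open>p\<close> is constant; hence \<open>Q\<close> may hold
  only there, and contact of the partial sums is required wherever \<open>Q\<close> fails.\<close>

lemma kkt_affine:
  assumes kkt: "kkt (\<lambda>_. True) w g m" and "M \<le> m" and M: "sum g {..<M} = sum w {..<M}"
    and a: "0 < (a::real)"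
    and Q: "\<And>t. \<lbrakk>Suc t < M; sum w {..<Suc t} < sum g {..<Suc t}\<rbrakk> \<Longrightarrow> Q t"
    and p: "\<And>t. Q t \<Longrightarrow> p (Suc t) = p t"
  shows "kkt Q (\<lambda>i. a * (w i - p i)) (\<lambda>i. a * (g i - p i)) M"
proof -
  have s: "(\<Sum>i<t. a * (f i - p i)) = a * (sum f {..<t} - sum p {..<t})" for f t
    by (simp add: sum_subtractf sum_distrib_left[symmetric])
  show ?thesis unfolding kkt_def s
  proof (intro conjI allI impI)
    fix t assume "t \<le> M"
    then have "sum w {..<t} \<le> sum g {..<t}" using kkt assms(2) by (simp add: kkt_def)
    then show "a * (sum w {..<t} - sum p {..<t}) \<le> a * (sum g {..<t} - sum p {..<t})" using a by simp
  next
    show "a * (sum g {..<M} - sum p {..<M}) = a * (sum w {..<M} - sum p {..<M})" by (simp add: M)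
  next
    fix t assume t: "Suc t < M"
      "a * (sum w {..<Suc t} - sum p {..<Suc t}) < a * (sum g {..<Suc t} - sum p {..<Suc t})"
    then have lt: "sum w {..<Suc t} < sum g {..<Suc t}" 
      using a unfolding mult_less_cancel_left_pos[OF a] by simp
    then show "Q t" using Q t by blast
    then have "p (Suc t) = p t" using p by blast
    moreover have "g (Suc t) = g t" using kkt lt t assms(2) unfolding kkt_def by simp
    ultimately show "a * (g (Suc t) - p (Suc t)) = a * (g t - p t)" by simp
  next
    fix t assume t: "Suc t < M" "Q t"
    then have "g (Suc t) \<le> g t" using kkt assms(2) unfolding kkt_def by simp
    then show "a * (g (Suc t) - p (Suc t)) \<le> a * (g t - p t)" using p t a by simp
  qed
qed

section \<open>Flat blocks of \<open>p\<close>\<close>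

text \<open>Positivity excludes the region where a nonnegative \<open>p\<close> vanishes:
  \<open>p\<close> is constant there but does not drop afterwards, so no \<open>flat_block\<close>
  lies in it and \<open>gren_blocks\<close> leaves it alone.\<close>

definition flat :: "(nat \<Rightarrow> real) \<Rightarrow> nat \<Rightarrow> bool" where
  "flat p t \<longleftrightarrow> p (Suc t) = p t \<and> 0 < p t"

lemma monotone_decreasing_le:
  assumes "monotone_decreasing p" "i \<le> j"
  shows "p j \<le> p i"
  by (rule lift_Suc_antimono_le[OF _ assms(2)]) (use assms(1) in \<open>simp add: monotone_decreasing_def\<close>)

lemma flat_block_const: "flat_block p r s \<Longrightarrow> y \<in> {r..s} \<Longrightarrow> p y = p r"
  unfolding flat_block_def by blast

lemma flat_block_unique:
  assumes p: "monotone_decreasing p" and "flat_block p r s" "flat_block p r' s'"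
    and "x \<in> {r..s}" "x \<in> {r'..s'}"
  shows "r' = r \<and> s' = s"
proof -
  have anti: "p j \<le> p i" if "i \<le> j" for i j
    using monotone_decreasing_le[OF p that] .
  have *: "r' \<le> r \<and> s \<le> s'" if b: "flat_block p r s" "flat_block p r' s'" "x \<in> {r..s}" "x \<in> {r'..s'}"
    for r s r' s'
  proof -
    have r: "p y = p x" if "y \<in> {r..s}" for y
      using flat_block_const[OF b(1) that] flat_block_const[OF b(1,3)] by simp
    have r': "p y = p x" if "y \<in> {r'..s'}" for y
      using flat_block_const[OF b(2) that] flat_block_const[OF b(2,4)] by simp
    have "r' \<le> r"
    proof (rule ccontr)
      assume "\<not> r' \<le> r"
      moreover from this have "r' - 1 \<in> {r..s}" "r' \<in> {r..s}" using b by auto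
      ultimately have "p (r' - 1) = p r'" using r[of "r' - 1"] r[of r'] by simp
      then show False using b(2) \<open>\<not> r' \<le> r\<close> by (auto simp: flat_block_def)
    qed
    moreover have "s \<le> s'"
    proof (rule ccontr)
      assume "\<not> s \<le> s'"
      then have "Suc s' \<in> {r..s}" "s' \<in> {r..s}" using b by auto
      then have "p (Suc s') = p s'" using r[of "Suc s'"] r[of s'] by simp
      then show False using b(2) by (auto simp: flat_block_def)
    qed
    ultimately show ?thesis by simp
  qed
  show ?thesis using *[OF assms(2-5)] *[OF assms(3,2,5,4)] by simp
qed

lemma gren_blocks_in:
  assumes p: "monotone_decreasing p" and b: "flat_block p r s" "x \<in> {r..s}"
  shows "gren_blocks p z x = gren (map z [r..<Suc s]) ! (x - r)"
proof -
  have "(THE (r, s). flat_block p r s \<and> x \<in> {r..s}) = (r, s)"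
  proof (rule the_equality)
    show "case (r, s) of (r, s) \<Rightarrow> flat_block p r s \<and> x \<in> {r..s}" using b by simp
  next
    fix q assume "case q of (r, s) \<Rightarrow> flat_block p r s \<and> x \<in> {r..s}"
    then show "q = (r, s)"
      using flat_block_unique[OF p b(1) _ b(2), of "fst q" "snd q"] by (cases q) auto
  qed
  then show ?thesis using b unfolding gren_blocks_def by (auto simp del: upt_Suc)
qed

text \<open>The last block in front of \<open>m\<close> is split off and appended to a shorter
  solution. The condition on \<open>m\<close> ensures that no block is severed.\<close>

lemma kkt_gren_blocks:
  assumes p: "monotone_decreasing p" "\<And>x. 0 \<le> p x" and m: "m = 0 \<or> \<not> flat p (m - 1)"
  shows "kkt (flat p) z (gren_blocks p z) m"
  using m
proof (induction m rule: less_induct)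
  case (less m)
  have anti: "p j \<le> p i" if "i \<le> j" for i j
    using monotone_decreasing_le[OF p(1) that] .
  show ?case
  proof (cases "m = 0")
    case True then show ?thesis by (simp add: kkt_def)
  next
    case False
    then obtain n where n: "m = Suc n" by (cases m) auto
    have nf: "\<not> flat p n" using less.prems n by simp
    \<comment> \<open>The left end of the level set of \<open>n\<close>. Where \<open>p\<close>
      vanishes every index counts as a block of its own, in accordance with the positivity in
      \<open>flat\<close>.\<close>
    define c where "c = (if p n = 0 then n else (LEAST x. p x = p n))"
    have c: "c \<le> n" "p c = p n" unfolding c_def by (auto intro: Least_le LeastI)
    have const: "p x = p n" if "c \<le> x" "x \<le> n" for x
      using anti[OF that(1)] anti[OF that(2)] c by simp
    have c0: "c = 0 \<or> \<not> flat p (c - 1)"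
    proof (rule ccontr)
      assume A: "\<not> (c = 0 \<or> \<not> flat p (c - 1))"
      then have "p (c - 1) = p n" "p n \<noteq> 0" using c by (auto simp: flat_def)
      then have "(LEAST x. p x = p n) \<le> c - 1" by (intro Least_le)
      then show False using A \<open>p n \<noteq> 0\<close> by (auto simp: c_def)
    qed
    have IH: "kkt (flat p) z (gren_blocks p z) c" using less.IH[of c] c n c0 by simp
    have "kkt (\<lambda>t. flat p (c + t)) (\<lambda>i. z (c + i)) (\<lambda>i. gren_blocks p z (c + i)) (m - c)"
    proof (cases "c < n")
      case True
      then have pn: "p n \<noteq> 0" by (auto simp: c_def)
      have fb: "flat_block p c n"
        unfolding flat_block_def
      proof (intro conjI ballI)
        show "c = 0 \<or> p c < p (c - 1)"
          using c0 anti[of "c - 1" c] pn p(2)[of n] c by (cases c) (auto simp: flat_def less_le)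
        show "p (Suc n) < p n" using nf pn p(2)[of n] anti[of n "Suc n"] by (auto simp: flat_def)
        show "c < n" by (rule True)
        show "p x = p c" if "x \<in> {c..n}" for x using const[of x] that c by simp
      qed
      let ?w = "map z [c..<Suc n]"
      have len: "length ?w = m - c" using n c by simp
      have "kkt (\<lambda>_. True) (nth ?w) (nth (gren ?w)) (m - c)" using kkt_gren[of ?w] len by simp
      also have "?this = kkt (\<lambda>t. flat p (c + t)) (\<lambda>i. z (c + i)) (\<lambda>i. gren_blocks p z (c + i)) (m - c)"
      proof (rule kkt_cong)
        fix t assume "Suc t < m - c"
        then show "True = flat p (c + t)" 
          using const[of "c + t"] const[of "Suc (c + t)"] n pn p(2)[of n] by (simp add: flat_def)
      next
        fix i assume "i < m - c"
        then show "?w ! i = z (c + i)" using n by (simp del: upt_Suc)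
        show "gren ?w ! i = gren_blocks p z (c + i)"
          using gren_blocks_in[OF p(1) fb, of "c + i"] \<open>i < m - c\<close> n by (simp del: upt_Suc)
      qed
      finally show ?thesis .
    next
      case False
      then have cn: "c = n" using c by simp
      have "\<not> (\<exists>r s. flat_block p r s \<and> n \<in> {r..s})"
      proof clarify
        fix r s assume fb: "flat_block p r s" and rs: "n \<in> {r..s}"
        have eq: "p x = p n" if "x \<in> {r..s}" for x
          using flat_block_const[OF fb that] flat_block_const[OF fb rs] by simp
        have "p (Suc s) < p s" using fb unfolding flat_block_def by blast
        then have pos: "p n > 0"
          using eq[of s] rs p(2)[of "Suc s"] by simp
        have "s = n"
        proof (rule ccontr)
          assume "s \<noteq> n"
          then have "p (Suc n) = p n" using eq[of "Suc n"] rs by auto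
          then show False using nf pos by (simp add: flat_def)
        qed
        then have "(LEAST x. p x = p n) \<le> r" using eq[of r] rs by (intro Least_le) auto
        moreover have "r < n" using fb \<open>s = n\<close> by (auto simp: flat_block_def)
        ultimately show False using cn pos by (auto simp: c_def)
      qed
      then have "gren_blocks p z n = z n" unfolding gren_blocks_def by (simp only: if_False)
      then show ?thesis using cn n by (auto simp: kkt_def le_Suc_eq)
    qed
    from kkt_append[OF IH this c0] show ?thesis using c n by simp
  qed
qed

text \<open>If \<open>p\<close> were flat from \<open>m\<close> on, it would be constant and
  positive there, against its limit zero.\<close>

lemma cut_exists:
  assumes p: "p \<longlonglongrightarrow> (0::real)" "\<And>x. 0 \<le> p x"
  shows "\<exists>M\<ge>m. \<not> flat p (M - 1) \<and> 0 < M"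
proof (rule ccontr)
  assume "\<not> ?thesis"
  then have *: "flat p t" if "t \<ge> m" for t using that by (metis diff_Suc_1 le_SucI zero_less_Suc)
  have "p t = p m" if "t \<ge> m" for t
    using that
  proof (induction t rule: dec_induct)
    case (step t)
    then show ?case using *[of t] by (simp add: flat_def)
  qed simp
  then have "p \<longlonglongrightarrow> p m"
    by (intro tendsto_eventually) (rule eventually_sequentiallyI)
  then have "p m = 0" using p LIMSEQ_unique by blast
  then show False using *[of m] by (simp add: flat_def)
qed

section \<open>Norms of square-summable sequences\<close>

definition l2 :: "(nat \<Rightarrow> real) \<Rightarrow> real" where
  "l2 v = sqrt (\<Sum>x. (v x)\<^sup>2)"

abbreviation sq_summable :: "(nat \<Rightarrow> real) \<Rightarrow> bool" where
  "sq_summable v \<equiv> summable (\<lambda>x. (v x)\<^sup>2)"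

lemma l2_nonneg: "sq_summable v \<Longrightarrow> 0 \<le> l2 v"
  by (simp add: l2_def suminf_nonneg)

lemma l2_sq: "sq_summable v \<Longrightarrow> (l2 v)\<^sup>2 = (\<Sum>x. (v x)\<^sup>2)"
  by (simp add: l2_def suminf_nonneg)

lemma abs_le_l2:
  assumes "sq_summable v" shows "\<bar>v x\<bar> \<le> l2 v"
proof -
  have "(\<Sum>y\<in>{x}. (v y)\<^sup>2) \<le> (\<Sum>x. (v x)\<^sup>2)" by (rule sum_le_suminf) (use assms in auto)
  then have "sqrt ((v x)\<^sup>2) \<le> l2 v" unfolding l2_def by (intro real_sqrt_le_mono) simp
  then show ?thesis by simp
qed

lemma sq_summable_diff:
  assumes "sq_summable u" "sq_summable v"
  shows "sq_summable (\<lambda>x. u x - v x)"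
proof (rule summable_comparison_test')
  show "summable (\<lambda>x. 2 * (u x)\<^sup>2 + 2 * (v x)\<^sup>2)" using assms by (intro summable_add summable_mult)
  fix x
  have "0 \<le> (u x + v x)\<^sup>2" by simp
  then have "(u x - v x)\<^sup>2 \<le> 2 * (u x)\<^sup>2 + 2 * (v x)\<^sup>2"
    by (simp add: power2_eq_square algebra_simps)
  then show "norm ((u x - v x)\<^sup>2) \<le> 2 * (u x)\<^sup>2 + 2 * (v x)\<^sup>2" by simp
qed

lemma sq_summable_add:
  assumes "sq_summable u" "sq_summable v"
  shows "sq_summable (\<lambda>x. u x + v x)"
  using sq_summable_diff[of u "\<lambda>x. - v x"] assms by simp

lemma sq_summable_cmult: "sq_summable v \<Longrightarrow> sq_summable (\<lambda>x. c * v x)" for c :: real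
  by (simp add: power_mult_distrib summable_mult)

lemma sq_summable_finite_support:
  "(\<And>x. x \<ge> m \<Longrightarrow> v x = (0::real)) \<Longrightarrow> sq_summable v"
  by (rule summable_finite[of "{..<m}"]) (auto simp: not_less)

lemma ereal_ge_2_cases:
  fixes k :: ereal
  assumes "2 \<le> k"
  obtains "k = \<infinity>" | K where "2 \<le> K" "k = ereal K"
  using assms by (cases k) auto

lemma lnorm_ereal: "lnorm (ereal K) v = (\<Sum>x. \<bar>v x\<bar> powr K) powr (1 / K)"
  by (simp add: lnorm_def)

lemma lnorm_inf: "lnorm \<infinity> v = (SUP x. \<bar>v x\<bar>)"
  by (simp add: lnorm_def)

lemma lnorm_2:
  assumes "sq_summable v" shows "lnorm 2 v = l2 v"
proof -
  have sq: "\<bar>v x\<bar> powr 2 = (v x)\<^sup>2" for x by (simp add: powr_numeral)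
  have "lnorm 2 v = lnorm (ereal 2) v" by simp
  also have "\<dots> = l2 v"
    unfolding lnorm_ereal l2_def sq using assms by (simp add: powr_half_sqrt suminf_nonneg)
  finally show ?thesis .
qed

text \<open>Reduces every exponent \<open>K \<ge> 2\<close> to the square for bounded entries; this
  is how square summability controls all the norms.\<close>

lemma powr_le_sq:
  fixes a B K :: real
  assumes "0 \<le> a" "a \<le> B" "2 \<le> K" shows "a powr K \<le> B powr (K - 2) * a\<^sup>2"
proof (cases "a = 0")
  case False
  have "a powr K = a powr (K - 2) * a powr 2" using powr_add[of a "K - 2" 2] by simp
  also have "a powr (K - 2) \<le> B powr (K - 2)" using assms by (intro powr_mono2) auto
  finally show ?thesis using False assms by (simp add: powr_numeral mult_right_mono)
qed simp

lemma summable_powr: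
  assumes "sq_summable v" "2 \<le> K" shows "summable (\<lambda>x. \<bar>v x\<bar> powr K)"
proof (rule summable_comparison_test')
  show "summable (\<lambda>x. l2 v powr (K - 2) * (v x)\<^sup>2)" using assms by (intro summable_mult)
  show "norm (\<bar>v x\<bar> powr K) \<le> l2 v powr (K - 2) * (v x)\<^sup>2" for x
    using powr_le_sq[of "\<bar>v x\<bar>" "l2 v" K] abs_le_l2[OF assms(1)] assms by simp
qed

lemma bdd_above_abs:
  assumes "sq_summable v" shows "bdd_above (range (\<lambda>x. \<bar>v x\<bar>))"
  using abs_le_l2[OF assms] by (auto intro!: bdd_aboveI[of _ "l2 v"])

lemma lnorm_nonneg:
  assumes "sq_summable v" "2 \<le> k" shows "0 \<le> lnorm k v"
  using assms(2)
proof (cases rule: ereal_ge_2_cases)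
  case 1
  then show ?thesis using cSUP_upper2[OF bdd_above_abs[OF assms(1)], of 0 0] by (simp add: lnorm_inf)
qed (simp add: lnorm_ereal)

lemma lnorm_powr:
  assumes "sq_summable v" "2 \<le> K" shows "lnorm (ereal K) v powr K = (\<Sum>x. \<bar>v x\<bar> powr K)"
  using assms by (simp add: lnorm_ereal powr_powr suminf_nonneg summable_powr)

lemma lnorm_le_iff:
  assumes "sq_summable v" "2 \<le> K" "0 \<le> C"
  shows "lnorm (ereal K) v \<le> C \<longleftrightarrow> (\<Sum>x. \<bar>v x\<bar> powr K) \<le> C powr K"
  using assms lnorm_powr[OF assms(1,2)] lnorm_nonneg[OF assms(1), of "ereal K"]
    powr_mono2[of K "lnorm (ereal K) v" C] powr_less_mono2[of K C "lnorm (ereal K) v"]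
  by (auto simp: not_le[symmetric])

lemma abs_le_lnorm:
  assumes "sq_summable v" "2 \<le> k" shows "\<bar>v x\<bar> \<le> lnorm k v"
  using assms(2)
proof (cases rule: ereal_ge_2_cases)
  case 1
  then show ?thesis using cSUP_upper[OF _ bdd_above_abs[OF assms(1)]] by (simp add: lnorm_inf)
next
  case (2 K)
  have "(\<Sum>y\<in>{x}. \<bar>v y\<bar> powr K) \<le> (\<Sum>x. \<bar>v x\<bar> powr K)"
    using summable_powr[OF assms(1)] 2 by (intro sum_le_suminf) auto
  then have "(\<bar>v x\<bar> powr K) powr (1/K) \<le> lnorm k v"
    unfolding 2(2) lnorm_ereal using 2 by (intro powr_mono2) auto
  then show ?thesis using 2 by (simp add: powr_powr)
qed

lemma lnorm_le_l2:
  assumes "sq_summable v" "2 \<le> k" shows "lnorm k v \<le> l2 v"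
  using assms(2)
proof (cases rule: ereal_ge_2_cases)
  case 1
  then show ?thesis using abs_le_l2[OF assms(1)] by (auto simp: lnorm_inf intro: cSUP_least)
next
  case (2 K)
  have "(\<Sum>x. \<bar>v x\<bar> powr K) \<le> (\<Sum>x. l2 v powr (K - 2) * (v x)\<^sup>2)"
  proof (rule suminf_le)
    show "\<bar>v x\<bar> powr K \<le> l2 v powr (K - 2) * (v x)\<^sup>2" for x
      using powr_le_sq[of "\<bar>v x\<bar>" "l2 v" K] abs_le_l2[OF assms(1)] 2 by simp
  qed (use assms summable_powr 2 in \<open>auto intro: summable_mult\<close>)
  also have "\<dots> = l2 v powr (K - 2) * (l2 v)\<^sup>2"
    using assms by (simp add: suminf_mult l2_sq)
  also have "\<dots> = l2 v powr K"
    using powr_add[of "l2 v" "K - 2" 2] l2_nonneg[OF assms(1)]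
    by (cases "l2 v = 0") (simp_all add: powr_numeral)
  finally show ?thesis 
    using lnorm_le_iff[OF assms(1) 2(1), of "l2 v"] l2_nonneg[OF assms(1)] 2 by simp
qed

lemma lnorm_mono:
  assumes "sq_summable u" "sq_summable v" "2 \<le> k" "\<And>x. \<bar>u x\<bar> \<le> \<bar>v x\<bar>"
  shows "lnorm k u \<le> lnorm k v"
  using assms(3)
proof (cases rule: ereal_ge_2_cases)
  case 1
  then show ?thesis using assms bdd_above_abs[OF assms(2)] by (auto simp: lnorm_inf intro: cSUP_mono)
next
  case (2 K)
  then show ?thesis unfolding 2 lnorm_ereal
    using assms by (intro powr_mono2 suminf_le summable_powr suminf_nonneg) (auto intro: powr_mono2)
qed

lemma lnorm_scale:
  assumes "sq_summable v" "2 \<le> k" "0 \<le> c"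
  shows "lnorm k (\<lambda>x. c * v x) = c * lnorm k v"
proof (cases "c = 0")
  case True
  show ?thesis using assms(2)
  proof (cases rule: ereal_ge_2_cases)
    case (2 K) then show ?thesis using True by (simp add: lnorm_ereal)
  qed (simp add: True lnorm_inf)
next
  case False
  then have c: "0 < c" using assms by simp
  show ?thesis using assms(2)
  proof (cases rule: ereal_ge_2_cases)
    case 1
    have "(SUP x. c * \<bar>v x\<bar>) = c * (SUP x. \<bar>v x\<bar>)"
    proof (rule antisym)
      show "(SUP x. c * \<bar>v x\<bar>) \<le> c * (SUP x. \<bar>v x\<bar>)"
        using c cSUP_upper[OF _ bdd_above_abs[OF assms(1)]] by (intro cSUP_least) auto
      have "\<bar>v x\<bar> \<le> (SUP x. c * \<bar>v x\<bar>) / c" for x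
      proof -
        have "c * \<bar>v x\<bar> \<le> (SUP x. c * \<bar>v x\<bar>)"
          by (rule cSUP_upper) (use c abs_le_l2[OF assms(1)] in \<open>auto intro!: bdd_aboveI[of _ "c * l2 v"]\<close>)
        then show ?thesis using c by (simp add: field_simps)
      qed
      then have "(SUP x. \<bar>v x\<bar>) \<le> (SUP x. c * \<bar>v x\<bar>) / c" by (intro cSUP_least) auto
      then show "c * (SUP x. \<bar>v x\<bar>) \<le> (SUP x. c * \<bar>v x\<bar>)" using c by (simp add: field_simps)
    qed
    then show ?thesis using 1 c by (simp add: lnorm_inf abs_mult)
  next
    case (2 K)
    have "(\<Sum>x. \<bar>c * v x\<bar> powr K) = c powr K * (\<Sum>x. \<bar>v x\<bar> powr K)"
      using c summable_powr[OF assms(1) 2(1)] by (simp add: abs_mult powr_mult suminf_mult)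
    then show ?thesis unfolding 2 lnorm_ereal
      using c 2 by (simp add: powr_mult powr_powr suminf_nonneg summable_powr assms)
  qed
qed

section \<open>Convexity and the triangle inequality\<close>

text \<open>For positive arguments this is convexity of the power; if one argument is zero it
  reduces to \<open>c powr K \<le> c\<close> on the unit interval.\<close>

lemma powr_convex_ge0:
  fixes s t l :: real
  assumes "0 \<le> s" "0 \<le> t" "0 \<le> l" "l \<le> 1" "1 \<le> K"
  shows "(l * s + (1 - l) * t) powr K \<le> l * s powr K + (1 - l) * t powr K"
proof -
  have le: "c powr K \<le> c" if "0 \<le> c" "c \<le> 1" for c :: real
    using powr_mono'[of 1 K c] that assms by (cases "c = 0") auto
  consider "s = 0" | "t = 0" | "0 < s" "0 < t" using assms by fastforce
  then show ?thesis
  proof cases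
    case 1
    then show ?thesis using assms le[of "1 - l"] by (simp add: powr_mult mult_right_mono)
  next
    case 2
    then show ?thesis using assms le[of l] by (simp add: powr_mult mult_right_mono)
  next
    case 3
    then show ?thesis
      using convex_onD[OF powr_convex[OF assms(5)], of "1 - l" s t] assms by simp
  qed
qed

text \<open>For a finite exponent this is Minkowski's inequality: \<open>u / A\<close> and
  \<open>v / B\<close> have norm one, and \<open>(u + v) / (A + B)\<close> is their convex
  combination with weight \<open>l = A / (A + B)\<close>, so convexity applies entrywise and is then
  summed.\<close>

lemma lnorm_triangle:
  assumes u: "sq_summable u" and v: "sq_summable v" and k: "2 \<le> k"
  shows "lnorm k (\<lambda>x. u x + v x) \<le> lnorm k u + lnorm k v"
  using k
proof (cases rule: ereal_ge_2_cases)
  case 1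
  have "\<bar>u x + v x\<bar> \<le> lnorm k u + lnorm k v" for x
    using abs_le_lnorm[OF u k, of x] abs_le_lnorm[OF v k, of x] by linarith
  then show ?thesis using 1 by (auto simp: lnorm_inf intro: cSUP_least)
next
  case (2 K)
  define A where "A = lnorm k u"
  define B where "B = lnorm k v"
  have A0: "0 \<le> A" and B0: "0 \<le> B" using lnorm_nonneg u v k by (auto simp: A_def B_def)
  consider "A = 0" | "B = 0" | "0 < A" "0 < B" using A0 B0 by fastforce
  then show ?thesis
  proof cases
    case 1
    then have "u x = 0" for x using abs_le_lnorm[OF u k, of x] by (simp add: A_def)
    then show ?thesis using A0 by (simp add: A_def)
  next
    case 2
    then have "v x = 0" for x using abs_le_lnorm[OF v k, of x] by (simp add: B_def)
    then show ?thesis using B0 by (simp add: B_def)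
  next
    case 3
    define l where "l = A / (A + B)"
    have l: "0 \<le> l" "l \<le> 1" "1 - l = B / (A + B)" using 3 by (auto simp: l_def field_simps)
    have su: "(\<Sum>x. \<bar>u x\<bar> powr K) = A powr K" and sv: "(\<Sum>x. \<bar>v x\<bar> powr K) = B powr K"
      using lnorm_powr u v 2 by (auto simp: A_def B_def)
    have sm: "summable (\<lambda>x. \<bar>u x\<bar> powr K)" "summable (\<lambda>x. \<bar>v x\<bar> powr K)"
      using summable_powr u v 2 by auto
    let ?b = "\<lambda>x. (A + B) powr K * (l * (\<bar>u x\<bar> powr K / A powr K) + (1 - l) * (\<bar>v x\<bar> powr K / B powr K))"
    have "\<bar>u x + v x\<bar> powr K \<le> ?b x" for x
    proof -
      have "\<bar>u x + v x\<bar> \<le> (A + B) * (l * (\<bar>u x\<bar> / A) + (1 - l) * (\<bar>v x\<bar> / B))"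
      proof -
        have "l * (\<bar>u x\<bar> / A) = \<bar>u x\<bar> / (A + B)" "(1 - l) * (\<bar>v x\<bar> / B) = \<bar>v x\<bar> / (A + B)"
          unfolding l(3) using 3 by (auto simp: l_def)
        then have "(A + B) * (l * (\<bar>u x\<bar> / A) + (1 - l) * (\<bar>v x\<bar> / B)) = \<bar>u x\<bar> + \<bar>v x\<bar>"
          using 3 by (simp add: distrib_left)
        then show ?thesis by simp
      qed
      then have "\<bar>u x + v x\<bar> powr K \<le> ((A + B) * (l * (\<bar>u x\<bar> / A) + (1 - l) * (\<bar>v x\<bar> / B))) powr K"
        using 2 by (intro powr_mono2) auto
      also have "\<dots> = (A + B) powr K * (l * (\<bar>u x\<bar> / A) + (1 - l) * (\<bar>v x\<bar> / B)) powr K"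
        using 3 l by (intro powr_mult)
      also have "\<dots> \<le> (A + B) powr K * (l * (\<bar>u x\<bar> / A) powr K + (1 - l) * (\<bar>v x\<bar> / B) powr K)"
        using l 2 3 by (intro mult_left_mono powr_convex_ge0) auto
      finally show ?thesis using 3 by (simp add: powr_divide)
    qed
    moreover have sb: "summable ?b"
      using sm by (intro summable_mult summable_add summable_divide)
    ultimately have "(\<Sum>x. \<bar>u x + v x\<bar> powr K) \<le> suminf ?b"
      using summable_powr[OF sq_summable_add[OF u v] 2(1)] by (intro suminf_le) auto
    also have "suminf ?b = (A + B) powr K * (l * ((\<Sum>x. \<bar>u x\<bar> powr K) / A powr K) + (1 - l) * ((\<Sum>x. \<bar>v x\<bar> powr K) / B powr K))"
      using sm by (simp add: suminf_mult summable_mult summable_add summable_divide suminf_add[symmetric] suminf_divide)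
    also have "\<dots> = (A + B) powr K" using 3 by (simp add: su sv)
    finally show ?thesis
      using lnorm_le_iff[OF sq_summable_add[OF u v] 2(1), of "A + B"] 3 2 by (simp add: A_def B_def)
  qed
qed

lemma lnorm_diff_le:
  assumes u: "sq_summable u" and v: "sq_summable v" and k: "2 \<le> k"
  shows "\<bar>lnorm k u - lnorm k v\<bar> \<le> l2 (\<lambda>x. u x - v x)"
proof -
  have 1: "lnorm k u \<le> lnorm k v + lnorm k (\<lambda>x. u x - v x)"
    using lnorm_triangle[OF v sq_summable_diff[OF u v] k] by simp
  have 2: "lnorm k v \<le> lnorm k u + lnorm k (\<lambda>x. v x - u x)"
    using lnorm_triangle[OF u sq_summable_diff[OF v u] k] by simp
  have "l2 (\<lambda>x. v x - u x) = l2 (\<lambda>x. u x - v x)"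
    by (simp add: l2_def power2_commute)
  then show ?thesis
    using 1 2 lnorm_le_l2[OF sq_summable_diff[OF u v] k] lnorm_le_l2[OF sq_summable_diff[OF v u] k]
    by linarith
qed

lemma l2_triangle:
  assumes "sq_summable u" "sq_summable v"
  shows "l2 (\<lambda>x. u x + v x) \<le> l2 u + l2 v"
  using lnorm_triangle[OF assms, of 2]
  unfolding lnorm_2[OF assms(1)] lnorm_2[OF assms(2)] lnorm_2[OF sq_summable_add[OF assms]] by simp

lemma l2_diff_commute: "l2 (\<lambda>x. u x - v x) = l2 (\<lambda>x. v x - u x)"
  by (simp add: l2_def power2_commute)

lemma l2_mono:
  assumes "sq_summable v" "\<And>x. \<bar>u x\<bar> \<le> \<bar>v x\<bar>"
  shows "sq_summable u" "l2 u \<le> l2 v"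
proof -
  have *: "(u x)\<^sup>2 \<le> (v x)\<^sup>2" for x using assms(2)[of x] by (simp add: abs_le_square_iff)
  show "sq_summable u" by (rule summable_comparison_test'[OF assms(1)]) (use * in auto)
  then show "l2 u \<le> l2 v" unfolding l2_def using assms(1) * by (intro real_sqrt_le_mono suminf_le) auto
qed

text \<open>Bounds along unboundedly many initial segments suffice; the projection inequalities for
  \<open>gren_blocks\<close> are available only on segments that end at a cut.\<close>

lemma suminf_le_cofinal:
  fixes a :: "nat \<Rightarrow> real"
  assumes "\<And>x. 0 \<le> a x" "\<And>m. \<exists>M\<ge>m. sum a {..<M} \<le> C"
  shows "summable a" "suminf a \<le> C"
proof -
  have *: "sum a {..<m} \<le> C" for m
  proof -
    obtain M where M: "M \<ge> m" "sum a {..<M} \<le> C" using assms(2) by blast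
    have "sum a {..<m} \<le> sum a {..<M}" using M(1) assms(1) by (intro sum_mono2) auto
    then show ?thesis using M(2) by simp
  qed
  show "summable a" by (rule summableI_nonneg_bounded[OF assms(1) *])
  then show "suminf a \<le> C" using * by (intro suminf_le_const)
qed

text \<open>Supplies the subgradient that \<open>kkt_convex\<close> needs for the norms with finite
  exponent.\<close>

lemma powr_abs_subgradient:
  fixes x y K :: real
  assumes "1 < K"
  shows "\<bar>x\<bar> powr K + K * \<bar>x\<bar> powr (K - 1) * sgn x * (y - x) \<le> \<bar>y\<bar> powr K"
proof -
  have pos: "a powr K + K * a powr (K - 1) * (b - a) \<le> b powr K" if ab: "0 \<le> a" "0 \<le> b" for a b :: real
  proof -
    consider "a = 0" | "b = 0" "0 < a" | "0 < a" "0 < b" using ab by fastforce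
    then show ?thesis
    proof cases
      case 2
      have "a powr (K - 1) * a = a powr K" using 2 powr_add[of a "K - 1" 1] by simp
      then have "a powr K + K * a powr (K - 1) * (b - a) = (1 - K) * a powr K" 
        using 2 by (simp add: algebra_simps)
      then show ?thesis using assms 2 by (simp add: mult_nonpos_nonneg)
    next
      case 3
      have "b powr K - a powr K \<ge> (K * a powr (K - 1)) * (b - a)"
      proof (rule convex_on_imp_above_tangent[where A = "{0<..}"])
        show "convex_on {0<..} (\<lambda>x. x powr K)" using powr_convex assms by simp
        show "((\<lambda>x. x powr K) has_real_derivative K * a powr (K - 1)) (at a within {0<..})"
          using 3 by (auto intro!: derivative_eq_intros)
      qed (use 3 in \<open>auto simp: interior_open\<close>)
      then show ?thesis by simp
    qed auto
  qed
  have "K * \<bar>x\<bar> powr (K - 1) * (sgn x * (y - x)) \<le> K * \<bar>x\<bar> powr (K - 1) * (\<bar>y\<bar> - \<bar>x\<bar>)"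
    using assms by (intro mult_left_mono) (auto simp: sgn_if)
  then show ?thesis using pos[of "\<bar>x\<bar>" "\<bar>y\<bar>"] by (simp add: mult.assoc)
qed

definition trunc :: "nat \<Rightarrow> (nat \<Rightarrow> real) \<Rightarrow> nat \<Rightarrow> real" where
  "trunc m v x = (if x < m then v x else 0)"

lemma sq_summable_trunc [simp]: "sq_summable (trunc m v)"
  by (rule sq_summable_finite_support[of m]) (simp add: trunc_def)

lemma l2_tail_sq:
  assumes "sq_summable v"
  shows "(l2 (\<lambda>x. v x - trunc m v x))\<^sup>2 = (\<Sum>x. (v (x + m))\<^sup>2)"
proof -
  have s: "sq_summable (\<lambda>x. v x - trunc m v x)" using assms by (intro sq_summable_diff) auto
  show ?thesis unfolding l2_sq[OF s]
    by (subst suminf_split_initial_segment[OF s, of m]) (auto simp: trunc_def intro!: sum.neutral)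
qed

text \<open>The hypothesis says that the two heads agree up to a permutation. Powers of the absolute
  value settle finite \<open>k\<close>; for the supremum norm, indicators of single values show that
  the sets of values coincide.\<close>

lemma lnorm_trunc_cong:
  assumes "\<And>\<phi> :: real \<Rightarrow> real. (\<Sum>x<m. \<phi> (u x)) = (\<Sum>x<m. \<phi> (v x))" and k: "2 \<le> k"
  shows "lnorm k (trunc m u) = lnorm k (trunc m v)"
  using k
proof (cases rule: ereal_ge_2_cases)
  case 1
  have sub: "u ` {..<m} \<subseteq> v ` {..<m}" 
    if *: "\<And>\<phi> :: real \<Rightarrow> real. (\<Sum>x<m. \<phi> (u x)) = (\<Sum>x<m. \<phi> (v x))" for u v
  proof
    fix y assume "y \<in> u ` {..<m}"
    then obtain x where "x < m" "u x = y" by auto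
    then have "0 < (\<Sum>x<m. if u x = y then 1 else (0::real))" by (intro sum_pos2[of _ x]) auto
    also have "\<dots> = (\<Sum>x<m. if v x = y then 1 else 0)" using *[of "\<lambda>z. if z = y then 1 else 0"] .
    finally have pos: "0 < (\<Sum>x<m. if v x = y then 1 else (0::real))" .
    show "y \<in> v ` {..<m}"
    proof (rule ccontr)
      assume "y \<notin> v ` {..<m}"
      then have "(\<Sum>x<m. if v x = y then 1 else (0::real)) = 0" by (intro sum.neutral) auto
      with pos show False by simp
    qed
  qed
  have "u ` {..<m} = v ` {..<m}" using sub[of u v] sub[of v u] assms(1) by auto
  moreover have "range (\<lambda>x. \<bar>trunc m w x\<bar>) = abs ` (w ` {..<m}) \<union> {0}" for w
  proof -
    have "(UNIV :: nat set) = {..<m} \<union> {m..}" by auto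
    then have "range (\<lambda>x. \<bar>trunc m w x\<bar>) = (\<lambda>x. \<bar>trunc m w x\<bar>) ` ({..<m} \<union> {m..})" by simp
    also have "\<dots> = abs ` (w ` {..<m}) \<union> {0}" unfolding image_Un
      by (intro arg_cong2[where f = "(\<union>)"]) (auto simp: trunc_def image_image image_iff)
    finally show ?thesis .
  qed
  ultimately show ?thesis using 1 by (simp add: lnorm_inf)
next
  case (2 K)
  have "(\<Sum>x. \<bar>trunc m w x\<bar> powr K) = (\<Sum>x<m. \<bar>w x\<bar> powr K)" for w
    by (subst suminf_finite[of "{..<m}"]) (auto simp: trunc_def)
  then show ?thesis unfolding 2 lnorm_ereal using assms(1)[of "\<lambda>y. \<bar>y\<bar> powr K"] by simp
qed

section \<open>The blockwise majorant on square-summable sequences\<close>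

context
  fixes p :: "nat \<Rightarrow> real"
  assumes p: "monotone_decreasing p" "\<And>x. 0 \<le> p x" "p \<longlonglongrightarrow> 0"
begin

lemma kkt_gren_blocks_cofinal: "\<exists>M\<ge>m. \<forall>z. kkt (flat p) z (gren_blocks p z) M"
  using cut_exists[OF p(3,2)] kkt_gren_blocks[OF p(1,2)] by blast

lemma gren_blocks_contraction:
  assumes z: "sq_summable (\<lambda>x. z x - z' x)"
  shows "sq_summable (\<lambda>x. gren_blocks p z x - gren_blocks p z' x)"
    "l2 (\<lambda>x. gren_blocks p z x - gren_blocks p z' x) \<le> l2 (\<lambda>x. z x - z' x)"
proof -
  have *: "\<exists>M\<ge>m. (\<Sum>x<M. (gren_blocks p z x - gren_blocks p z' x)\<^sup>2) \<le> (\<Sum>x. (z x - z' x)\<^sup>2)" for m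
  proof -
    obtain M where M: "M \<ge> m" "\<And>z. kkt (flat p) z (gren_blocks p z) M"
      using kkt_gren_blocks_cofinal by blast
    have "(\<Sum>x<M. (gren_blocks p z x - gren_blocks p z' x)\<^sup>2) \<le> (\<Sum>x<M. (z x - z' x)\<^sup>2)"
      by (rule kkt_nonexpansive[OF M(2) M(2)])
    also have "\<dots> \<le> (\<Sum>x. (z x - z' x)\<^sup>2)" using z by (intro sum_le_suminf) auto
    finally show ?thesis using M(1) by blast
  qed
  show "sq_summable (\<lambda>x. gren_blocks p z x - gren_blocks p z' x)"
    by (rule suminf_le_cofinal(1)[OF _ *]) simp
  show "l2 (\<lambda>x. gren_blocks p z x - gren_blocks p z' x) \<le> l2 (\<lambda>x. z x - z' x)"
    unfolding l2_def by (intro real_sqrt_le_mono suminf_le_cofinal(2)[OF _ *]) simp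
qed

lemma gren_blocks_zero: "gren_blocks p (\<lambda>_. 0) x = 0"
proof -
  obtain M where M: "M \<ge> Suc x" "\<And>z. kkt (flat p) z (gren_blocks p z) M"
    using kkt_gren_blocks_cofinal by blast
  have "kkt (flat p) (\<lambda>_. 0) (\<lambda>_. 0) M" by (simp add: kkt_def)
  from kkt_unique[OF M(2) this] show ?thesis using M(1) by simp
qed

lemma gren_blocks_l2:
  assumes "sq_summable z"
  shows "sq_summable (gren_blocks p z)" "l2 (gren_blocks p z) \<le> l2 z"
  using gren_blocks_contraction[of z "\<lambda>_. 0"] assms by (simp_all add: gren_blocks_zero)

lemma gren_blocks_lnorm_le:
  assumes z: "sq_summable z" and k: "2 \<le> k"
  shows "lnorm k (gren_blocks p z) \<le> lnorm k z"
  using k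
proof (cases rule: ereal_ge_2_cases)
  case 1
  define B where "B = lnorm k z"
  have B0: "0 \<le> B" using lnorm_nonneg[OF z k] by (simp add: B_def)
  have "\<bar>gren_blocks p z x\<bar> \<le> B" for x
  proof -
    obtain M where M: "M \<ge> Suc x" "\<And>z. kkt (flat p) z (gren_blocks p z) M"
      using kkt_gren_blocks_cofinal by blast
    \<comment> \<open>\<open>?\<phi>\<close> is convex and vanishes exactly on
      \<open>[-B, B]\<close>, so the inequality between its sums confines the entries of the image
      to that interval. \<open>?s\<close> is a subgradient of it.\<close>
    let ?\<phi> = "\<lambda>y. max 0 (\<bar>y\<bar> - B)" and ?s = "\<lambda>y. if y > B then 1 else if y < - B then -1 else 0"
    have "(\<Sum>x<M. ?\<phi> (gren_blocks p z x)) \<le> (\<Sum>x<M. ?\<phi> (z x))"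
      by (rule kkt_convex[OF M(2), where s = ?s]) (use B0 in auto)
    also have "\<dots> = 0" using abs_le_lnorm[OF z k] by (intro sum.neutral) (auto simp: B_def)
    finally have "(\<Sum>x<M. ?\<phi> (gren_blocks p z x)) = 0" by (intro antisym sum_nonneg) auto
    then have "?\<phi> (gren_blocks p z x) = 0" using M(1) by (subst (asm) sum_nonneg_eq_0_iff) auto
    then show ?thesis by simp
  qed
  then show ?thesis using 1 by (auto simp: lnorm_inf B_def intro: cSUP_least)
next
  case (2 K)
  have *: "\<exists>M\<ge>m. (\<Sum>x<M. \<bar>gren_blocks p z x\<bar> powr K) \<le> (\<Sum>x. \<bar>z x\<bar> powr K)" for m
  proof -
    obtain M where M: "M \<ge> m" "\<And>z. kkt (flat p) z (gren_blocks p z) M"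
      using kkt_gren_blocks_cofinal by blast
    have "(\<Sum>x<M. \<bar>gren_blocks p z x\<bar> powr K) \<le> (\<Sum>x<M. \<bar>z x\<bar> powr K)"
      by (rule kkt_convex[OF M(2) powr_abs_subgradient]) (use 2 in simp)
    also have "\<dots> \<le> (\<Sum>x. \<bar>z x\<bar> powr K)"
      using summable_powr[OF z 2(1)] by (intro sum_le_suminf) auto
    finally show ?thesis using M(1) by blast
  qed
  have "(\<Sum>x. \<bar>gren_blocks p z x\<bar> powr K) \<le> (\<Sum>x. \<bar>z x\<bar> powr K)"
    by (rule suminf_le_cofinal(2)[OF _ *]) simp
  then show ?thesis unfolding 2 lnorm_ereal
    using summable_powr[OF gren_blocks_l2(1)[OF z] 2(1)] 2 by (intro powr_mono2 suminf_nonneg) auto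
qed

end

section \<open>Contraction and localisation of the estimators\<close>

lemma sq_le_extend:
  assumes eq: "\<And>x. x \<ge> m \<Longrightarrow> u x = v x" and v: "sq_summable v"
    and le: "(\<Sum>x<m. (u x)\<^sup>2) \<le> (\<Sum>x<m. (v x)\<^sup>2)"
  shows "sq_summable u" "l2 u \<le> l2 v"
proof -
  have *: "\<exists>M\<ge>m'. (\<Sum>x<M. (u x)\<^sup>2) \<le> (\<Sum>x. (v x)\<^sup>2)" for m'
  proof -
    let ?M = "m + m'"
    have "(\<Sum>x<?M. (u x)\<^sup>2) = (\<Sum>x<m. (u x)\<^sup>2) + (\<Sum>x<m'. (u (m + x))\<^sup>2)" 
      by (simp add: sum_lessThan_add)
    also have "\<dots> \<le> (\<Sum>x<m. (v x)\<^sup>2) + (\<Sum>x<m'. (v (m + x))\<^sup>2)" using le by (simp add: eq)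
    also have "\<dots> = (\<Sum>x<?M. (v x)\<^sup>2)" by (simp add: sum_lessThan_add)
    also have "\<dots> \<le> (\<Sum>x. (v x)\<^sup>2)" using v by (intro sum_le_suminf) auto
    finally show ?thesis by (intro exI[of _ ?M]) simp
  qed
  show "sq_summable u" by (rule suminf_le_cofinal(1)[OF _ *]) simp
  show "l2 u \<le> l2 v"
    unfolding l2_def by (intro real_sqrt_le_mono suminf_le_cofinal(2)[OF _ *]) simp
qed

text \<open>Beyond the observed range \<open>m\<close> the estimators vanish and their errors
  coincide, so a comparison between \<open>M\<close> and \<open>m\<close> extends to the whole
  tail.\<close>

lemma l2_tail_le_extend:
  assumes eq: "\<And>x. x \<ge> m \<Longrightarrow> u x = v x" and u: "sq_summable u" and v: "sq_summable v"
    and le: "(\<Sum>x<m - M. (u (M + x))\<^sup>2) \<le> (\<Sum>x<m - M. (v (M + x))\<^sup>2)" and "M \<le> m"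
  shows "l2 (\<lambda>x. u x - trunc M u x) \<le> l2 (\<lambda>x. v x - trunc M v x)"
proof (rule sq_le_extend(2))
  have *: "(\<Sum>x<m. (f x - trunc M f x)\<^sup>2) = (\<Sum>x<m - M. (f (M + x))\<^sup>2)" for f
    using sum_lessThan_add[of "\<lambda>x. (f x - trunc M f x)\<^sup>2" M "m - M"] \<open>M \<le> m\<close>
    by (simp add: trunc_def)
  show "(\<Sum>x<m. (u x - trunc M u x)\<^sup>2) \<le> (\<Sum>x<m. (v x - trunc M v x)\<^sup>2)"
    using le by (simp add: *)
  show "u x - trunc M u x = v x - trunc M v x" if "m \<le> x" for x
    using that eq \<open>M \<le> m\<close> by (simp add: trunc_def)
  show "sq_summable (\<lambda>x. v x - trunc M v x)" using v by (intro sq_summable_diff) auto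
qed

lemma length_emp_vec: "length (emp_vec xs n) = Suc (Max (xs ` {1..n}))"
  by (simp add: emp_vec_def)

lemma emp_est_zero:
  assumes "x \<ge> length (emp_vec xs n)" shows "emp_est xs n x = 0"
proof -
  have "{i \<in> {1..n}. xs i = x} = {}"
  proof (rule ccontr)
    assume "\<not> ?thesis"
    then obtain i where "i \<in> {1..n}" "xs i = x" by auto
    then have "x \<le> Max (xs ` {1..n})" by (intro Max_ge) auto
    then show False using assms by (simp add: length_emp_vec)
  qed
  then show ?thesis by (simp add: emp_est_def)
qed

lemma emp_vec_nth: "x < length (emp_vec xs n) \<Longrightarrow> emp_vec xs n ! x = emp_est xs n x"
  by (simp add: emp_vec_def del: upt_Suc)

lemma gren_est_zero: "x \<ge> length (emp_vec xs n) \<Longrightarrow> gren_est xs n x = 0"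
  by (simp add: gren_est_def extend_zero_def)

lemma rear_est_zero: "x \<ge> length (emp_vec xs n) \<Longrightarrow> rear_est xs n x = 0"
  by (simp add: rear_est_def extend_zero_def rear_def)

lemma kkt_gren_est: "kkt (\<lambda>_. True) (emp_est xs n) (gren_est xs n) (length (emp_vec xs n))"
proof -
  have "kkt (\<lambda>_. True) (emp_est xs n) (gren_est xs n) (length (emp_vec xs n)) =
    kkt (\<lambda>_. True) (nth (emp_vec xs n)) (nth (gren (emp_vec xs n))) (length (emp_vec xs n))"
    by (rule kkt_cong) (auto simp: emp_vec_nth gren_est_def extend_zero_def)
  then show ?thesis using kkt_gren by simp
qed

lemma sum_rear_est:
  "(\<Sum>x<length (emp_vec xs n). \<phi> (rear_est xs n x)) = (\<Sum>x<length (emp_vec xs n). \<phi> (emp_est xs n x))"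
  for \<phi> :: "real \<Rightarrow> real"
proof -
  let ?w = "emp_vec xs n"
  have *: "(\<Sum>x<length v. \<phi> (v ! x)) = sum_mset (image_mset \<phi> (mset v))" for v :: "real list"
  proof -
    have "sum_mset (image_mset \<phi> (mset v)) = sum_list (map \<phi> v)" by (metis mset_map sum_mset_sum_list)
    then show ?thesis by (simp add: sum_list_sum_nth atLeast0LessThan)
  qed
  have len: "length (rear ?w) = length ?w" by (simp add: rear_def)
  have "(\<Sum>x<length ?w. \<phi> (rear_est xs n x)) = (\<Sum>x<length (rear ?w). \<phi> (rear ?w ! x))"
    by (simp add: rear_est_def extend_zero_def len)
  also have "\<dots> = (\<Sum>x<length ?w. \<phi> (?w ! x))"
    unfolding * by (simp add: rear_def)
  finally show ?thesis by (simp add: emp_vec_nth)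
qed

lemma rear_est_antimono:
  assumes "i \<le> j" "j < length (emp_vec xs n)" shows "rear_est xs n j \<le> rear_est xs n i"
proof -
  let ?w = "emp_vec xs n"
  have "sorted_wrt (\<ge>) (rear ?w)" by (simp add: rear_def sorted_wrt_rev)
  then have "rear ?w ! j \<le> rear ?w ! i"
    using assms sorted_wrt_nth_less[of "(\<ge>)" "rear ?w" i j] by (cases "i = j") (auto simp: rear_def)
  then show ?thesis using assms by (simp add: rear_est_def extend_zero_def rear_def)
qed

text \<open>With \<open>\<theta>\<close> the \<open>t\<close>-th largest entry, the sum of the
  \<open>t\<close> largest entries is \<open>t * \<theta>\<close> plus the sum of all positive parts
  of \<open>y - \<theta>\<close>, while any \<open>t\<close> entries sum to at most that.\<close>

lemma rear_est_partial_sums: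
  assumes "t \<le> length (emp_vec xs n)"
  shows "sum (emp_est xs n) {..<t} \<le> sum (rear_est xs n) {..<t}"
proof (cases "t = 0")
  case False
  define \<theta> where "\<theta> = rear_est xs n (t - 1)"
  let ?\<phi> = "\<lambda>y. max 0 (y - \<theta>)" and ?m = "length (emp_vec xs n)"
  have "sum (emp_est xs n) {..<t} - t * \<theta> = (\<Sum>x<t. emp_est xs n x - \<theta>)"
    by (simp add: sum_subtractf)
  also have "\<dots> \<le> (\<Sum>x<t. ?\<phi> (emp_est xs n x))" by (intro sum_mono) simp
  also have "\<dots> \<le> (\<Sum>x<?m. ?\<phi> (emp_est xs n x))" using assms by (intro sum_mono2) auto
  also have "\<dots> = (\<Sum>x<?m. ?\<phi> (rear_est xs n x))" using sum_rear_est[of ?\<phi>] by simp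
  also have "\<dots> = (\<Sum>x<t. ?\<phi> (rear_est xs n x))"
  proof (rule sum.mono_neutral_right)
    show "\<forall>x\<in>{..<?m} - {..<t}. ?\<phi> (rear_est xs n x) = 0"
      using rear_est_antimono[of "t - 1" _ xs n] by (auto simp: \<theta>_def)
  qed (use assms in auto)
  also have "\<dots> = (\<Sum>x<t. rear_est xs n x - \<theta>)"
  proof (rule sum.cong)
    fix x assume "x \<in> {..<t}"
    then have "rear_est xs n (t - 1) \<le> rear_est xs n x" using assms by (intro rear_est_antimono) auto
    then show "?\<phi> (rear_est xs n x) = rear_est xs n x - \<theta>" by (simp add: \<theta>_def)
  qed simp
  also have "\<dots> = sum (rear_est xs n) {..<t} - t * \<theta>" by (simp add: sum_subtractf)
  finally show ?thesis by simp
qed simp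

lemma l2_scale: 
  assumes "sq_summable v" "0 \<le> c" shows "l2 (\<lambda>x. c * v x) = c * l2 v"
  using lnorm_scale[OF assms(1), of 2 c] assms
  by (simp only: lnorm_2 sq_summable_cmult order_refl simp_thms)

text \<open>The factor 2 arises because both sequences are replaced by their heads, at the cost of
  one tail each.\<close>

lemma lnorm_head_eq_approx:
  assumes u: "sq_summable u" and v: "sq_summable v" and k: "2 \<le> k"
    and eq: "lnorm k (trunc M u) = lnorm k (trunc M v)"
    and u': "l2 (\<lambda>x. u x - trunc M u x) \<le> C" and v': "l2 (\<lambda>x. v x - trunc M v x) \<le> C"
  shows "\<bar>lnorm k u - lnorm k v\<bar> \<le> 2 * C"
  using lnorm_diff_le[OF u sq_summable_trunc k, of M u] lnorm_diff_le[OF v sq_summable_trunc k, of M v]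
    eq u' v' by linarith

context
  fixes p :: "nat \<Rightarrow> real"
  assumes mono: "monotone_decreasing p" and nonneg: "\<And>x. 0 \<le> p x" and summable: "summable p"
begin

lemma sq_summable_p: "sq_summable p"
proof (rule summable_comparison_test')
  show "summable (\<lambda>x. p 0 * p x)" using summable by (rule summable_mult)
  show "norm ((p x)\<^sup>2) \<le> p 0 * p x" for x
    using monotone_decreasing_le[OF mono, of 0 x] nonneg[of x]
    by (simp add: power2_eq_square mult_right_mono)
qed

lemma p_tendsto_0: "p \<longlonglongrightarrow> 0"
  using summable by (rule summable_LIMSEQ_zero)

lemma sq_summable_emp: "sq_summable (\<lambda>x. emp_est xs n x - p x)"
  by (rule sq_summable_diff[OF sq_summable_finite_support[of "length (emp_vec xs n)"] sq_summable_p])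
     (simp add: emp_est_zero)

lemma gren_est_contraction:
  "sq_summable (\<lambda>x. gren_est xs n x - p x)"
  "l2 (\<lambda>x. gren_est xs n x - p x) \<le> l2 (\<lambda>x. emp_est xs n x - p x)"
proof -
  let ?m = "length (emp_vec xs n)"
  have le: "(\<Sum>x<?m. (gren_est xs n x - p x)\<^sup>2) \<le> (\<Sum>x<?m. (emp_est xs n x - p x)\<^sup>2)"
    by (rule kkt_sq_dist_le[OF kkt_gren_est]) (use mono in \<open>simp add: monotone_decreasing_def\<close>)
  show "sq_summable (\<lambda>x. gren_est xs n x - p x)"
    "l2 (\<lambda>x. gren_est xs n x - p x) \<le> l2 (\<lambda>x. emp_est xs n x - p x)"
    using sq_le_extend[OF _ sq_summable_emp le] gren_est_zero[where xs = xs and n = n]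
      emp_est_zero[where xs = xs and n = n] by auto
qed

text \<open>Sorting keeps the sum of squares and, by summation by parts, does not lower the inner
  product with the decreasing \<open>p\<close>; hence the squared distance to \<open>p\<close> does
  not grow.\<close>

lemma rear_est_contraction:
  "sq_summable (\<lambda>x. rear_est xs n x - p x)"
  "l2 (\<lambda>x. rear_est xs n x - p x) \<le> l2 (\<lambda>x. emp_est xs n x - p x)"
proof -
  define m where "m = length (emp_vec xs n)"
  define w where "w = emp_est xs n"
  define r where "r = rear_est xs n"
  obtain l where l: "m = Suc l" by (auto simp: m_def length_emp_vec)
  define d where "d x = w x - r x" for x
  have D: "sum d {..<t} \<le> 0" if "t \<le> m" for t
    using rear_est_partial_sums[of t xs n] that by (simp add: d_def[abs_def] sum_subtractf m_def w_def r_def)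
  have Dm: "sum d {..<m} = 0"
    using sum_rear_est[of "\<lambda>x. x" xs n] by (simp add: d_def[abs_def] sum_subtractf m_def w_def r_def)
  have "0 \<le> (\<Sum>i<l. (p (Suc i) - p i) * sum d {..<Suc i})"
  proof (rule sum_nonneg)
    fix i assume "i \<in> {..<l}"
    then have "sum d {..<Suc i} \<le> 0" using l by (intro D) auto
    moreover have "p (Suc i) - p i \<le> 0" using mono by (simp add: monotone_decreasing_def)
    ultimately show "0 \<le> (p (Suc i) - p i) * sum d {..<Suc i}" by (rule mult_nonpos_nonpos[rotated])
  qed
  then have pd: "(\<Sum>i<m. p i * d i) \<le> 0" using Dm unfolding l sum_abel by (simp del: sum.lessThan_Suc)
  have sq: "(\<Sum>i<m. (r i)\<^sup>2) = (\<Sum>i<m. (w i)\<^sup>2)"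
    using sum_rear_est[of "\<lambda>y. y\<^sup>2" xs n] by (simp add: m_def w_def r_def)
  have "(\<Sum>i<m. (w i - p i)\<^sup>2) - (\<Sum>i<m. (r i - p i)\<^sup>2) = ((\<Sum>i<m. (w i)\<^sup>2) - (\<Sum>i<m. (r i)\<^sup>2)) - 2 * (\<Sum>i<m. p i * d i)"
    unfolding sum_distrib_left sum_subtractf[symmetric]
    by (intro sum.cong) (auto simp: d_def power2_eq_square algebra_simps)
  then have le: "(\<Sum>i<m. (r i - p i)\<^sup>2) \<le> (\<Sum>i<m. (w i - p i)\<^sup>2)" using pd sq by simp
  show "sq_summable (\<lambda>x. rear_est xs n x - p x)"
    "l2 (\<lambda>x. rear_est xs n x - p x) \<le> l2 (\<lambda>x. emp_est xs n x - p x)"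
    using sq_le_extend[OF _ sq_summable_emp le[unfolded w_def r_def]] 
      rear_est_zero[where xs = xs and n = n] emp_est_zero[where xs = xs and n = n] by (auto simp: m_def)
qed

text \<open>The factor 2 is what prevents two entries within \<open>\<epsilon>\<close> of
  \<open>p\<close> from tying across a drop. Only finitely many positions are inspected, since the
  drops of \<open>p\<close> need not have a positive lower bound.\<close>

lemma gap_exists: "\<exists>\<epsilon>>0. \<forall>t<M. p (Suc t) < p t \<longrightarrow> 2 * \<epsilon> \<le> p t - p (Suc t)"
proof (induction M)
  case 0
  then show ?case by (auto intro: exI[of _ 1])
next
  case (Suc M)
  then obtain \<epsilon> where e: "\<epsilon> > 0" "\<forall>t<M. p (Suc t) < p t \<longrightarrow> 2 * \<epsilon> \<le> p t - p (Suc t)" by auto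
  define d where "d = (if p (Suc M) < p M then min \<epsilon> ((p M - p (Suc M)) / 2) else \<epsilon>)"
  have "2 * d \<le> p t - p (Suc t)" if t: "t < Suc M" "p (Suc t) < p t" for t
  proof (cases "t = M")
    case True
    then have "p (Suc M) < p M" using t by simp
    then have "d = min \<epsilon> ((p M - p (Suc M)) / 2)" by (simp only: d_def if_True)
    also have "\<dots> \<le> (p M - p (Suc M)) / 2" by (rule min.cobounded2)
    finally show ?thesis using True by simp
  next
    case False
    then have "2 * \<epsilon> \<le> p t - p (Suc t)" using e t by auto
    moreover have "d \<le> \<epsilon>" by (simp add: d_def)
    ultimately show ?thesis by linarith
  qed
  moreover have "d > 0" using e by (simp add: d_def)
  ultimately show ?case by blast
qed

text \<open>Truncation at a cut commutes with \<open>gren_blocks\<close>. The tail of the image is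
  therefore the difference of the images of \<open>z\<close> and \<open>trunc M z\<close>, to which
  contraction applies.\<close>

lemma gren_blocks_tail:
  assumes z: "sq_summable z" and M: "\<not> flat p (M - 1)"
  shows "l2 (\<lambda>x. gren_blocks p z x - trunc M (gren_blocks p z) x) \<le> l2 (\<lambda>x. z x - trunc M z x)"
proof -
  note p = mono nonneg p_tendsto_0
  have k0: "kkt (flat p) z (gren_blocks p z) M" using kkt_gren_blocks[OF mono nonneg] M by blast
  have k1: "kkt (flat p) (trunc M z) (trunc M (gren_blocks p z)) M"
    using k0 by (subst kkt_cong[of _ _ "flat p" _ z _ "gren_blocks p z"]) (auto simp: trunc_def)
  have k2: "kkt (flat p) (trunc M z) (trunc M (gren_blocks p z)) (M + b)" for b
    by (rule kkt_append[OF k1]) (use M in \<open>auto simp: trunc_def kkt_def\<close>)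
  have "gren_blocks p (trunc M z) x = trunc M (gren_blocks p z) x" for x
  proof -
    obtain M' where M': "M' \<ge> M + Suc x" "\<And>z. kkt (flat p) z (gren_blocks p z) M'"
      using kkt_gren_blocks_cofinal[OF p] by blast
    have "kkt (flat p) (trunc M z) (trunc M (gren_blocks p z)) M'" using k2[of "M' - M"] M' by simp
    from kkt_unique[OF M'(2) this] show ?thesis using M' by simp
  qed
  then show ?thesis
    using gren_blocks_contraction(2)[OF p, of z "trunc M z"] z by (simp add: sq_summable_diff)
qed

lemma scaled_err_sq_summable:
  "sq_summable (scaled_err p emp_est xs n)"
  "sq_summable (scaled_err p rear_est xs n)" 
  "sq_summable (scaled_err p gren_est xs n)"
  unfolding scaled_err_def
  by (intro sq_summable_cmult sq_summable_emp rear_est_contraction gren_est_contraction)+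

lemma scaled_err_l2_le:
  "l2 (scaled_err p rear_est xs n) \<le> l2 (scaled_err p emp_est xs n)"
  "l2 (scaled_err p gren_est xs n) \<le> l2 (scaled_err p emp_est xs n)"
  using rear_est_contraction gren_est_contraction sq_summable_emp
  by (auto simp: scaled_err_def[abs_def] l2_scale intro!: mult_left_mono)

text \<open>The deterministic core. Once the empirical vector is close to \<open>p\<close>, both
  estimators respect the drops of \<open>p\<close> in front of the cut: the Grenander error is there
  the blockwise majorant of the empirical error, and rearrangement merely permutes errors inside
  level sets. Behind the cut only contraction is used. The radius \<open>\<epsilon>\<close> depends
  neither on the sample nor on \<open>n\<close> or \<open>k\<close>.\<close>

lemma est_approx:
  assumes M: "0 < M" "p M < p (M - 1)"
  obtains \<epsilon> where "\<epsilon> > 0"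
    "\<And>xs n k. \<lbrakk>0 < n; 2 \<le> k; l2 (\<lambda>x. emp_est xs n x - p x) < \<epsilon>\<rbrakk> \<Longrightarrow>
       \<bar>lnorm k (scaled_err p gren_est xs n) - lnorm k (gren_blocks p (scaled_err p emp_est xs n))\<bar>
         \<le> 2 * l2 (\<lambda>x. scaled_err p emp_est xs n x - trunc M (scaled_err p emp_est xs n) x)"
    "\<And>xs n k. \<lbrakk>0 < n; 2 \<le> k; l2 (\<lambda>x. emp_est xs n x - p x) < \<epsilon>\<rbrakk> \<Longrightarrow>
       \<bar>lnorm k (scaled_err p rear_est xs n) - lnorm k (scaled_err p emp_est xs n)\<bar>
         \<le> 2 * l2 (\<lambda>x. scaled_err p emp_est xs n x - trunc M (scaled_err p emp_est xs n) x)"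
proof -
  obtain \<epsilon> where e: "\<epsilon> > 0" "\<And>t. t < M \<Longrightarrow> p (Suc t) < p t \<Longrightarrow> 2 * \<epsilon> \<le> p t - p (Suc t)"
    using gap_exists[of M] by blast
  note anti = monotone_decreasing_le[OF mono]
  have M1: "Suc (M - 1) = M" using M by simp
  have eM: "2 * \<epsilon> \<le> p (M - 1) - p M" using e(2)[of "M - 1"] M by simp
  have nfM: "\<not> flat p (M - 1)" using M by (simp add: flat_def)
  have pos: "0 < p t" if "t < M" for t
  proof -
    have "p (M - 1) \<le> p t" by (rule anti) (use that in simp)
    then show ?thesis using M nonneg[of M] by linarith
  qed
  {
    fix xs n and k :: ereal assume n: "0 < n" and k: "2 \<le> k" and ev: "l2 (\<lambda>x. emp_est xs n x - p x) < \<epsilon>"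
    define m where "m = length (emp_vec xs n)"
    define w where "w = emp_est xs n"
    define r where "r = rear_est xs n"
    define g where "g = gren_est xs n"
    define a where "a = sqrt (real n)"
    have a: "0 < a" using n by (simp add: a_def)
    have w: "\<bar>w x - p x\<bar> < \<epsilon>" for x
      using abs_le_l2[OF sq_summable_emp, of xs n x] ev by (simp add: w_def)
    have r: "\<bar>r x - p x\<bar> < \<epsilon>" for x
      using abs_le_l2[OF rear_est_contraction(1), of xs n x] rear_est_contraction(2)[of xs n] ev by (simp add: r_def)
    have g: "\<bar>g x - p x\<bar> < \<epsilon>" for x
      using abs_le_l2[OF gren_est_contraction(1), of xs n x] gren_est_contraction(2)[of xs n] ev by (simp add: g_def)
    \<comment> \<open>The observed range must reach the cut: otherwise the empirical mass at
      \<open>M - 1\<close> would be zero, although it lies within \<open>\<epsilon>\<close> of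
      \<open>p (M - 1) \<ge> 2 * \<epsilon>\<close>.\<close>
    have Mm: "M \<le> m"
    proof (rule ccontr)
      assume "\<not> M \<le> m"
      then have "w (M - 1) = 0" unfolding w_def by (intro emp_est_zero) (simp add: m_def)
      then show False using w[of "M - 1"] eM nonneg[of M] e(1) by simp
    qed
    have kg: "kkt (\<lambda>_. True) w g m" using kkt_gren_est by (simp add: w_def g_def m_def)
    \<comment> \<open>Without contact \<open>g\<close> would tie across a drop of at least
      \<open>2 * \<epsilon>\<close>, which is impossible for a vector within
      \<open>\<epsilon>\<close> of \<open>p\<close>.\<close>
    have touch: "\<not> p (Suc t) < p t" if "t < M" "Suc t < m" "sum w {..<Suc t} < sum g {..<Suc t}" for t
    proof
      assume "p (Suc t) < p t"
      then have "2 * \<epsilon> \<le> p t - p (Suc t)" using e(2) that by simp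
      then have "g (Suc t) \<noteq> g t" using g[of t] g[of "Suc t"] by linarith
      moreover have "g (Suc t) = g t" using kg that unfolding kkt_def by blast
      ultimately show False by simp
    qed
    have GM: "sum g {..<M} = sum w {..<M}"
    proof (cases "M = m")
      case True
      then show ?thesis using kg by (simp add: kkt_def)
    next
      case False
      then have "\<not> sum w {..<M} < sum g {..<M}" using touch[of "M - 1"] M Mm unfolding M1 by auto
      moreover have "sum w {..<M} \<le> sum g {..<M}" using kg Mm by (simp add: kkt_def)
      ultimately show ?thesis by simp
    qed
    let ?Y = "scaled_err p emp_est xs n" and ?G = "scaled_err p gren_est xs n" and ?R = "scaled_err p rear_est xs n"
    have Y: "?Y = (\<lambda>x. a * (w x - p x))" and G: "?G = (\<lambda>x. a * (g x - p x))" and R: "?R = (\<lambda>x. a * (r x - p x))"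
      by (simp_all add: scaled_err_def[abs_def] a_def w_def g_def r_def)
    have "kkt (flat p) ?Y ?G M"
      unfolding Y G
    proof (rule kkt_affine[OF kg Mm GM a])
      fix t assume t: "Suc t < M" "sum w {..<Suc t} < sum g {..<Suc t}"
      then have "\<not> p (Suc t) < p t" using touch Mm by simp
      then show "flat p t" using anti[of t "Suc t"] pos[of t] t by (simp add: flat_def)
    qed (simp add: flat_def)
    moreover have "kkt (flat p) ?Y (gren_blocks p ?Y) M" using kkt_gren_blocks[OF mono nonneg] nfM by blast
    ultimately have "?G x = gren_blocks p ?Y x" if "x < M" for x using that kkt_unique by blast
    then have "trunc M ?G = trunc M (gren_blocks p ?Y)" by (auto simp: trunc_def fun_eq_iff)
    then have hG: "lnorm k (trunc M ?G) = lnorm k (trunc M (gren_blocks p ?Y))" by simp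
    have sqG: "sq_summable ?G" "sq_summable ?Y" "sq_summable ?R" using scaled_err_sq_summable by auto
    have tG: "l2 (\<lambda>x. ?G x - trunc M ?G x) \<le> l2 (\<lambda>x. ?Y x - trunc M ?Y x)"
    proof (rule l2_tail_le_extend[where m = m])
      have "(\<Sum>x<m - M. (g (M + x) - p (M + x))\<^sup>2) \<le> (\<Sum>x<m - M. (w (M + x) - p (M + x))\<^sup>2)"
        using kkt_sq_dist_le[OF kkt_drop[OF kg Mm GM], of "\<lambda>x. p (M + x)"] anti by simp
      then show "(\<Sum>x<m - M. (?G (M + x))\<^sup>2) \<le> (\<Sum>x<m - M. (?Y (M + x))\<^sup>2)"
        unfolding Y G by (simp add: power_mult_distrib sum_distrib_left[symmetric] mult_left_mono)
      show "?G x = ?Y x" if "m \<le> x" for x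
        using that by (simp add: Y G w_def g_def m_def emp_est_zero gren_est_zero)
    qed (use sqG Mm in auto)
    have "\<bar>lnorm k ?G - lnorm k (gren_blocks p ?Y)\<bar> \<le> 2 * l2 (\<lambda>x. ?Y x - trunc M ?Y x)"
      by (rule lnorm_head_eq_approx[OF sqG(1) gren_blocks_l2(1)[OF mono nonneg p_tendsto_0 sqG(2)] k hG tG
            gren_blocks_tail[OF sqG(2) nfM]])
    moreover
    \<comment> \<open>The entries in front of a drop are exactly those above the midpoint
      \<open>\<theta>\<close>, for the sorted vector as for the unsorted one; so sorting moves no
      entry across the drop.\<close>
    have cut: "(\<Sum>x<c. \<phi> (r x)) = (\<Sum>x<c. \<phi> (w x))" if c: "0 < c" "c \<le> M" "p c < p (c - 1)" for \<phi> :: "real \<Rightarrow> real" and c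
    proof -
      define \<theta> where "\<theta> = (p (c - 1) + p c) / 2"
      have gap: "2 * \<epsilon> \<le> p (c - 1) - p c" using e(2)[of "c - 1"] c by simp
      have *: "(\<Sum>x<c. \<phi> (u x)) = (\<Sum>x<m. if u x > \<theta> then \<phi> (u x) else 0)"
        if u: "\<And>x. \<bar>u x - p x\<bar> < \<epsilon>" for u
      proof -
        have 1: "u x > \<theta>" if "x < c" for x
        proof -
          have "p (c - 1) \<le> p x" by (rule anti) (use that in simp)
          then show ?thesis using u[of x] gap unfolding \<theta>_def by (simp add: field_simps)
        qed
        have 2: "\<not> u x > \<theta>" if "\<not> x < c" for x
        proof -
          have "p x \<le> p c" by (rule anti) (use that in simp)
          then show ?thesis using u[of x] gap unfolding \<theta>_def by (simp add: field_simps)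
        qed
        have "(\<Sum>x<m. if u x > \<theta> then \<phi> (u x) else 0) = (\<Sum>x<m. if x < c then \<phi> (u x) else 0)"
          using 1 2 by (intro sum.cong) auto
        also have "\<dots> = (\<Sum>x\<in>{..<m} \<inter> {x. x < c}. \<phi> (u x))" by (simp add: sum.inter_restrict)
        also have "{..<m} \<inter> {x. x < c} = {..<c}" using c Mm by auto
        finally show ?thesis by simp
      qed
      show ?thesis
        unfolding *[OF r] *[OF w]
        using sum_rear_est[of "\<lambda>y. if y > \<theta> then \<phi> y else 0" xs n] unfolding r_def w_def m_def .
    qed
    \<comment> \<open>The error is not a function of the entry alone, so the claim is proved level
      set by level set: there \<open>p\<close> is constant, and a block sum is the difference of two
      head sums furnished by \<open>cut\<close>.\<close>
    have head: "(\<Sum>x<c. \<phi> (r x - p x)) = (\<Sum>x<c. \<phi> (w x - p x))"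
      if "c = 0 \<or> p c < p (c - 1)" "c \<le> M" for \<phi> :: "real \<Rightarrow> real" and c
      using that
    proof (induction c rule: less_induct)
      case (less c)
      show ?case
      proof (cases "c = 0")
        case False
        then have c: "0 < c" "p c < p (c - 1)" using less.prems by auto
        define b where "b = (LEAST x. p x = p (c - 1))"
        have b: "b \<le> c - 1" "p b = p (c - 1)" unfolding b_def by (auto intro: Least_le LeastI)
        have const: "p x = p b" if "b \<le> x" "x \<le> c - 1" for x
          using anti[OF that(1)] anti[OF that(2)] b by simp
        have b0: "b = 0 \<or> p b < p (b - 1)"
        proof (rule ccontr)
          assume A: "\<not> (b = 0 \<or> p b < p (b - 1))"
          then have "p (b - 1) = p (c - 1)" using anti[of "b - 1" b] b by simp
          then have "b \<le> b - 1" unfolding b_def by (rule Least_le)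
          then show False using A by (cases b) auto
        qed
        have IH: "(\<Sum>x<b. \<phi> (r x - p x)) = (\<Sum>x<b. \<phi> (w x - p x))"
          using less.IH[of b] b0 b less.prems c by simp
        have eqb: "(\<Sum>x<b. \<phi> (r x - p b)) = (\<Sum>x<b. \<phi> (w x - p b))"
          using cut[of b "\<lambda>y. \<phi> (y - p b)"] b0 b c less.prems by (cases "b = 0") auto
        have eqc: "(\<Sum>x<c. \<phi> (r x - p b)) = (\<Sum>x<c. \<phi> (w x - p b))"
          using cut[of c "\<lambda>y. \<phi> (y - p b)"] c less.prems by simp
        have split: "(\<Sum>x<c. \<phi> (u x - p x)) = (\<Sum>x<b. \<phi> (u x - p x)) + ((\<Sum>x<c. \<phi> (u x - p b)) - (\<Sum>x<b. \<phi> (u x - p b)))" for u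
        proof -
          have "(\<Sum>x<b + (c - b). \<phi> (u x - p x)) = (\<Sum>x<b. \<phi> (u x - p x)) + (\<Sum>x<c - b. \<phi> (u (b + x) - p (b + x)))"
            by (rule sum_lessThan_add)
          also have "(\<Sum>x<c - b. \<phi> (u (b + x) - p (b + x))) = (\<Sum>x<c - b. \<phi> (u (b + x) - p b))"
          proof (rule sum.cong)
            fix x assume "x \<in> {..<c - b}"
            then have "p (b + x) = p b" by (intro const) auto
            then show "\<phi> (u (b + x) - p (b + x)) = \<phi> (u (b + x) - p b)" by simp
          qed simp
          also have "\<dots> = (\<Sum>x<b + (c - b). \<phi> (u x - p b)) - (\<Sum>x<b. \<phi> (u x - p b))"
            by (subst sum_lessThan_add) simp
          finally show ?thesis using b c by simp
        qed
        show ?thesis unfolding split IH eqb eqc by simp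
      qed simp
    qed
    have headM: "(\<Sum>x<M. \<phi> (?R x)) = (\<Sum>x<M. \<phi> (?Y x))" for \<phi> :: "real \<Rightarrow> real"
      using head[of M "\<lambda>y. \<phi> (a * y)"] M by (simp add: Y R)
    \<comment> \<open>Heads of equal norm and a total norm that is no larger leave a tail that is no
      larger.\<close>
    have tR: "l2 (\<lambda>x. ?R x - trunc M ?R x) \<le> l2 (\<lambda>x. ?Y x - trunc M ?Y x)"
    proof -
      have *: "(l2 v)\<^sup>2 = (\<Sum>x<M. (v x)\<^sup>2) + (l2 (\<lambda>x. v x - trunc M v x))\<^sup>2" if "sq_summable v" for v
        using suminf_split_initial_segment[OF that, of M] l2_sq[OF that] l2_tail_sq[OF that, of M] by simp
      have "(l2 ?R)\<^sup>2 \<le> (l2 ?Y)\<^sup>2"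
        using scaled_err_l2_le(1) l2_nonneg[OF sqG(3)] by (intro power_mono)
      then have "(l2 (\<lambda>x. ?R x - trunc M ?R x))\<^sup>2 \<le> (l2 (\<lambda>x. ?Y x - trunc M ?Y x))\<^sup>2"
        using *[OF sqG(2)] *[OF sqG(3)] headM[of "\<lambda>y. y\<^sup>2"] by simp
      then show ?thesis
        by (rule power2_le_imp_le) (intro l2_nonneg sq_summable_diff sqG sq_summable_trunc)
    qed
    have "\<bar>lnorm k ?R - lnorm k ?Y\<bar> \<le> 2 * l2 (\<lambda>x. ?Y x - trunc M ?Y x)"
      by (rule lnorm_head_eq_approx[OF sqG(3) sqG(2) k lnorm_trunc_cong[OF headM k] tR order_refl])
    ultimately have "\<bar>lnorm k ?G - lnorm k (gren_blocks p ?Y)\<bar> \<le> 2 * l2 (\<lambda>x. ?Y x - trunc M ?Y x) \<and>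
      \<bar>lnorm k ?R - lnorm k ?Y\<bar> \<le> 2 * l2 (\<lambda>x. ?Y x - trunc M ?Y x)" by blast
  }
  then show ?thesis using that e(1) by blast
qed

end

section \<open>Weak limits along Lipschitz functionals\<close>

text \<open>Real trigonometric polynomials in finitely many coordinates. The phase
  \<open>\<theta>\<close> covers sines as well. Products of cosines are sums of cosines, so these
  functions form an algebra, and their expectations are determined by those of the cosines of linear
  forms.\<close>

inductive trig :: "((nat \<Rightarrow> real) \<Rightarrow> real) \<Rightarrow> bool" where
  trig_cos: "trig (\<lambda>z. c * cos ((\<Sum>x<m. a x * z x) + \<theta>))"
| trig_add: "trig f \<Longrightarrow> trig g \<Longrightarrow> trig (\<lambda>z. f z + g z)"

lemma sum_extend_zero:
  fixes z :: "nat \<Rightarrow> real"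
  assumes "m \<le> l"
  shows "(\<Sum>x<m. a x * z x) = (\<Sum>x<l. (if x < m then a x else 0) * z x)"
proof -
  have "(\<Sum>x<l. (if x < m then a x else 0) * z x) = (\<Sum>x<m. (if x < m then a x else 0) * z x)"
    by (rule sum.mono_neutral_right) (use assms in auto)
  then show ?thesis by simp
qed

lemma trig_const: "trig (\<lambda>_. c)"
  using trig_cos[where c = c and m = 0 and \<theta> = 0] by simp

lemma trig_mult:
  assumes "trig f" "trig g"
  shows "trig (\<lambda>z. f z * g z)"
  using assms
proof (induction f)
  case (trig_cos c a m \<theta>)
  from trig_cos show ?case
  proof (induction g)
    case (trig_cos d b l \<eta>)
    let ?n = "max m l"
    let ?a = "\<lambda>x. if x < m then a x else 0" and ?b = "\<lambda>x. if x < l then b x else 0"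
    have "c * cos ((\<Sum>x<m. a x * z x) + \<theta>) * (d * cos ((\<Sum>x<l. b x * z x) + \<eta>)) =
      (c * d / 2) * cos ((\<Sum>x<?n. (?a x - ?b x) * z x) + (\<theta> - \<eta>)) +
      (c * d / 2) * cos ((\<Sum>x<?n. (?a x + ?b x) * z x) + (\<theta> + \<eta>))" for z :: "nat \<Rightarrow> real"
    proof -
      let ?A = "\<Sum>x<m. a x * z x" and ?B = "\<Sum>x<l. b x * z x"
      have e: "(\<Sum>x<?n. (?a x - ?b x) * z x) = ?A - ?B" "(\<Sum>x<?n. (?a x + ?b x) * z x) = ?A + ?B"
        using sum_extend_zero[of m ?n a z] sum_extend_zero[of l ?n b z]
        by (simp_all only: left_diff_distrib distrib_right sum_subtractf sum.distrib max.cobounded1 max.cobounded2)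
      have r: "?A - ?B + (\<theta> - \<eta>) = (?A + \<theta>) - (?B + \<eta>)" "?A + ?B + (\<theta> + \<eta>) = (?A + \<theta>) + (?B + \<eta>)"
        by simp_all
      have "cos (?A + \<theta>) * cos (?B + \<eta>) = (cos ((?A + \<theta>) - (?B + \<eta>)) + cos ((?A + \<theta>) + (?B + \<eta>))) / 2"
        by (rule cos_times_cos)
      then show ?thesis unfolding e r by algebra
    qed
    then show ?case by (simp only:) (intro trig.intros)
  next
    case (trig_add f g)
    then show ?case using trig.trig_add by (simp add: distrib_left)
  qed
next
  case (trig_add f g)
  then show ?case using trig.trig_add by (simp add: distrib_right)
qed

lemma trig_bounded: "trig f \<Longrightarrow> \<exists>B. \<forall>z. \<bar>f z\<bar> \<le> B"
proof (induction rule: trig.induct)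
  case (trig_cos c a m \<theta>)
  then show ?case by (intro exI[of _ "\<bar>c\<bar>"]) (simp add: abs_mult mult_left_le)
next
  case (trig_add f g)
  then obtain A B where "\<forall>z. \<bar>f z\<bar> \<le> A" "\<forall>z. \<bar>g z\<bar> \<le> B" by blast
  then have "\<forall>z. \<bar>f z + g z\<bar> \<le> A + B" by (metis abs_triangle_ineq add_mono order_trans)
  then show ?case by blast
qed

lemma trig_continuous: "trig f \<Longrightarrow> continuous_on S f"
  by (induction rule: trig.induct)
    (auto intro!: continuous_intros continuous_on_subset[OF continuous_on_product_coordinates])

lemma trig_trunc: "trig f \<Longrightarrow> trig (\<lambda>z. f (trunc m z))"
proof (induction rule: trig.induct)
  case (trig_cos c a l \<theta>)
  have "(\<Sum>x<l. a x * trunc m z x) = (\<Sum>x<l. (if x < m then a x else 0) * z x)" for z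
    by (intro sum.cong) (auto simp: trunc_def)
  then show ?case using trig.trig_cos by simp
qed (rule trig.trig_add)

text \<open>The sine of one rescaled coordinate suffices: \<open>b\<close> brings both values into
  \<open>[-1, 1]\<close>, where the sine is injective.\<close>

lemma trig_separates:
  assumes "z \<noteq> z'" shows "\<exists>f. trig f \<and> f z \<noteq> f z'"
proof -
  obtain x where x: "z x \<noteq> z' x" using assms by auto
  define b where "b = 1 / (1 + \<bar>z x\<bar> + \<bar>z' x\<bar>)"
  have b: "b > 0" by (simp add: b_def)
  let ?a = "\<lambda>y. if y = x then b else 0"
  have s: "(\<Sum>y<Suc x. ?a y * u y) = b * u x" for u :: "nat \<Rightarrow> real"
    by (simp add: if_distrib[of "\<lambda>c. c * _"] cong: if_cong)
  have "trig (\<lambda>u. 1 * cos ((\<Sum>y<Suc x. ?a y * u y) + - (pi / 2)))" by (rule trig_cos)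
  moreover have "cos (y + - (pi / 2)) = sin y" for y :: real by (simp only: cos_add) simp
  ultimately have t: "trig (\<lambda>u. sin (b * u x))" unfolding s by simp
  have "\<bar>b * z x\<bar> \<le> 1" "\<bar>b * z' x\<bar> \<le> 1" by (auto simp: b_def field_simps)
  then have "- (pi / 2) \<le> b * z x" "b * z x \<le> pi / 2" "- (pi / 2) \<le> b * z' x" "b * z' x \<le> pi / 2"
    using pi_gt3 by linarith+
  then have "sin (b * z x) \<noteq> sin (b * z' x)" using sin_inj_pi[of "b * z x" "b * z' x"] x b by auto
  with t show ?thesis by blast
qed

lemma trig_poly:
  assumes "trig g" shows "trig (\<lambda>z. \<Sum>i\<le>(n::nat). c i * g z ^ i)"
proof -
  have p: "trig (\<lambda>z. g z ^ i)" for i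
    by (induction i) (auto intro: trig_mult trig_const assms)
  show ?thesis
    by (induction n) (auto intro!: trig_add trig_mult trig_const p assms simp: trig_const[of "c 0"])
qed

lemma compact_cube: "compact {z :: nat \<Rightarrow> real. \<forall>x. \<bar>z x\<bar> \<le> R}"
proof -
  have "{z :: nat \<Rightarrow> real. \<forall>x. \<bar>z x\<bar> \<le> R} = PiE UNIV (\<lambda>_. {-R..R})"
    by (auto simp: PiE_iff abs_le_iff minus_le_iff)
  moreover have "compactin (product_topology (\<lambda>_. euclidean) UNIV) (PiE (UNIV :: nat set) (\<lambda>_. {-R..R}))"
    unfolding compactin_PiE by simp
  ultimately show ?thesis by (simp add: euclidean_product_topology)
qed

text \<open>Stone-Weierstrass controls the approximant \<open>g\<close> only on the cube, but
  expectations need a bound everywhere in terms of \<open>B\<close>. Composing \<open>g\<close> with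
  a polynomial close to \<open>clip\<close> on an interval containing the range of \<open>g\<close>
  provides it without leaving the algebra.\<close>

lemma trig_approx:
  assumes F: "continuous_on UNIV F" "\<And>z. \<bar>F z\<bar> \<le> B" and "\<epsilon> > 0"
  shows "\<exists>q. trig q \<and> (\<forall>z. \<bar>q z\<bar> \<le> B + \<epsilon>) \<and> (\<forall>z. (\<forall>x. \<bar>z x\<bar> \<le> R) \<longrightarrow> \<bar>q z - F z\<bar> < \<epsilon>)"
proof -
  define K where "K = {z :: nat \<Rightarrow> real. \<forall>x. \<bar>z x\<bar> \<le> R}"
  have "\<exists>g. trig g \<and> (\<forall>x\<in>K. \<bar>F x - g x\<bar> < \<epsilon> / 2)"
    by (rule Stone_Weierstrass_HOL)
      (use assms compact_cube in \<open>auto simp: K_def intro: trig_const trig_continuous trig_add trig_mult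
        trig_separates continuous_on_subset\<close>)
  then obtain g where g: "trig g" "\<And>z. z \<in> K \<Longrightarrow> \<bar>F z - g z\<bar> < \<epsilon> / 2" by blast
  obtain G where G: "\<And>z. \<bar>g z\<bar> \<le> G" using trig_bounded[OF g(1)] by blast
  define clip where "clip y = max (- B) (min B y)" for y
  have clip: "continuous_on {-G..G} clip"
    unfolding clip_def by (intro continuous_intros)
  obtain r where r: "real_polynomial_function r" "\<And>y. y \<in> {-G..G} \<Longrightarrow> \<bar>clip y - r y\<bar> < \<epsilon> / 2"
    using Stone_Weierstrass_real_polynomial_function[OF _ clip, of "\<epsilon> / 2"] \<open>\<epsilon> > 0\<close> by auto
  obtain c n where rc: "r = (\<lambda>y. \<Sum>i\<le>(n::nat). c i * y ^ i)"
    using real_polynomial_function_imp_sum[OF r(1)] by auto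
  have t: "trig (\<lambda>z. r (g z))" unfolding rc by (rule trig_poly[OF g(1)])
  have B: "0 \<le> B" using F(2)[of undefined] abs_ge_zero order_trans by blast
  have "g z \<in> {-G..G}" for z using G[of z] by (simp add: abs_le_iff minus_le_iff)
  note r' = r(2)[OF this]
  have "\<bar>r (g z)\<bar> \<le> B + \<epsilon>" for z
  proof -
    have "\<bar>clip (g z)\<bar> \<le> B" using B by (auto simp: clip_def)
    then show ?thesis using r'[of z] \<open>\<epsilon> > 0\<close> by (auto simp: abs_if split: if_splits)
  qed
  moreover have "\<bar>r (g z) - F z\<bar> < \<epsilon>" if "z \<in> K" for z
  proof -
    have "\<bar>clip (g z) - F z\<bar> < \<epsilon> / 2"
      using g(2)[OF that] F(2)[of z] B by (auto simp: clip_def min_def max_def abs_minus_commute)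
    then show ?thesis using r'[of z] by linarith
  qed
  ultimately show ?thesis using t by (intro exI[of _ "\<lambda>z. r (g z)"]) (auto simp: K_def)
qed

text \<open>Restricted to square-summable sequences, because elsewhere the infinite sums behind the
  norms may take default values.\<close>

definition l2_lipschitz :: "real \<Rightarrow> ((nat \<Rightarrow> real) \<Rightarrow> real) \<Rightarrow> bool" where
  "l2_lipschitz C f \<longleftrightarrow>
    (\<forall>z z'. sq_summable z \<longrightarrow> sq_summable z' \<longrightarrow> \<bar>f z - f z'\<bar> \<le> C * l2 (\<lambda>x. z x - z' x))"

lemma l2_trunc_diff: "l2 (\<lambda>x. trunc m z x - trunc m z' x) = sqrt (\<Sum>x<m. (z x - z' x)\<^sup>2)"
  unfolding l2_def by (subst suminf_finite[of "{..<m}"]) (auto simp: trunc_def)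

text \<open>On finitely many coordinates norm and product topology agree, so truncation restores the
  continuity that \<open>f\<close> itself may lack.\<close>

lemma l2_lipschitz_trunc_continuous:
  assumes "l2_lipschitz C f" shows "continuous_on UNIV (\<lambda>z. f (trunc m z))"
  unfolding continuous_on_def
proof
  fix z0 :: "nat \<Rightarrow> real"
  have "((\<lambda>z. C * sqrt (\<Sum>x<m. (z x - z0 x)\<^sup>2)) \<longlongrightarrow> C * sqrt (\<Sum>x<m. (z0 x - z0 x)\<^sup>2)) (at z0)"
    by (intro tendsto_intros)
       (metis UNIV_I continuous_on_def continuous_on_product_coordinates)
  then have "((\<lambda>z. C * sqrt (\<Sum>x<m. (z x - z0 x)\<^sup>2)) \<longlongrightarrow> 0) (at z0)" by simp
  then have "((\<lambda>z. f (trunc m z) - f (trunc m z0)) \<longlongrightarrow> 0) (at z0)"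
    by (rule Lim_null_comparison[rotated])
       (use assms in \<open>auto simp: l2_lipschitz_def l2_trunc_diff[symmetric] intro!: always_eventually\<close>)
  then show "((\<lambda>z. f (trunc m z)) \<longlongrightarrow> f (trunc m z0)) (at z0)" by (simp add: LIM_zero_iff)
qed

lemma l2_tail_tendsto_0:
  assumes "sq_summable z" shows "(\<lambda>m. l2 (\<lambda>x. z x - trunc m z x)) \<longlonglongrightarrow> 0"
proof -
  have "(\<lambda>m. \<Sum>x. (z (x + m))\<^sup>2) \<longlonglongrightarrow> 0"
    using suminf_exist_split[OF _ assms] by (simp add: LIMSEQ_iff)
  then have "(\<lambda>m. sqrt ((l2 (\<lambda>x. z x - trunc m z x))\<^sup>2)) \<longlonglongrightarrow> sqrt 0"
    unfolding l2_tail_sq[OF assms] by (rule tendsto_real_sqrt)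
  then show ?thesis using assms by (simp add: l2_nonneg sq_summable_diff)
qed

lemma l2_lipschitz_tendsto:
  assumes "l2_lipschitz C f" "sq_summable z" shows "(\<lambda>m. f (trunc m z)) \<longlonglongrightarrow> f z"
proof -
  have le: "norm (f (trunc m z) - f z) \<le> C * l2 (\<lambda>x. z x - trunc m z x)" for m
    using assms sq_summable_trunc[of m z] unfolding l2_lipschitz_def l2_diff_commute[of z "trunc m z"]
    by simp
  have ev: "\<forall>\<^sub>F m in sequentially. norm (f (trunc m z) - f z) \<le> C * l2 (\<lambda>x. z x - trunc m z x)"
    using le by (rule always_eventually[OF allI])
  have "(\<lambda>m. C * l2 (\<lambda>x. z x - trunc m z x)) \<longlonglongrightarrow> 0"
    using tendsto_mult_left[OF l2_tail_tendsto_0[OF assms(2)], of C] by simp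
  from Lim_null_comparison[OF ev this] show ?thesis by (rule LIM_zero_cancel)
qed

text \<open>\<open>f\<close> need not be continuous for the product topology; it is measurable along
  \<open>Z\<close> as the pointwise limit of the continuous functionals
  \<open>f (trunc m z)\<close>.\<close>

lemma l2_lipschitz_measurable:
  assumes meas: "\<And>x. (\<lambda>\<omega>. Z \<omega> x) \<in> borel_measurable M"
    and sq: "\<And>\<omega>. \<omega> \<in> space M \<Longrightarrow> sq_summable (Z \<omega>)" and f: "l2_lipschitz C f"
  shows "(\<lambda>\<omega>. f (Z \<omega>)) \<in> borel_measurable M"
proof (rule borel_measurable_LIMSEQ_real)
  show "(\<lambda>m. f (trunc m (Z \<omega>))) \<longlonglongrightarrow> f (Z \<omega>)" if "\<omega> \<in> space M" for \<omega>
    by (rule l2_lipschitz_tendsto[OF f sq[OF that]])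
  have "Z \<in> borel_measurable M" using meas by (rule measurable_coordinatewise_then_product)
  moreover have "(\<lambda>z. f (trunc m z)) \<in> borel_measurable borel" for m
    using l2_lipschitz_trunc_continuous[OF f] by (rule borel_measurable_continuous_onI)
  ultimately show "(\<lambda>\<omega>. f (trunc m (Z \<omega>))) \<in> borel_measurable M" for m
    by (rule measurable_compose)
qed

lemma tendsto_by_approx:
  fixes a :: "nat \<Rightarrow> real"
  assumes "\<And>\<epsilon>. \<epsilon> > 0 \<Longrightarrow> \<exists>b b'. b \<longlonglongrightarrow> b' \<and> (\<forall>\<^sub>F n in sequentially. \<bar>a n - b n\<bar> \<le> \<epsilon>) \<and> \<bar>a' - b'\<bar> \<le> \<epsilon>"
  shows "a \<longlonglongrightarrow> a'"
proof (rule tendstoI)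
  fix e :: real assume "e > 0"
  then obtain b b' where b: "b \<longlonglongrightarrow> b'" "\<forall>\<^sub>F n in sequentially. \<bar>a n - b n\<bar> \<le> e / 4" "\<bar>a' - b'\<bar> \<le> e / 4"
    using assms[of "e / 4"] by auto
  have "\<forall>\<^sub>F n in sequentially. dist (b n) b' < e / 4" using b(1) \<open>e > 0\<close> by (intro tendstoD) auto
  with b(2) show "\<forall>\<^sub>F n in sequentially. dist (a n) a' < e"
  proof eventually_elim
    case (elim n)
    then show ?case using b(3) \<open>e > 0\<close> unfolding dist_real_def by linarith
  qed
qed

text \<open>Tightness in quantitative form. In the limit theorem one summable \<open>v\<close>
  serves the whole sequence, which makes the tails uniformly small.\<close>

locale sq_bounded = prob_space M for M :: "'a measure" +
  fixes Z :: "'a \<Rightarrow> nat \<Rightarrow> real" and v :: "nat \<Rightarrow> real"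
  assumes meas: "\<And>x. (\<lambda>\<omega>. Z \<omega> x) \<in> borel_measurable M"
    and sq: "\<And>\<omega>. \<omega> \<in> space M \<Longrightarrow> sq_summable (Z \<omega>)"
    and v: "summable v"
    and sq_int: "\<And>x. integrable M (\<lambda>\<omega>. (Z \<omega> x)\<^sup>2)" "\<And>x. expectation (\<lambda>\<omega>. (Z \<omega> x)\<^sup>2) \<le> v x"
begin

lemma v_nonneg: "0 \<le> v x"
  using sq_int(2)[of x] by (rule order_trans[rotated]) simp

lemma tail_integral:
  "integrable M (\<lambda>\<omega>. \<Sum>x. (Z \<omega> (x + m))\<^sup>2)" "expectation (\<lambda>\<omega>. \<Sum>x. (Z \<omega> (x + m))\<^sup>2) \<le> (\<Sum>x. v (x + m))"
proof -
  have vm: "summable (\<lambda>x. v (x + m))" using v by (subst summable_iff_shift)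
  have 1: "AE \<omega> in M. summable (\<lambda>x. norm ((Z \<omega> (x + m))\<^sup>2))"
  proof (rule AE_I2)
    fix \<omega> assume "\<omega> \<in> space M"
    from sq[OF this] show "summable (\<lambda>x. norm ((Z \<omega> (x + m))\<^sup>2))"
      using summable_iff_shift[of "\<lambda>x. (Z \<omega> x)\<^sup>2" m] by simp
  qed
  have 2: "summable (\<lambda>x. expectation (\<lambda>\<omega>. norm ((Z \<omega> (x + m))\<^sup>2)))"
    by (rule summable_comparison_test'[OF vm]) (use sq_int in simp)
  show "integrable M (\<lambda>\<omega>. \<Sum>x. (Z \<omega> (x + m))\<^sup>2)"
    by (rule integrable_suminf[OF sq_int(1) 1 2])
  have "expectation (\<lambda>\<omega>. \<Sum>x. (Z \<omega> (x + m))\<^sup>2) = (\<Sum>x. expectation (\<lambda>\<omega>. (Z \<omega> (x + m))\<^sup>2))"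
    by (rule integral_suminf[OF sq_int(1) 1 2])
  also have "\<dots> \<le> (\<Sum>x. v (x + m))"
    by (rule suminf_le[OF sq_int(2) _ vm]) (use 2 in simp)
  finally show "expectation (\<lambda>\<omega>. \<Sum>x. (Z \<omega> (x + m))\<^sup>2) \<le> (\<Sum>x. v (x + m))" .
qed

text \<open>The inequality \<open>t \<le> \<delta> + t\<^sup>2 / \<delta>\<close> bounds the mean of
  the tail norm by that of its square. Once the tail sum of \<open>v\<close> is below
  \<open>\<delta>\<^sup>2\<close> the bound is at most \<open>2 * \<delta>\<close>.\<close>

lemma tail_l2_expectation:
  assumes "\<delta> > 0"
  shows "integrable M (\<lambda>\<omega>. l2 (\<lambda>x. Z \<omega> x - trunc m (Z \<omega>) x))"
    "expectation (\<lambda>\<omega>. l2 (\<lambda>x. Z \<omega> x - trunc m (Z \<omega>) x)) \<le> \<delta> + (\<Sum>x. v (x + m)) / \<delta>"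
proof -
  let ?t = "\<lambda>\<omega>. l2 (\<lambda>x. Z \<omega> x - trunc m (Z \<omega>) x)" and ?b = "\<lambda>\<omega>. \<delta> + (\<Sum>x. (Z \<omega> (x + m))\<^sup>2) / \<delta>"
  have b: "integrable M ?b" using tail_integral by simp
  have le: "?t \<omega> \<le> ?b \<omega>" and t0: "0 \<le> ?t \<omega>" if "\<omega> \<in> space M" for \<omega>
  proof -
    have *: "t \<le> \<delta> + t\<^sup>2 / \<delta>" for t :: real
    proof -
      have "0 \<le> (t - \<delta> / 2)\<^sup>2" by simp
      then have "t * \<delta> \<le> t\<^sup>2 + \<delta> * \<delta> / 4" by (simp add: power2_eq_square algebra_simps)
      moreover have "0 \<le> \<delta> * \<delta>" by simp
      ultimately have "t * \<delta> \<le> \<delta> * \<delta> + t\<^sup>2" by linarith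
      then show ?thesis using assms by (simp add: field_simps)
    qed
    show "?t \<omega> \<le> ?b \<omega>" using *[of "?t \<omega>"] unfolding l2_tail_sq[OF sq[OF that]] .
    show "0 \<le> ?t \<omega>" using sq[OF that] by (intro l2_nonneg sq_summable_diff) auto
  qed
  have m: "?t \<in> borel_measurable M"
  proof (rule measurable_cong[THEN iffD1])
    show "sqrt (\<Sum>x. (Z \<omega> (x + m))\<^sup>2) = ?t \<omega>" if "\<omega> \<in> space M" for \<omega>
      using t0[OF that] unfolding l2_tail_sq[OF sq[OF that], symmetric] by simp
    show "(\<lambda>\<omega>. sqrt (\<Sum>x. (Z \<omega> (x + m))\<^sup>2)) \<in> borel_measurable M"
      using tail_integral(1) by measurable
  qed
  show i: "integrable M ?t"
    by (rule Bochner_Integration.integrable_bound[OF b m]) (rule AE_I2, use le t0 in fastforce)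
  have "expectation ?t \<le> expectation ?b" by (rule integral_mono[OF i b le])
  also have "\<dots> = \<delta> + expectation (\<lambda>\<omega>. \<Sum>x. (Z \<omega> (x + m))\<^sup>2) / \<delta>"
    using tail_integral by (simp add: prob_space)
  also have "\<dots> \<le> \<delta> + (\<Sum>x. v (x + m)) / \<delta>" using tail_integral(2)[of m] assms by (simp add: divide_right_mono)
  finally show "expectation ?t \<le> \<delta> + (\<Sum>x. v (x + m)) / \<delta>" .
qed

lemma trig_measurable: "trig q \<Longrightarrow> (\<lambda>\<omega>. q (Z \<omega>)) \<in> borel_measurable M"
  using measurable_coordinatewise_then_product[OF meas]
    borel_measurable_continuous_onI[OF trig_continuous] by (rule measurable_compose)

lemma trig_integrable: "trig q \<Longrightarrow> integrable M (\<lambda>\<omega>. q (Z \<omega>))"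
  by (metis (mono_tags, lifting) AE_I2 integrable_const_bound real_norm_def trig_bounded trig_measurable)

text \<open>Three errors: the approximation on the cube; the probability of leaving the cube, by
  Chebyshev, where the two functions differ by at most \<open>2 * B + \<epsilon>\<close>; and the
  truncation at \<open>m\<close>, by the Lipschitz property.\<close>

lemma expectation_trig_approx:
  assumes f: "l2_lipschitz C f" "\<And>z. \<bar>f z\<bar> \<le> B" and q: "trig q" "\<And>z. \<bar>q z\<bar> \<le> B + \<epsilon>"
    "\<And>z. (\<forall>x. \<bar>z x\<bar> \<le> R) \<Longrightarrow> \<bar>q z - f (trunc m z)\<bar> < \<epsilon>"
    and pos: "0 < \<epsilon>" "0 < R" "0 < \<delta>" "0 \<le> C"
  shows "\<bar>expectation (\<lambda>\<omega>. f (Z \<omega>)) - expectation (\<lambda>\<omega>. q (trunc m (Z \<omega>)))\<bar> \<le>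
    \<epsilon> + (2 * B + \<epsilon>) * (\<Sum>x. v x) / R\<^sup>2 + C * (\<delta> + (\<Sum>x. v (x + m)) / \<delta>)"
proof -
  let ?t = "\<lambda>\<omega>. l2 (\<lambda>x. Z \<omega> x - trunc m (Z \<omega>) x)"
  let ?b = "\<lambda>\<omega>. \<epsilon> + (2 * B + \<epsilon>) * (\<Sum>x<m. (Z \<omega> x)\<^sup>2) / R\<^sup>2 + C * ?t \<omega>"
  have B: "0 \<le> B" using f(2)[of undefined] abs_ge_zero order_trans by blast
  have fm: "(\<lambda>\<omega>. f (Z \<omega>)) \<in> borel_measurable M" by (rule l2_lipschitz_measurable[OF meas sq f(1)])
  have fi: "integrable M (\<lambda>\<omega>. f (Z \<omega>))" by (rule integrable_const_bound[of _ B]) (use f fm in auto)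
  have qi: "integrable M (\<lambda>\<omega>. q (trunc m (Z \<omega>)))" using trig_integrable[OF trig_trunc[OF q(1)]] .
  have bi: "integrable M ?b" using tail_l2_expectation(1)[OF pos(3)] sq_int by auto
  have "\<bar>f (Z \<omega>) - q (trunc m (Z \<omega>))\<bar> \<le> ?b \<omega>" if "\<omega> \<in> space M" for \<omega>
  proof -
    let ?z = "Z \<omega>"
    have 1: "\<bar>f ?z - f (trunc m ?z)\<bar> \<le> C * ?t \<omega>"
      using f(1) sq[OF that] unfolding l2_lipschitz_def by simp
    have tt: "trunc m (trunc m ?z) = trunc m ?z" by (auto simp: trunc_def)
    have 2: "\<bar>q (trunc m ?z) - f (trunc m ?z)\<bar> \<le> \<epsilon> + (2 * B + \<epsilon>) * (\<Sum>x<m. (?z x)\<^sup>2) / R\<^sup>2"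
    proof (cases "\<forall>x<m. \<bar>?z x\<bar> \<le> R")
      case True
      then have "\<forall>x. \<bar>trunc m ?z x\<bar> \<le> R" using pos by (auto simp: trunc_def)
      from q(3)[OF this] have "\<bar>q (trunc m ?z) - f (trunc m ?z)\<bar> \<le> \<epsilon>" by (simp add: tt)
      moreover have "0 \<le> (2 * B + \<epsilon>) * (\<Sum>x<m. (?z x)\<^sup>2) / R\<^sup>2" using B pos by (simp add: sum_nonneg)
      ultimately show ?thesis by linarith
    next
      case False
      then obtain x where x: "x < m" "R < \<bar>?z x\<bar>" by auto
      then have "R\<^sup>2 \<le> (?z x)\<^sup>2" using pos by (simp add: abs_le_square_iff[symmetric])
      also have "\<dots> \<le> (\<Sum>x<m. (?z x)\<^sup>2)" using x by (intro member_le_sum) auto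
      finally have "1 \<le> (\<Sum>x<m. (?z x)\<^sup>2) / R\<^sup>2" using pos by simp
      then have "(2 * B + \<epsilon>) * 1 \<le> (2 * B + \<epsilon>) * ((\<Sum>x<m. (?z x)\<^sup>2) / R\<^sup>2)"
        using B pos by (intro mult_left_mono) auto
      then show ?thesis using q(2)[of "trunc m ?z"] f(2)[of "trunc m ?z"] pos by (simp add: abs_le_iff)
    qed
    show ?thesis using 1 2 by linarith
  qed
  note ptw = this
  have "\<bar>expectation (\<lambda>\<omega>. f (Z \<omega>)) - expectation (\<lambda>\<omega>. q (trunc m (Z \<omega>)))\<bar> =
      \<bar>expectation (\<lambda>\<omega>. f (Z \<omega>) - q (trunc m (Z \<omega>)))\<bar>" using fi qi by simp
  also have "\<dots> \<le> expectation (\<lambda>\<omega>. \<bar>f (Z \<omega>) - q (trunc m (Z \<omega>))\<bar>)" by (rule integral_abs_bound)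
  also have "\<dots> \<le> expectation ?b" using fi qi bi ptw by (intro integral_mono) auto
  also have "\<dots> = \<epsilon> + (2 * B + \<epsilon>) * (\<Sum>x<m. expectation (\<lambda>\<omega>. (Z \<omega> x)\<^sup>2)) / R\<^sup>2 + C * expectation ?t"
    using tail_l2_expectation(1)[OF pos(3)] sq_int by (simp add: prob_space)
  also have "\<dots> \<le> \<epsilon> + (2 * B + \<epsilon>) * (\<Sum>x. v x) / R\<^sup>2 + C * (\<delta> + (\<Sum>x. v (x + m)) / \<delta>)"
  proof -
    have "(\<Sum>x<m. expectation (\<lambda>\<omega>. (Z \<omega> x)\<^sup>2)) \<le> (\<Sum>x<m. v x)" using sq_int(2) by (intro sum_mono)
    also have "\<dots> \<le> (\<Sum>x. v x)" using v v_nonneg by (intro sum_le_suminf) auto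
    finally show ?thesis using tail_l2_expectation(2)[OF pos(3)] B pos
      by (intro add_mono mult_left_mono divide_right_mono) auto
  qed
  finally show ?thesis .
qed

end

text \<open>Since \<open>v\<close> is common to all \<open>n\<close>, the trigonometric
  approximation is uniform in \<open>n\<close>. The parameters make each of its four error terms at
  most \<open>e / 4\<close>.\<close>

theorem lipschitz_weak_limit:
  fixes M :: "'a measure" and N :: "'b measure"
  assumes Z: "\<And>n. sq_bounded M (Z n) v" and W: "sq_bounded N W v"
    and cos: "\<And>m a \<theta>. (\<lambda>n. \<integral>\<omega>. cos ((\<Sum>x<m. a x * Z n \<omega> x) + \<theta>) \<partial>M)
      \<longlonglongrightarrow> (\<integral>\<omega>. cos ((\<Sum>x<m. a x * W \<omega> x) + \<theta>) \<partial>N)"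
    and f: "l2_lipschitz C f" "\<And>z. \<bar>f z\<bar> \<le> B" "0 \<le> C"
  shows "(\<lambda>n. \<integral>\<omega>. f (Z n \<omega>) \<partial>M) \<longlonglongrightarrow> (\<integral>\<omega>. f (W \<omega>) \<partial>N)"
proof (rule tendsto_by_approx)
  fix e :: real assume e: "e > 0"
  interpret W: sq_bounded N W v by fact
  have B: "0 \<le> B" using f(2)[of undefined] abs_ge_zero order_trans by blast
  have V: "0 \<le> (\<Sum>x. v x)" using W.v W.v_nonneg by (intro suminf_nonneg)
  define \<delta> where "\<delta> = e / (4 * (C + 1))"
  have \<delta>: "\<delta> > 0" "C * \<delta> \<le> e / 4" using e f(3) by (auto simp: \<delta>_def field_simps)
  obtain m where m: "(\<Sum>x. v (x + m)) < \<delta>\<^sup>2"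
    using suminf_exist_split[OF _ W.v, of "\<delta>\<^sup>2"] \<delta> by (auto simp: abs_less_iff)
  have m': "C * ((\<Sum>x. v (x + m)) / \<delta>) \<le> e / 4"
  proof -
    have "(\<Sum>x. v (x + m)) / \<delta> \<le> \<delta>" using m \<delta> by (simp add: field_simps power2_eq_square)
    then have "C * ((\<Sum>x. v (x + m)) / \<delta>) \<le> C * \<delta>" using f(3) by (rule mult_left_mono)
    then show ?thesis using \<delta>(2) by linarith
  qed
  define \<epsilon> where "\<epsilon> = e / 4"
  \<comment> \<open>Makes \<open>(2 * B + \<epsilon>) * ((\<Sum>x. v x) + 1) / R\<^sup>2\<close>
    equal to \<open>e / 4\<close>; the added one keeps \<open>R\<close> positive even if
    \<open>v\<close> vanishes.\<close>
  define R where "R = sqrt ((2 * B + \<epsilon>) * ((\<Sum>x. v x) + 1) / (e / 4))"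
  have \<epsilon>: "\<epsilon> > 0" using e by (simp add: \<epsilon>_def)
  have pos: "0 < (2 * B + \<epsilon>) * ((\<Sum>x. v x) + 1)" using B \<epsilon> V by (intro mult_pos_pos) auto
  have R: "R > 0" using pos e by (simp add: R_def)
  have R2: "(2 * B + \<epsilon>) * (\<Sum>x. v x) / R\<^sup>2 \<le> e / 4"
  proof -
    have "R\<^sup>2 = (2 * B + \<epsilon>) * ((\<Sum>x. v x) + 1) / (e / 4)" using pos e by (simp add: R_def)
    then have "(e / 4) * R\<^sup>2 = (2 * B + \<epsilon>) * ((\<Sum>x. v x) + 1)" using e by simp
    moreover have "(2 * B + \<epsilon>) * (\<Sum>x. v x) \<le> (2 * B + \<epsilon>) * ((\<Sum>x. v x) + 1)"
      using B \<epsilon> by (intro mult_left_mono) auto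
    ultimately show ?thesis using R by (simp add: pos_divide_le_eq)
  qed
  obtain q where q: "trig q" "\<And>z. \<bar>q z\<bar> \<le> B + \<epsilon>" "\<And>z. (\<forall>x. \<bar>z x\<bar> \<le> R) \<Longrightarrow> \<bar>q z - f (trunc m z)\<bar> < \<epsilon>"
    using trig_approx[OF l2_lipschitz_trunc_continuous[OF f(1), of m] f(2) \<epsilon>, of R] by blast
  have bound: "\<epsilon> + (2 * B + \<epsilon>) * (\<Sum>x. v x) / R\<^sup>2 + C * (\<delta> + (\<Sum>x. v (x + m)) / \<delta>) \<le> e"
    using R2 m' \<delta>(2) unfolding distrib_left \<epsilon>_def by linarith
  have conv: "(\<lambda>n. \<integral>\<omega>. g (Z n \<omega>) \<partial>M) \<longlonglongrightarrow> (\<integral>\<omega>. g (W \<omega>) \<partial>N)" if "trig g" for g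
    using that
  proof (induction rule: trig.induct)
    case (trig_cos c a m \<theta>)
    then show ?case using cos by (simp add: tendsto_mult_left)
  next
    case (trig_add f g)
    then show ?case
      using tendsto_add sq_bounded.trig_integrable[OF Z] W.trig_integrable by simp
  qed
  show "\<exists>b b'. b \<longlonglongrightarrow> b' \<and> (\<forall>\<^sub>F n in sequentially. \<bar>(\<integral>\<omega>. f (Z n \<omega>) \<partial>M) - b n\<bar> \<le> e) \<and>
      \<bar>(\<integral>\<omega>. f (W \<omega>) \<partial>N) - b'\<bar> \<le> e"
  proof (intro exI conjI always_eventually allI)
    show "(\<lambda>n. \<integral>\<omega>. q (trunc m (Z n \<omega>)) \<partial>M) \<longlonglongrightarrow> (\<integral>\<omega>. q (trunc m (W \<omega>)) \<partial>N)"
      using conv[OF trig_trunc[OF q(1), of m]] .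
    show "\<bar>(\<integral>\<omega>. f (Z n \<omega>) \<partial>M) - (\<integral>\<omega>. q (trunc m (Z n \<omega>)) \<partial>M)\<bar> \<le> e" for n
      using sq_bounded.expectation_trig_approx[OF Z f(1,2) q \<epsilon> R \<delta>(1) f(3)] bound by (rule order_trans)
    show "\<bar>(\<integral>\<omega>. f (W \<omega>) \<partial>N) - (\<integral>\<omega>. q (trunc m (W \<omega>)) \<partial>N)\<bar> \<le> e"
      using W.expectation_trig_approx[OF f(1,2) q \<epsilon> R \<delta>(1) f(3)] bound by (rule order_trans)
  qed
qed

section \<open>The empirical process\<close>

lemma measurable_map_list:
  fixes f :: "'i \<Rightarrow> 'a \<Rightarrow> 'c::countable"
  assumes "\<And>i. i \<in> set is \<Longrightarrow> f i \<in> measurable N (count_space UNIV)"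
  shows "(\<lambda>\<omega>. map (\<lambda>i. f i \<omega>) is) \<in> measurable N (count_space UNIV)"
  using assms
proof (induction "is")
  case (Cons i "is")
  have "(\<lambda>\<omega>. (f i \<omega>, map (\<lambda>i. f i \<omega>) is)) \<in> measurable N (count_space UNIV \<Otimes>\<^sub>M count_space UNIV)"
    using Cons by (intro measurable_Pair) auto
  then have "(\<lambda>\<omega>. (f i \<omega>, map (\<lambda>i. f i \<omega>) is)) \<in> measurable N (count_space UNIV)"
    by (simp add: pair_measure_countable)
  from measurable_compose[OF this, of "\<lambda>(a, b). a # b" "count_space UNIV"] show ?case by simp
qed simp

lemma integral_pmf_nat:
  fixes f :: "nat \<Rightarrow> real"
  assumes "\<And>x. \<bar>f x\<bar> \<le> B"
  shows "summable (\<lambda>x. pmf P x * f x)" "measure_pmf.expectation P f = (\<Sum>x. pmf P x * f x)"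
proof -
  have "integrable (measure_pmf P) f"
    by (rule measure_pmf.integrable_const_bound[of _ B]) (use assms in auto)
  then have i: "integrable (count_space UNIV) (\<lambda>x. pmf P x * f x)"
    unfolding measure_pmf_eq_density by (subst (asm) integrable_density) (auto simp: pmf_nonneg)
  have "measure_pmf.expectation P f = integral\<^sup>L (count_space UNIV) (\<lambda>x. pmf P x * f x)"
    unfolding measure_pmf_eq_density by (subst integral_density) (auto simp: pmf_nonneg)
  also have "\<dots> = (\<Sum>x. pmf P x * f x)" by (rule integral_count_space_nat[OF i])
  finally show "measure_pmf.expectation P f = (\<Sum>x. pmf P x * f x)" .
  show "summable (\<lambda>x. pmf P x * f x)"
    using i unfolding integrable_count_space_nat_iff by (rule summable_norm_cancel)
qed

lemma pmf_nat_sums: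
  fixes P :: "nat pmf"
  shows "summable (pmf P)" "(\<Sum>x. pmf P x) = 1"
  using integral_pmf_nat[of "\<lambda>_. 1" 1 P] by simp_all

text \<open>The real and imaginary parts of the characteristic function; the sine contributes
  nothing because that function is real.\<close>

lemma integral_cos_std_normal:
  "(\<integral>y. cos (s * y + \<theta>) \<partial>std_normal_distribution) = exp (- s\<^sup>2 / 2) * cos \<theta>"
proof -
  interpret real_distribution std_normal_distribution by (rule real_dist_normal_dist)
  have i: "integrable std_normal_distribution (\<lambda>y. iexp (s * y))"
    by (rule integrable_const_bound[of _ 1]) auto
  have c: "(\<integral>y. iexp (s * y) \<partial>std_normal_distribution) = complex_of_real (exp (- s\<^sup>2 / 2))"
    using fun_cong[OF char_std_normal_distribution, of s] by (simp add: char_def)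
  have "(\<integral>y. cos (s * y + \<theta>) \<partial>std_normal_distribution) =
      (\<integral>y. cos (s * y) * cos \<theta> - sin (s * y) * sin \<theta> \<partial>std_normal_distribution)"
    by (simp add: cos_add)
  also have "\<dots> = (\<integral>y. cos (s * y) \<partial>std_normal_distribution) * cos \<theta> - (\<integral>y. sin (s * y) \<partial>std_normal_distribution) * sin \<theta>"
    by (subst Bochner_Integration.integral_diff) (auto intro!: integrable_const_bound[of _ 1] integrable_mult_left)
  also have "(\<integral>y. cos (s * y) \<partial>std_normal_distribution) = exp (- s\<^sup>2 / 2)"
    using integral_Re[OF i] unfolding c by (simp add: Re_exp)
  also have "(\<integral>y. sin (s * y) \<partial>std_normal_distribution) = 0"
    using integral_Im[OF i] unfolding c by (simp add: Im_exp)
  finally show ?thesis by simp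
qed


text \<open>\<open>A\<close> will be a squared norm and \<open>D\<close> its increment. As
  \<open>D\<close> is of the order of the square root of \<open>1 + A\<close>, the second-order term
  is absorbed by \<open>(1 + A) ^ q\<close>. The induction multiplies by \<open>A + D\<close>; 32 is
  the constant of \<open>sq_incr_bound\<close>, and 34 bounds \<open>A + D\<close> by way of
  \<open>D \<le> D\<^sup>2 + 1\<close>.\<close>

lemma power_increment_bound:
  "\<exists>K\<ge>0. \<forall>(A::real) D::real. 0 \<le> A \<longrightarrow> 0 \<le> A + D \<longrightarrow> D\<^sup>2 \<le> 32 * (1 + A) \<longrightarrow>
    (A + D) ^ Suc q \<le> A ^ Suc q + Suc q * A ^ q * D + K * (1 + A) ^ q"
proof (induction q)
  case 0
  show ?case by (intro exI[of _ 0]) simp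
next
  case (Suc q)
  then obtain K where K: "K \<ge> 0" and IH: "\<And>(A::real) D::real. \<lbrakk>0 \<le> A; 0 \<le> A + D; D\<^sup>2 \<le> 32 * (1 + A)\<rbrakk> \<Longrightarrow>
    (A + D) ^ Suc q \<le> A ^ Suc q + Suc q * A ^ q * D + K * (1 + A) ^ q" by blast
  have "(A + D) ^ Suc (Suc q) \<le> A ^ Suc (Suc q) + Suc (Suc q) * A ^ Suc q * D + (32 * Suc q + 34 * K) * (1 + A) ^ Suc q"
    if A: "0 \<le> A" "0 \<le> A + D" "D\<^sup>2 \<le> 32 * (1 + A)" for A D :: real
  proof -
    have "(A + D) ^ Suc (Suc q) = (A + D) * (A + D) ^ Suc q" by simp
    also have "\<dots> \<le> (A + D) * (A ^ Suc q + Suc q * A ^ q * D + K * (1 + A) ^ q)"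
      by (rule mult_left_mono[OF IH[OF A] A(2)])
    also have "\<dots> = A ^ Suc (Suc q) + Suc (Suc q) * A ^ Suc q * D + Suc q * (A ^ q * D\<^sup>2) + K * ((A + D) * (1 + A) ^ q)"
      by (simp add: power2_eq_square algebra_simps)
    also have "\<dots> \<le> A ^ Suc (Suc q) + Suc (Suc q) * A ^ Suc q * D
      + Suc q * ((1 + A) ^ q * (32 * (1 + A))) + K * ((34 * (1 + A)) * (1 + A) ^ q)"
    proof (rule add_mono[OF add_mono[OF order_refl mult_left_mono] mult_left_mono])
      show "A ^ q * D\<^sup>2 \<le> (1 + A) ^ q * (32 * (1 + A))"
        using A by (intro mult_mono power_mono) auto
      show "(A + D) * (1 + A) ^ q \<le> (34 * (1 + A)) * (1 + A) ^ q"
      proof (rule mult_right_mono)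
      have "0 \<le> (D - 1 / 2)\<^sup>2" by simp
      then have "D \<le> D\<^sup>2 + 1" by (simp add: power2_eq_square algebra_simps)
      then show "A + D \<le> 34 * (1 + A)" using A by simp
      qed (use A in simp)
    qed (use K in auto)
    finally show ?thesis by (simp add: algebra_simps)
  qed
  then show ?case using K by (intro exI[of _ "32 * Suc q + 34 * K"]) auto
qed

lemma one_plus_power_le:
  fixes A :: real
  assumes "0 \<le> A" shows "(1 + A) ^ q \<le> 2 ^ q * (1 + A ^ q)"
proof -
  have "(1 + A) ^ q \<le> (2 * max 1 A) ^ q" using assms by (intro power_mono) auto
  also have "\<dots> = 2 ^ q * max 1 A ^ q" by (rule power_mult_distrib)
  also have "max 1 A ^ q \<le> 1 + A ^ q" using assms by (auto simp: max_def)
  finally show ?thesis by simp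
qed

text \<open>Observations are numbered from one, while the central limit theorem is applied to a
  sequence that starts at zero.\<close>

lemma (in prob_space) indep_vars_Suc:
  assumes "indep_vars (\<lambda>_. S) X {1..}"
  shows "indep_vars (\<lambda>_. S) (\<lambda>i. X (Suc i)) UNIV"
  unfolding indep_vars_def2
proof (intro conjI ballI indep_setsI)
  let ?F = "\<lambda>i. {X i -` A \<inter> space M |A. A \<in> sets S}"
  have rv: "random_variable S (X (Suc i))" for i
    using assms unfolding indep_vars_def2 by simp
  then show "random_variable S (X (Suc i))" for i .
  show "?F (Suc i) \<subseteq> events" for i using measurable_sets[OF rv] by auto
  fix A J assume J: "J \<noteq> {}" "finite (J :: nat set)" and A: "\<forall>j\<in>J. A j \<in> ?F (Suc j)"
  have ind: "indep_sets ?F {1..}" using assms unfolding indep_vars_def2 by simp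
  have "prob (\<Inter>j\<in>Suc ` J. A (j - 1)) = (\<Prod>j\<in>Suc ` J. prob (A (j - 1)))"
    by (rule indep_setsD[OF ind]) (use J A in auto)
  then show "prob (\<Inter>j\<in>J. A j) = (\<Prod>j\<in>J. prob (A j))"
    by (simp add: prod.reindex)
qed

locale iid_sample = prob_space M for M :: "'a measure" +
  fixes X :: "nat \<Rightarrow> 'a \<Rightarrow> nat" and P :: "nat pmf"
  assumes indep: "indep_vars (\<lambda>_. count_space UNIV) X {1..}"
    and distr: "\<And>i. i \<ge> 1 \<Longrightarrow> distr M (count_space UNIV) (X i) = measure_pmf P"
begin

lemma X_meas: "i \<ge> 1 \<Longrightarrow> X i \<in> measurable M (count_space UNIV)"
  using indep unfolding indep_vars_def by auto

lemma expectation_X: "i \<ge> 1 \<Longrightarrow> expectation (\<lambda>\<omega>. g (X i \<omega>)) = measure_pmf.expectation P g" for g :: "nat \<Rightarrow> real"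
  unfolding distr[symmetric] by (subst integral_distr[OF X_meas]) auto

text \<open>Lists over a countable type form a countable discrete space, so every function of the
  first \<open>n\<close> observations is measurable once written as a function of
  \<open>L n\<close>.\<close>

definition L :: "nat \<Rightarrow> 'a \<Rightarrow> nat list" where "L n \<omega> = map (\<lambda>i. X i \<omega>) [1..<Suc n]"

lemma L_meas: "L n \<in> measurable M (count_space UNIV)"
  unfolding L_def[abs_def] by (rule measurable_map_list) (auto intro: X_meas)

lemma sample_fun:
  assumes "\<And>xs ys. (\<And>i. i \<in> {1..n} \<Longrightarrow> xs i = ys i) \<Longrightarrow> F xs = F ys"
  shows "F (\<lambda>i. X i \<omega>) = F (\<lambda>i. L n \<omega> ! (i - 1))"
  by (rule assms) (auto simp: L_def simp del: upt_Suc)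

lemma sample_measurable:
  assumes "\<And>xs ys. (\<And>i. i \<in> {1..n} \<Longrightarrow> xs i = ys i) \<Longrightarrow> F xs = F ys"
  shows "(\<lambda>\<omega>. F (\<lambda>i. X i \<omega>) :: real) \<in> borel_measurable M"
proof -
  have "(\<lambda>\<omega>. F (\<lambda>i. L n \<omega> ! (i - 1))) \<in> borel_measurable M"
    by (rule measurable_compose[OF L_meas]) simp
  moreover have "F (\<lambda>i. X i \<omega>) = F (\<lambda>i. L n \<omega> ! (i - 1))" for \<omega>
    by (rule sample_fun) (rule assms)
  ultimately show ?thesis by simp
qed

text \<open>Conditioning on the first \<open>n\<close> observations: their list and the next
  observation are independent, and Fubini on the product of the two laws integrates the latter
  out.\<close>

lemma expectation_step:
  assumes F: "\<And>xs ys y. (\<And>i. i \<in> {1..n} \<Longrightarrow> xs i = ys i) \<Longrightarrow> F xs y = F ys y"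
    and B: "\<And>xs y. \<bar>F xs y :: real\<bar> \<le> B"
  shows "expectation (\<lambda>\<omega>. F (\<lambda>i. X i \<omega>) (X (Suc n) \<omega>)) =
    expectation (\<lambda>\<omega>. measure_pmf.expectation P (F (\<lambda>i. X i \<omega>)))"
proof -
  define \<Phi> where "\<Phi> = (\<lambda>(l :: nat list, l' :: nat list). F (\<lambda>i. l ! (i - 1)) (hd l'))"
  define L' where "L' = (\<lambda>\<omega>. [X (Suc n) \<omega>])"
  have FL: "F (\<lambda>i. X i \<omega>) y = \<Phi> (L n \<omega>, [y])" for \<omega> y
    using sample_fun[of n "\<lambda>xs. F xs y" \<omega>, OF F] by (simp add: \<Phi>_def)
  have "indep_var (PiM {1..n} (\<lambda>_. count_space UNIV)) (\<lambda>\<omega>. restrict (\<lambda>i. X i \<omega>) {1..n})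
      (PiM {Suc n} (\<lambda>_. count_space UNIV)) (\<lambda>\<omega>. restrict (\<lambda>i. X i \<omega>) {Suc n})"
    by (rule indep_var_restrict[OF indep]) auto
  then have "indep_var (count_space UNIV) ((\<lambda>f. map (\<lambda>i. f i) [1..<Suc n]) \<circ> (\<lambda>\<omega>. restrict (\<lambda>i. X i \<omega>) {1..n}))
      (count_space UNIV) ((\<lambda>f. map (\<lambda>i. f i) [Suc n]) \<circ> (\<lambda>\<omega>. restrict (\<lambda>i. X i \<omega>) {Suc n}))"
    by (rule indep_var_compose; intro measurable_map_list measurable_component_singleton)
       (auto simp del: upt_Suc)
  also have "(\<lambda>f. map (\<lambda>i. f i) [1..<Suc n]) \<circ> (\<lambda>\<omega>. restrict (\<lambda>i. X i \<omega>) {1..n}) = L n"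
    by (auto simp: L_def fun_eq_iff simp del: upt_Suc)
  also have "(\<lambda>f. map (\<lambda>i. f i) [Suc n]) \<circ> (\<lambda>\<omega>. restrict (\<lambda>i. X i \<omega>) {Suc n}) = L'"
    by (auto simp: L'_def)
  finally have iv: "distr M (count_space UNIV) (L n) \<Otimes>\<^sub>M distr M (count_space UNIV) L' =
      distr M (count_space UNIV \<Otimes>\<^sub>M count_space UNIV) (\<lambda>\<omega>. (L n \<omega>, L' \<omega>))" 
    and L'm: "L' \<in> measurable M (count_space UNIV)"
    unfolding indep_var_distribution_eq by simp_all
  let ?mL = "distr M (count_space UNIV) (L n)" and ?mR = "distr M (count_space UNIV) L'"
  interpret mL: prob_space ?mL by (rule prob_space_distr[OF L_meas])
  interpret mR: prob_space ?mR by (rule prob_space_distr[OF L'm])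
  interpret pair_prob_space ?mL ?mR ..
  have sets: "sets (?mL \<Otimes>\<^sub>M ?mR) = UNIV"
  proof -
    have "sets (?mL \<Otimes>\<^sub>M ?mR) = sets (count_space (UNIV :: nat list set) \<Otimes>\<^sub>M count_space (UNIV :: nat list set))"
      by (rule sets_pair_measure_cong) auto
    then show ?thesis by (subst (asm) pair_measure_countable) auto
  qed
  have \<Phi>m: "\<Phi> \<in> borel_measurable (count_space UNIV \<Otimes>\<^sub>M count_space UNIV)"
    by (simp add: pair_measure_countable)
  have \<Phi>i: "integrable (?mL \<Otimes>\<^sub>M ?mR) \<Phi>"
  proof (rule P.integrable_const_bound[of _ B])
    show "\<Phi> \<in> borel_measurable (?mL \<Otimes>\<^sub>M ?mR)"
      using sets by (intro measurableI) auto
  qed (use B in \<open>auto simp: \<Phi>_def\<close>)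
  have pm: "(\<lambda>\<omega>. (L n \<omega>, L' \<omega>)) \<in> measurable M (count_space UNIV \<Otimes>\<^sub>M count_space UNIV)"
    by (intro measurable_Pair L_meas L'm)
  have inner: "(\<integral>l'. \<Phi> (l, l') \<partial>?mR) = measure_pmf.expectation P (\<lambda>y. \<Phi> (l, [y]))" for l
  proof -
    have "(\<integral>l'. \<Phi> (l, l') \<partial>?mR) = (\<integral>\<omega>. \<Phi> (l, L' \<omega>) \<partial>M)"
      by (rule integral_distr[OF L'm]) simp
    also have "\<dots> = measure_pmf.expectation P (\<lambda>y. \<Phi> (l, [y]))"
      unfolding L'_def by (rule expectation_X) simp
    finally show ?thesis .
  qed
  have "(\<integral>\<omega>. F (\<lambda>i. X i \<omega>) (X (Suc n) \<omega>) \<partial>M) = (\<integral>\<omega>. \<Phi> (L n \<omega>, L' \<omega>) \<partial>M)"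
    by (simp add: FL L'_def)
  also have "\<dots> = integral\<^sup>L (distr M (count_space UNIV \<Otimes>\<^sub>M count_space UNIV) (\<lambda>\<omega>. (L n \<omega>, L' \<omega>))) \<Phi>"
    by (rule integral_distr[OF pm \<Phi>m, symmetric])
  also have "\<dots> = integral\<^sup>L (?mL \<Otimes>\<^sub>M ?mR) \<Phi>"
    using iv by simp
  also have "\<dots> = (\<integral>l. (\<integral>l'. \<Phi> (l, l') \<partial>?mR) \<partial>?mL)"
    by (rule integral_fst'[OF \<Phi>i, symmetric])
  also have "\<dots> = (\<integral>\<omega>. measure_pmf.expectation P (\<lambda>y. \<Phi> (L n \<omega>, [y])) \<partial>M)"
    unfolding inner by (rule integral_distr[OF L_meas]) simp
  finally show ?thesis by (simp add: FL[symmetric])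
qed

text \<open>The central limit theorem tested against a cosine, with the standard deviation
  \<open>s\<close> moved into its argument. Variance zero is treated apart because the sum cannot be
  standardised; all summands then vanish almost surely.\<close>

lemma clt_cos:
  fixes g :: "nat \<Rightarrow> real"
  assumes B: "\<And>y. \<bar>g y\<bar> \<le> B" and g0: "measure_pmf.expectation P g = 0"
  shows "(\<lambda>n. expectation (\<lambda>\<omega>. cos ((\<Sum>i\<in>{1..n}. g (X i \<omega>)) / sqrt n + \<theta>)))
    \<longlonglongrightarrow> exp (- measure_pmf.expectation P (\<lambda>y. (g y)\<^sup>2) / 2) * cos \<theta>"
proof -
  define V where "V = measure_pmf.expectation P (\<lambda>y. (g y)\<^sup>2)"
  have B2: "(g y)\<^sup>2 \<le> B\<^sup>2" for y using B[of y] by (simp add: abs_le_square_iff[symmetric])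
  have V0: "0 \<le> V" by (simp add: V_def)
  have gm: "(\<lambda>\<omega>. g (X i \<omega>)) \<in> borel_measurable M" if "i \<ge> 1" for i
    by (rule measurable_compose[OF X_meas[OF that]]) simp
  have int2: "integrable M (\<lambda>\<omega>. (g (X i \<omega>))\<^sup>2)" if "i \<ge> 1" for i
    by (rule integrable_const_bound[of _ "B\<^sup>2"]) (use B2 gm[OF that] in auto)
  have E2: "expectation (\<lambda>\<omega>. (g (X i \<omega>))\<^sup>2) = V" if "i \<ge> 1" for i
    using expectation_X[OF that, of "\<lambda>y. (g y)\<^sup>2"] by (simp add: V_def)
  show ?thesis
  proof (cases "V = 0")
    case True
    have "AE \<omega> in M. g (X i \<omega>) = 0" if "i \<ge> 1" for i
      using integral_nonneg_eq_0_iff_AE[OF int2[OF that]] E2[OF that] True by simp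
    then have ae: "AE \<omega> in M. \<forall>i\<in>{1..n}. g (X i \<omega>) = 0" for n
      by (intro AE_finite_allI) auto
    have "expectation (\<lambda>\<omega>. cos ((\<Sum>i\<in>{1..n}. g (X i \<omega>)) / sqrt n + \<theta>)) = expectation (\<lambda>\<omega>. cos \<theta>)" for n
    proof (rule integral_cong_AE)
      show "AE \<omega> in M. cos ((\<Sum>i\<in>{1..n}. g (X i \<omega>)) / sqrt n + \<theta>) = cos \<theta>"
        using ae[of n] by eventually_elim simp
      show "(\<lambda>\<omega>. cos ((\<Sum>i\<in>{1..n}. g (X i \<omega>)) / sqrt n + \<theta>)) \<in> borel_measurable M"
        by (rule sample_measurable[where n = n and F = "\<lambda>xs. cos ((\<Sum>i\<in>{1..n}. g (xs i)) / sqrt n + \<theta>)"])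
           (metis (no_types, lifting) sum.cong)
    qed simp
    then show ?thesis using True by (simp add: V_def prob_space)
  next
    case False
    define s where "s = sqrt V"
    have s: "s > 0" "s\<^sup>2 = V" using False V0 by (auto simp: s_def)
    define Z where "Z i \<omega> = g (X (Suc i) \<omega>)" for i \<omega>
    have iZ: "indep_vars (\<lambda>_. borel) Z UNIV"
    proof -
      from indep_vars_compose2[OF indep_vars_Suc[OF indep], of "\<lambda>_. g" "\<lambda>_. borel"] show ?thesis by (simp add: Z_def[abs_def])
    qed
    have EZ: "expectation (Z i) = 0" for i
      using expectation_X[of "Suc i" g] g0 by (simp add: Z_def[abs_def])
    have dZ: "distr M borel (Z i) = distr (measure_pmf P) borel g" for i
      unfolding distr[of "Suc i", simplified, symmetric] Z_def[abs_def]
      by (subst distr_distr) (auto simp: comp_def X_meas)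
    have cl: "weak_conv_m (\<lambda>n. distr M borel (\<lambda>\<omega>. (\<Sum>i<n. Z i \<omega> - 0) / sqrt (n * s\<^sup>2))) std_normal_distribution"
      by (rule central_limit_theorem[OF iZ EZ s(1) _ _ dZ])
         (use int2 E2 s EZ in \<open>auto simp: Z_def[abs_def] prob_space\<close>)
    let ?S = "\<lambda>n \<omega>. (\<Sum>i<n. Z i \<omega> - 0) / sqrt (n * s\<^sup>2)"
    have Sm: "?S n \<in> borel_measurable M" for n
      unfolding Z_def using gm by (intro borel_measurable_divide borel_measurable_sum borel_measurable_diff) auto
    have rd: "real_distribution (distr M borel (?S n))" for n
      by (rule real_distribution_distr[OF Sm])
    have "(\<lambda>n. integral\<^sup>L (distr M borel (?S n)) (\<lambda>y. cos (s * y + \<theta>))) \<longlonglongrightarrow>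
        integral\<^sup>L std_normal_distribution (\<lambda>y. cos (s * y + \<theta>))"
      by (rule weak_conv_imp_integral_bdd_continuous_conv[OF rd real_dist_normal_dist cl, where B = 1])
         (auto intro!: continuous_intros)
    moreover have "integral\<^sup>L (distr M borel (?S n)) (\<lambda>y. cos (s * y + \<theta>)) =
        expectation (\<lambda>\<omega>. cos ((\<Sum>i\<in>{1..n}. g (X i \<omega>)) / sqrt n + \<theta>))" for n
    proof -
      have "(\<Sum>i<n. Z i \<omega> - 0) = (\<Sum>i\<in>{1..n}. g (X i \<omega>))" for \<omega>
        by (simp add: Z_def sum.atLeast1_atMost_eq)
      then have "s * ?S n \<omega> = (\<Sum>i\<in>{1..n}. g (X i \<omega>)) / sqrt n" for \<omega>
        using s(1) by (simp add: real_sqrt_mult)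
      then show ?thesis by (subst integral_distr[OF Sm]) auto
    qed
    ultimately show ?thesis unfolding integral_cos_std_normal s(2) V_def[symmetric] by simp
  qed
qed

end

section \<open>Moments of the empirical process by recursion over the sample size\<close>

text \<open>\<open>n\<close> times the estimation error, or \<open>sqrt n\<close> times
  \<open>Y\<^sub>n\<close>. Left unnormalised, it satisfies a recursion in \<open>n\<close>.\<close>

definition dev :: "(nat \<Rightarrow> real) \<Rightarrow> (nat \<Rightarrow> nat) \<Rightarrow> nat \<Rightarrow> nat \<Rightarrow> real" where
  "dev p xs n x = (\<Sum>i\<in>{1..n}. of_bool (xs i = x) - p x)"

lemma scaled_err_emp_eq: "scaled_err p emp_est xs n x = dev p xs n x / sqrt n"
proof (cases "n = 0")
  case False
  have "real (card {i \<in> {1..n}. xs i = x}) = (\<Sum>i\<in>{1..n}. of_bool (xs i = x))"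
    by (simp add: of_bool_def sum.If_cases Int_def)
  then have "dev p xs n x = real (card {i \<in> {1..n}. xs i = x}) - n * p x"
    by (simp add: dev_def sum_subtractf)
  then have "dev p xs n x = n * (emp_est xs n x - p x)"
    using False by (simp add: emp_est_def right_diff_distrib)
  then show ?thesis using False by (simp add: scaled_err_def real_div_sqrt flip: times_divide_eq_left)
qed (simp add: scaled_err_def dev_def)

lemma dev_Suc: "dev p xs (Suc n) x = dev p xs n x + (of_bool (xs (Suc n) = x) - p x)"
  by (simp add: dev_def)

lemma dev_cong: "(\<And>i. i \<in> {1..n} \<Longrightarrow> xs i = ys i) \<Longrightarrow> dev p xs n = dev p ys n"
  by (auto simp: dev_def fun_eq_iff intro!: sum.cong)

context
  fixes P :: "nat pmf"
begin

lemma pmf_sq_summable: "sq_summable (pmf P)" "(\<Sum>x. (pmf P x)\<^sup>2) \<le> 1" "0 \<le> (\<Sum>x. (pmf P x)\<^sup>2)"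
proof -
  have le: "(pmf P x)\<^sup>2 \<le> pmf P x" for x
    using pmf_le_1[of P x] by (simp add: power2_eq_square mult_left_le)
  show s: "sq_summable (pmf P)"
    by (rule summable_comparison_test'[OF pmf_nat_sums(1)]) (use le in simp)
  show "(\<Sum>x. (pmf P x)\<^sup>2) \<le> 1"
    using suminf_le[OF le s pmf_nat_sums(1)] pmf_nat_sums(2) by simp
  show "0 \<le> (\<Sum>x. (pmf P x)\<^sup>2)" using s by (intro suminf_nonneg) auto
qed

text \<open>The change of the squared norm of a deviation \<open>b\<close> when \<open>y\<close> is
  observed, that is, when the unit vector at \<open>y\<close> minus \<open>pmf P\<close> is added.
  The first summand has mean zero under \<open>P\<close>.\<close>

definition sq_incr :: "(nat \<Rightarrow> real) \<Rightarrow> nat \<Rightarrow> real" where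
  "sq_incr b y = 2 * (b y - measure_pmf.expectation P b) + (1 - 2 * pmf P y + (\<Sum>x. (pmf P x)\<^sup>2))"

lemma sq_incr_sums:
  assumes b: "sq_summable b"
  shows "(\<lambda>x. (b x + (of_bool (y = x) - pmf P x))\<^sup>2) sums ((\<Sum>x. (b x)\<^sup>2) + sq_incr b y)"
proof -
  have "(\<lambda>x. (b x)\<^sup>2 + (2 * (if x = y then b x else 0) - 2 * (pmf P x * b x)) +
      ((if x = y then 1 - 2 * pmf P x else 0) + (pmf P x)\<^sup>2)) sums
      ((\<Sum>x. (b x)\<^sup>2) + (2 * b y - 2 * measure_pmf.expectation P b) + ((1 - 2 * pmf P y) + (\<Sum>x. (pmf P x)\<^sup>2)))"
    unfolding integral_pmf_nat(2)[OF abs_le_l2[OF b]]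
    by (intro sums_add sums_diff sums_mult sums_single summable_sums b pmf_sq_summable
        integral_pmf_nat(1)[OF abs_le_l2[OF b]])
  moreover have "(b x)\<^sup>2 + (2 * (if x = y then b x else 0) - 2 * (pmf P x * b x)) +
      ((if x = y then 1 - 2 * pmf P x else 0) + (pmf P x)\<^sup>2) = (b x + (of_bool (y = x) - pmf P x))\<^sup>2" for x
    by (auto simp: power2_eq_square algebra_simps)
  ultimately show ?thesis by (simp add: sq_incr_def algebra_simps)
qed

text \<open>The increment is at most \<open>4 * l2 b + 2\<close> in absolute value: it is linear in
  the norm of \<open>b\<close>, not quadratic. Squaring gives the constant 32.\<close>

lemma sq_incr_bound:
  assumes b: "sq_summable b"
  shows "(sq_incr b y)\<^sup>2 \<le> 32 * (1 + (\<Sum>x. (b x)\<^sup>2))"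
proof -
  note le = abs_le_l2[OF b]
  have "\<bar>measure_pmf.expectation P b\<bar> \<le> measure_pmf.expectation P (\<lambda>x. \<bar>b x\<bar>)"
    by (rule integral_abs_bound)
  also have "\<dots> \<le> measure_pmf.expectation P (\<lambda>x. l2 b)"
    by (rule integral_mono) (use le in \<open>auto intro: measure_pmf.integrable_const_bound[of _ "l2 b"]\<close>)
  finally have E: "\<bar>measure_pmf.expectation P b\<bar> \<le> l2 b" by simp
  have c: "\<bar>1 - 2 * pmf P y + (\<Sum>x. (pmf P x)\<^sup>2)\<bar> \<le> 2"
    unfolding abs_le_iff using pmf_sq_summable(2,3) pmf_le_1[of P y] pmf_nonneg[of P y]
    by (intro conjI) linarith+
  have "\<bar>sq_incr b y\<bar> \<le> 4 * l2 b + 2"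
  proof -
    have "\<bar>2 * (u - e) + d\<bar> \<le> 4 * l + 2" if "\<bar>u\<bar> \<le> l" "\<bar>e\<bar> \<le> l" "\<bar>d\<bar> \<le> 2" for u e d l :: real
      using that by (auto simp: abs_le_iff)
    from this[OF le[of y] E c] show ?thesis unfolding sq_incr_def .
  qed
  then have "(sq_incr b y)\<^sup>2 \<le> (4 * l2 b + 2)\<^sup>2" by (metis abs_ge_zero power2_abs power_mono)
  also have "\<dots> \<le> 32 * (1 + (l2 b)\<^sup>2)"
  proof -
    have "0 \<le> (4 * l2 b - 2)\<^sup>2" by simp
    then show ?thesis by (simp add: power2_eq_square algebra_simps)
  qed
  finally show ?thesis by (simp add: l2_sq[OF b])
qed

text \<open>The term linear in \<open>b\<close> is centred; one minus the sum of the squared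
  probabilities remains.\<close>

lemma expectation_sq_incr:
  assumes b: "sq_summable b"
  shows "measure_pmf.expectation P (sq_incr b) \<le> 1"
proof -
  have ib: "integrable (measure_pmf P) b" "integrable (measure_pmf P) (pmf P)"
    subgoal by (rule measure_pmf.integrable_const_bound[of _ "l2 b"]) (use abs_le_l2[OF b] in auto)
    subgoal by (rule measure_pmf.integrable_const_bound[of _ 1]) (auto simp: pmf_le_1)
    done
  have Ep: "measure_pmf.expectation P (pmf P) = (\<Sum>x. (pmf P x)\<^sup>2)"
    unfolding power2_eq_square by (rule integral_pmf_nat(2)[of _ 1]) (simp add: pmf_le_1)
  have "measure_pmf.expectation P (sq_incr b) = 1 - (\<Sum>x. (pmf P x)\<^sup>2)"
    unfolding sq_incr_def using ib by (simp add: Ep)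
  then show ?thesis using pmf_sq_summable(3) by simp
qed

lemma sq_summable_dev: "sq_summable (dev (pmf P) xs n)"
proof (induction n)
  case 0
  then show ?case by (simp add: dev_def)
next
  case (Suc n)
  then show ?case using sq_incr_sums[OF Suc, of "xs (Suc n)"] unfolding dev_Suc by (auto simp: sums_iff)
qed

definition sq_dev :: "(nat \<Rightarrow> nat) \<Rightarrow> nat \<Rightarrow> real" where
  "sq_dev xs n = (\<Sum>x. (dev (pmf P) xs n x)\<^sup>2)"

lemma sq_dev_nonneg: "0 \<le> sq_dev xs n"
  unfolding sq_dev_def by (intro suminf_nonneg sq_summable_dev) simp

lemma sq_dev_0: "sq_dev xs 0 = 0"
  by (simp add: sq_dev_def dev_def)

lemma sq_dev_Suc: "sq_dev xs (Suc n) = sq_dev xs n + sq_incr (dev (pmf P) xs n) (xs (Suc n))"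
  using sq_incr_sums[OF sq_summable_dev, of xs n "xs (Suc n)"] unfolding sq_dev_def dev_Suc by (simp add: sums_iff)

lemma sq_dev_cong: "(\<And>i. i \<in> {1..n} \<Longrightarrow> xs i = ys i) \<Longrightarrow> sq_dev xs n = sq_dev ys n"
  using dev_cong[of n xs ys "pmf P"] by (simp add: sq_dev_def)

lemma abs_sq_incr_le: "\<bar>sq_incr (dev (pmf P) xs n) y\<bar> \<le> 33 * (1 + sq_dev xs n)"
proof -
  let ?D = "sq_incr (dev (pmf P) xs n) y"
  have "0 \<le> (\<bar>?D\<bar> - 1 / 2)\<^sup>2" by simp
  then have "\<bar>?D\<bar> \<le> ?D\<^sup>2 + 1" by (simp add: power2_eq_square algebra_simps)
  then show ?thesis using sq_incr_bound[OF sq_summable_dev, of xs n y] sq_dev_nonneg[of xs n]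
    unfolding sq_dev_def[symmetric] by (auto simp: algebra_simps)
qed

text \<open>A crude bound for each fixed \<open>n\<close>; it serves integrability and the
  boundedness asked for by \<open>expectation_step\<close>.\<close>

lemma sq_dev_bounded: "\<exists>B. \<forall>xs. sq_dev xs n \<le> B"
proof (induction n)
  case 0
  then show ?case by (auto simp: sq_dev_0)
next
  case (Suc n)
  then obtain B where B: "\<And>xs. sq_dev xs n \<le> B" by blast
  have "sq_dev xs (Suc n) \<le> 34 * (1 + B)" for xs
    using abs_sq_incr_le[of xs n "xs (Suc n)"] B[of xs] sq_dev_nonneg[of xs n]
    unfolding sq_dev_Suc abs_le_iff by (auto simp: algebra_simps)
  then show ?case by blast
qed

end

context iid_sample
begin

lemma sq_dev_measurable: "(\<lambda>\<omega>. sq_dev P (\<lambda>i. X i \<omega>) n) \<in> borel_measurable M"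
  by (rule sample_measurable[of n "\<lambda>xs. sq_dev P xs n"]) (rule sq_dev_cong)

lemma sq_dev_integrable: "integrable M (\<lambda>\<omega>. sq_dev P (\<lambda>i. X i \<omega>) n ^ q)"
proof -
  obtain B where B: "\<And>xs. sq_dev P xs n \<le> B" using sq_dev_bounded by blast
  show ?thesis
    by (rule integrable_const_bound[of _ "B ^ q"])
       (use B sq_dev_nonneg sq_dev_measurable in \<open>auto intro!: AE_I2 power_mono\<close>)
qed

text \<open>In the expansion of the next power the linear term has mean at most that of the
  \<open>q\<close>-th power, by conditioning, and the remainder is of the same order; so one more
  observation adds at most \<open>H * (n + 1) ^ q\<close>, and summation over \<open>n\<close> gives
  order \<open>n ^ (q + 1)\<close>.\<close>

lemma sq_dev_moments:
  "\<exists>C. 0 \<le> C \<and> (\<forall>n. expectation (\<lambda>\<omega>. sq_dev P (\<lambda>i. X i \<omega>) n ^ q) \<le> C * real n ^ q)"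
proof (induction q)
  case 0
  show ?case by (intro exI[of _ 1]) (simp add: prob_space)
next
  case (Suc q)
  then obtain C where C: "0 \<le> C" "\<And>n. expectation (\<lambda>\<omega>. sq_dev P (\<lambda>i. X i \<omega>) n ^ q) \<le> C * real n ^ q" by blast
  obtain K where K: "K \<ge> 0" and Kb: "\<And>(A::real) D::real. \<lbrakk>0 \<le> A; 0 \<le> A + D; D\<^sup>2 \<le> 32 * (1 + A)\<rbrakk> \<Longrightarrow>
    (A + D) ^ Suc q \<le> A ^ Suc q + Suc q * A ^ q * D + K * (1 + A) ^ q"
    using power_increment_bound[of q] by blast
  define H where "H = (real (Suc q) + K * 2 ^ q) * (1 + C)"
  have H: "H \<ge> 0" using K C by (simp add: H_def)
  let ?A = "\<lambda>n \<omega>. sq_dev P (\<lambda>i. X i \<omega>) n" and ?D = "\<lambda>n \<omega>. sq_incr P (dev (pmf P) (\<lambda>i. X i \<omega>) n) (X (Suc n) \<omega>)"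
  have step: "expectation (\<lambda>\<omega>. ?A (Suc n) \<omega> ^ Suc q) \<le> expectation (\<lambda>\<omega>. ?A n \<omega> ^ Suc q) + H * real (Suc n) ^ q" for n
  proof -
    obtain B where B: "\<And>xs. sq_dev P xs n \<le> B" using sq_dev_bounded by blast
    have B0: "0 \<le> B" using order_trans[OF sq_dev_nonneg B] .
    let ?F = "\<lambda>xs y. sq_dev P xs n ^ q * sq_incr P (dev (pmf P) xs n) y"
    have Fb: "\<bar>?F xs y\<bar> \<le> B ^ q * (33 * (1 + B))" for xs y
      unfolding abs_mult using abs_sq_incr_le[of P xs n y] B[of xs] B0 sq_dev_nonneg[of P xs n]
      by (intro mult_mono) (auto intro!: power_mono simp: power_abs[symmetric])
    have FE: "expectation (\<lambda>\<omega>. ?A n \<omega> ^ q * ?D n \<omega>) \<le> expectation (\<lambda>\<omega>. ?A n \<omega> ^ q)"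
    proof -
      have "expectation (\<lambda>\<omega>. ?A n \<omega> ^ q * ?D n \<omega>) =
          expectation (\<lambda>\<omega>. measure_pmf.expectation P (?F (\<lambda>i. X i \<omega>)))"
        by (rule expectation_step[of n ?F, OF _ Fb]) (metis dev_cong sq_dev_cong)
      also have "\<dots> \<le> expectation (\<lambda>\<omega>. ?A n \<omega> ^ q)"
      proof (rule integral_mono[OF _ sq_dev_integrable])
        show "integrable M (\<lambda>\<omega>. measure_pmf.expectation P (?F (\<lambda>i. X i \<omega>)))"
        proof (rule integrable_const_bound[of _ "B ^ q * (33 * (1 + B))"])
          show "(\<lambda>\<omega>. measure_pmf.expectation P (?F (\<lambda>i. X i \<omega>))) \<in> borel_measurable M"
            by (rule sample_measurable[of n "\<lambda>xs. measure_pmf.expectation P (?F xs)"]) (metis dev_cong sq_dev_cong)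
          have "\<bar>measure_pmf.expectation P (?F xs)\<bar> \<le> B ^ q * (33 * (1 + B))" for xs
          proof -
            have "\<bar>measure_pmf.expectation P (?F xs)\<bar> \<le> measure_pmf.expectation P (\<lambda>y. \<bar>?F xs y\<bar>)"
              by (rule integral_abs_bound)
            also have "\<dots> \<le> measure_pmf.expectation P (\<lambda>y. B ^ q * (33 * (1 + B)))"
              using Fb by (intro integral_mono) (auto intro!: measure_pmf.integrable_const_bound[of _ "B ^ q * (33 * (1 + B))"])
            finally show ?thesis by simp
          qed
          then show "AE \<omega> in M. norm (measure_pmf.expectation P (?F (\<lambda>i. X i \<omega>))) \<le> B ^ q * (33 * (1 + B))" by simp
        qed
        fix \<omega>
        have "measure_pmf.expectation P (?F (\<lambda>i. X i \<omega>)) =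
            ?A n \<omega> ^ q * measure_pmf.expectation P (sq_incr P (dev (pmf P) (\<lambda>i. X i \<omega>) n))" by simp
        also have "\<dots> \<le> ?A n \<omega> ^ q * 1"
          using sq_dev_nonneg by (intro mult_left_mono expectation_sq_incr sq_summable_dev) auto
        finally show "measure_pmf.expectation P (?F (\<lambda>i. X i \<omega>)) \<le> ?A n \<omega> ^ q" by simp
      qed
      finally show ?thesis .
    qed
    have Fi: "integrable M (\<lambda>\<omega>. ?A n \<omega> ^ q * ?D n \<omega>)"
      by (rule integrable_const_bound[of _ "B ^ q * (33 * (1 + B))"])
         (use Fb in \<open>auto intro!: sample_measurable[of "Suc n" "\<lambda>xs. sq_dev P xs n ^ q * sq_incr P (dev (pmf P) xs n) (xs (Suc n))"]
            arg_cong2[where f = "(*)"] arg_cong2[where f = "sq_incr P"] arg_cong[where f = "\<lambda>z. z ^ q"] sq_dev_cong dev_cong\<close>)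
    let ?R = "\<lambda>\<omega>. ?A n \<omega> ^ Suc q + real (Suc q) * (?A n \<omega> ^ q * ?D n \<omega>) + K * (2 ^ q * (1 + ?A n \<omega> ^ q))"
    have "expectation (\<lambda>\<omega>. ?A (Suc n) \<omega> ^ Suc q) \<le> expectation ?R"
    proof (rule integral_mono[OF sq_dev_integrable])
      show "integrable M ?R"
        by (intro Bochner_Integration.integrable_add integrable_mult_right sq_dev_integrable Fi) simp
      fix \<omega>
      have "?A (Suc n) \<omega> ^ Suc q \<le> ?A n \<omega> ^ Suc q + real (Suc q) * ?A n \<omega> ^ q * ?D n \<omega> + K * (1 + ?A n \<omega>) ^ q"
        using sq_dev_nonneg[of P _ n] sq_dev_nonneg[of P _ "Suc n"] sq_incr_bound[OF sq_summable_dev]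
        unfolding sq_dev_Suc by (intro Kb) (auto simp: sq_dev_def)
      also have "\<dots> \<le> ?R \<omega>"
        using K one_plus_power_le[OF sq_dev_nonneg, of P "\<lambda>i. X i \<omega>" n q] by (simp add: mult_left_mono mult.assoc)
      finally show "?A (Suc n) \<omega> ^ Suc q \<le> ?R \<omega>" .
    qed
    also have "expectation ?R = expectation (\<lambda>\<omega>. ?A n \<omega> ^ Suc q) + real (Suc q) * expectation (\<lambda>\<omega>. ?A n \<omega> ^ q * ?D n \<omega>)
        + K * (2 ^ q * (1 + expectation (\<lambda>\<omega>. ?A n \<omega> ^ q)))"
      using sq_dev_integrable[of n q] sq_dev_integrable[of n "Suc q"] Fi by (simp add: prob_space)
    also have "\<dots> \<le> expectation (\<lambda>\<omega>. ?A n \<omega> ^ Suc q) + real (Suc q) * (1 + C * real n ^ q) + K * (2 ^ q * (1 + C * real n ^ q))"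
    proof -
      have "expectation (\<lambda>\<omega>. ?A n \<omega> ^ q * ?D n \<omega>) \<le> 1 + C * real n ^ q"
        using FE C(2)[of n] by linarith
      then show ?thesis using C(2)[of n] K by (intro add_mono mult_left_mono) auto
    qed
    also have "\<dots> = expectation (\<lambda>\<omega>. ?A n \<omega> ^ Suc q) + (real (Suc q) + K * 2 ^ q) * (1 + C * real n ^ q)"
      by (simp add: algebra_simps)
    also have "(real (Suc q) + K * 2 ^ q) * (1 + C * real n ^ q) \<le> (real (Suc q) + K * 2 ^ q) * ((1 + C) * real (Suc n) ^ q)"
    proof (rule mult_left_mono)
      have "1 \<le> real (Suc n) ^ q" "real n ^ q \<le> real (Suc n) ^ q" by (auto intro: one_le_power power_mono)
      then show "1 + C * real n ^ q \<le> (1 + C) * real (Suc n) ^ q"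
        using C(1) mult_left_mono[of "real n ^ q" "real (Suc n) ^ q" C]
        unfolding distrib_right by linarith
    qed (use K in simp)
    finally show ?thesis by (simp add: H_def mult.assoc)
  qed
  have "expectation (\<lambda>\<omega>. ?A n \<omega> ^ Suc q) \<le> H * real n ^ Suc q" for n
  proof (induction n)
    case (Suc n)
    have "H * real n ^ Suc q + H * real (Suc n) ^ q \<le> H * real (Suc n) ^ Suc q"
    proof -
      have "real n * real n ^ q \<le> real n * real (Suc n) ^ q" by (intro mult_left_mono power_mono) auto
      then have "H * (real n ^ Suc q + real (Suc n) ^ q) \<le> H * real (Suc n) ^ Suc q"
        using H by (intro mult_left_mono) (auto simp: algebra_simps)
      then show ?thesis by (simp add: distrib_left)
    qed
    then show ?case using step[of n] Suc by linarith
  qed (simp add: sq_dev_0)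
  then show ?case using H by blast
qed

abbreviation Yn :: "nat \<Rightarrow> 'a \<Rightarrow> nat \<Rightarrow> real" where
  "Yn n \<omega> \<equiv> scaled_err (pmf P) emp_est (\<lambda>i. X i \<omega>) n"

lemma Yn_eq: "Yn n \<omega> = (\<lambda>x. dev (pmf P) (\<lambda>i. X i \<omega>) n x / sqrt n)"
  by (simp add: scaled_err_emp_eq fun_eq_iff)

lemma sq_summable_Yn: "sq_summable (Yn n \<omega>)"
  unfolding Yn_eq using sq_summable_cmult[OF sq_summable_dev, of "1 / sqrt n"] by simp

lemma l2_Yn_sq: "(l2 (Yn n \<omega>))\<^sup>2 = sq_dev P (\<lambda>i. X i \<omega>) n / n"
  unfolding l2_sq[OF sq_summable_Yn] unfolding Yn_eq power_divide sq_dev_def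
  by (simp add: suminf_divide[OF sq_summable_dev])

lemma l2_Yn_moments:
  "integrable M (\<lambda>\<omega>. (l2 (Yn n \<omega>)) ^ (2 * q))"
  "\<exists>C. \<forall>n. expectation (\<lambda>\<omega>. (l2 (Yn n \<omega>)) ^ (2 * q)) \<le> C"
proof -
  have eq: "(l2 (Yn n \<omega>)) ^ (2 * q) = sq_dev P (\<lambda>i. X i \<omega>) n ^ q / n ^ q" for n \<omega>
    by (simp add: power_mult l2_Yn_sq power_divide)
  show "integrable M (\<lambda>\<omega>. (l2 (Yn n \<omega>)) ^ (2 * q))"
    unfolding eq using sq_dev_integrable by simp
  obtain C where C: "0 \<le> C" "\<And>n. expectation (\<lambda>\<omega>. sq_dev P (\<lambda>i. X i \<omega>) n ^ q) \<le> C * real n ^ q"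
    using sq_dev_moments by blast
  have "expectation (\<lambda>\<omega>. (l2 (Yn n \<omega>)) ^ (2 * q)) \<le> C" for n
  proof -
    have "expectation (\<lambda>\<omega>. (l2 (Yn n \<omega>)) ^ (2 * q)) = expectation (\<lambda>\<omega>. sq_dev P (\<lambda>i. X i \<omega>) n ^ q) / real n ^ q"
      unfolding eq by simp
    also have "\<dots> \<le> C * real n ^ q / real n ^ q" by (intro divide_right_mono C) simp
    also have "\<dots> \<le> C" using C(1) by (cases "real n ^ q = 0") simp_all
    finally show ?thesis .
  qed
  then show "\<exists>C. \<forall>n. expectation (\<lambda>\<omega>. (l2 (Yn n \<omega>)) ^ (2 * q)) \<le> C" by blast
qed

text \<open>The coordinatewise bound behind tightness: increments are conditionally centred, so
  their second moments add up, each being at most \<open>pmf P x\<close>.\<close>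

lemma dev_second_moment:
  "integrable M (\<lambda>\<omega>. (dev (pmf P) (\<lambda>i. X i \<omega>) n x)\<^sup>2)"
  "expectation (\<lambda>\<omega>. (dev (pmf P) (\<lambda>i. X i \<omega>) n x)\<^sup>2) \<le> n * pmf P x"
proof -
  have ab: "\<bar>of_bool (y = x) - pmf P x\<bar> \<le> 1" for y
    using pmf_le_1[of P x] pmf_nonneg[of P x] by (cases "y = x") (simp_all add: abs_of_nonneg)
  have b: "\<bar>dev (pmf P) xs n x\<bar> \<le> n" for xs n
  proof -
    have "\<bar>dev (pmf P) xs n x\<bar> \<le> (\<Sum>i\<in>{1..n}. \<bar>of_bool (xs i = x) - pmf P x\<bar>)"
      unfolding dev_def by (rule sum_abs)
    also have "\<dots> \<le> (\<Sum>i\<in>{1..n}. 1)" using ab by (intro sum_mono)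
    finally show ?thesis by simp
  qed
  have b2: "(dev (pmf P) xs n x)\<^sup>2 \<le> (real n)\<^sup>2" for xs n
    using b[of xs n] by (simp add: abs_le_square_iff[symmetric])
  have m: "(\<lambda>\<omega>. dev (pmf P) (\<lambda>i. X i \<omega>) n x) \<in> borel_measurable M" for n
    by (rule sample_measurable[of n "\<lambda>xs. dev (pmf P) xs n x"]) (metis dev_cong)
  show i: "integrable M (\<lambda>\<omega>. (dev (pmf P) (\<lambda>i. X i \<omega>) n x)\<^sup>2)" for n
    by (rule integrable_const_bound[of _ "(real n)\<^sup>2"]) (use b2 m in auto)
  show "expectation (\<lambda>\<omega>. (dev (pmf P) (\<lambda>i. X i \<omega>) n x)\<^sup>2) \<le> n * pmf P x"
  proof (induction n)
    case (Suc n)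
    let ?d = "\<lambda>\<omega>. dev (pmf P) (\<lambda>i. X i \<omega>) n x" and ?e = "\<lambda>y. of_bool (y = x) - pmf P x"
    let ?F = "\<lambda>xs y. 2 * dev (pmf P) xs n x * ?e y + (?e y)\<^sup>2"
    have e2: "\<bar>(?e y)\<^sup>2\<bar> \<le> 1" for y using ab[of y] by (simp add: abs_square_le_1)
    have Fb: "\<bar>?F xs y\<bar> \<le> 2 * n + 1" for xs y
    proof -
      have "\<bar>2 * dev (pmf P) xs n x * ?e y\<bar> \<le> (2 * real n) * 1"
        unfolding abs_mult using b[of xs n] ab[of y] by (intro mult_mono) auto
      then show ?thesis using e2[of y] abs_triangle_ineq[of "2 * dev (pmf P) xs n x * ?e y" "(?e y)\<^sup>2"] by simp
    qed
    have Ee: "measure_pmf.expectation P ?e = 0" "measure_pmf.expectation P (\<lambda>y. (?e y)\<^sup>2) \<le> pmf P x"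
    proof -
      have I: "measure_pmf.expectation P (\<lambda>y. of_bool (y = x)) = pmf P x"
        by (subst integral_measure_pmf_real[of "{x}"]) (auto split: if_splits)
      have i: "integrable (measure_pmf P) (\<lambda>y. of_bool (y = x) :: real)"
        by (rule measure_pmf.integrable_const_bound[of _ 1]) auto
      show "measure_pmf.expectation P ?e = 0" using i I by simp
      have sq: "(?e y)\<^sup>2 = (1 - 2 * pmf P x) * of_bool (y = x) + (pmf P x)\<^sup>2" for y
        by (auto simp: power2_eq_square algebra_simps)
      have "measure_pmf.expectation P (\<lambda>y. (?e y)\<^sup>2) = (1 - 2 * pmf P x) * pmf P x + (pmf P x)\<^sup>2"
        unfolding sq using i I by simp
      also have "\<dots> \<le> pmf P x" by (simp add: power2_eq_square algebra_simps)
      finally show "measure_pmf.expectation P (\<lambda>y. (?e y)\<^sup>2) \<le> pmf P x" .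
    qed
    have "expectation (\<lambda>\<omega>. (dev (pmf P) (\<lambda>i. X i \<omega>) (Suc n) x)\<^sup>2) =
        expectation (\<lambda>\<omega>. (?d \<omega>)\<^sup>2 + ?F (\<lambda>i. X i \<omega>) (X (Suc n) \<omega>))"
      unfolding dev_Suc by (intro Bochner_Integration.integral_cong) (auto simp: power2_eq_square algebra_simps)
    also have "\<dots> = expectation (\<lambda>\<omega>. (?d \<omega>)\<^sup>2) + expectation (\<lambda>\<omega>. ?F (\<lambda>i. X i \<omega>) (X (Suc n) \<omega>))"
    proof (rule Bochner_Integration.integral_add[OF i])
      show "integrable M (\<lambda>\<omega>. ?F (\<lambda>i. X i \<omega>) (X (Suc n) \<omega>))"
      proof (rule integrable_const_bound[of _ "2 * n + 1"])
        show "(\<lambda>\<omega>. ?F (\<lambda>i. X i \<omega>) (X (Suc n) \<omega>)) \<in> borel_measurable M"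
        proof (rule sample_measurable[of "Suc n" "\<lambda>xs. ?F xs (xs (Suc n))"])
          fix xs ys :: "nat \<Rightarrow> nat" assume eq: "\<And>i. i \<in> {1..Suc n} \<Longrightarrow> xs i = ys i"
          have "dev (pmf P) xs n = dev (pmf P) ys n" by (rule dev_cong) (use eq in simp)
          moreover have "xs (Suc n) = ys (Suc n)" using eq by simp
          ultimately show "?F xs (xs (Suc n)) = ?F ys (ys (Suc n))" by simp
        qed
      qed (use Fb in auto)
    qed
    also have "expectation (\<lambda>\<omega>. ?F (\<lambda>i. X i \<omega>) (X (Suc n) \<omega>)) = expectation (\<lambda>\<omega>. measure_pmf.expectation P (?F (\<lambda>i. X i \<omega>)))"
      by (rule expectation_step[of n ?F, OF _ Fb]) (metis dev_cong)
    also have "\<dots> = expectation (\<lambda>\<omega>. measure_pmf.expectation P (\<lambda>y. (?e y)\<^sup>2))"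
    proof -
      have "integrable (measure_pmf P) ?e" "integrable (measure_pmf P) (\<lambda>y. (?e y)\<^sup>2)"
        using ab e2 by (auto intro!: measure_pmf.integrable_const_bound[of _ 1])
      then have "measure_pmf.expectation P (?F xs) = measure_pmf.expectation P (\<lambda>y. (?e y)\<^sup>2)" for xs
        using Ee(1) by (subst Bochner_Integration.integral_add) auto
      then show ?thesis by simp
    qed
    also have "\<dots> \<le> pmf P x" using Ee(2) by (simp add: prob_space)
    finally show ?case using Suc by (simp add: distrib_right)
  qed (simp add: dev_def)
qed

lemma sq_bounded_Yn: "sq_bounded M (Yn n) (pmf P)"
proof unfold_locales
  show "(\<lambda>\<omega>. Yn n \<omega> x) \<in> borel_measurable M" for x
    by (rule sample_measurable[of n "\<lambda>xs. scaled_err (pmf P) emp_est xs n x"]) (metis dev_cong scaled_err_emp_eq)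
  show "sq_summable (Yn n \<omega>)" for \<omega> by (rule sq_summable_Yn)
  show "summable (pmf P)" by (rule pmf_nat_sums)
  have eq: "(Yn n \<omega> x)\<^sup>2 = (dev (pmf P) (\<lambda>i. X i \<omega>) n x)\<^sup>2 / n" for \<omega> x
    by (simp add: Yn_eq power_divide)
  show "integrable M (\<lambda>\<omega>. (Yn n \<omega> x)\<^sup>2)" for x unfolding eq using dev_second_moment(1) by simp
  show "expectation (\<lambda>\<omega>. (Yn n \<omega> x)\<^sup>2) \<le> pmf P x" for x
    unfolding eq using dev_second_moment[of n x] by (cases "n = 0") (simp_all add: divide_le_eq mult.commute)
qed

text \<open>The Cramer-Wold step: a linear form in \<open>Yn\<close> is a normalised sum of the
  centred variables \<open>g (X i)\<close>, and the exponent contains the variance of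
  \<open>g\<close> under \<open>P\<close>.\<close>

lemma Yn_cos:
  "(\<lambda>n. expectation (\<lambda>\<omega>. cos ((\<Sum>x<m. a x * Yn n \<omega> x) + \<theta>))) \<longlonglongrightarrow>
    exp (- ((\<Sum>x<m. (a x)\<^sup>2 * pmf P x) - (\<Sum>x<m. a x * pmf P x)\<^sup>2) / 2) * cos \<theta>"
proof -
  define h where "h y = (if y < m then a y else 0)" for y
  define c where "c = (\<Sum>x<m. a x * pmf P x)"
  define g where "g y = h y - c" for y
  have lin: "(\<Sum>x<m. a x * Yn n \<omega> x) = (\<Sum>i\<in>{1..n}. g (X i \<omega>)) / sqrt n" for n \<omega>
  proof -
    have "(\<Sum>x<m. a x * Yn n \<omega> x) = (\<Sum>x<m. \<Sum>i\<in>{1..n}. a x * (of_bool (X i \<omega> = x) - pmf P x)) / sqrt n"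
      by (simp add: Yn_eq dev_def sum_divide_distrib sum_distrib_left)
    also have "(\<Sum>x<m. \<Sum>i\<in>{1..n}. a x * (of_bool (X i \<omega> = x) - pmf P x)) =
        (\<Sum>i\<in>{1..n}. \<Sum>x<m. a x * (of_bool (X i \<omega> = x) - pmf P x))" by (rule sum.swap)
    also have "\<dots> = (\<Sum>i\<in>{1..n}. g (X i \<omega>))"
    proof (rule sum.cong)
      fix i
      let ?y = "X i \<omega>"
      have "(\<Sum>x<m. a x * of_bool (?y = x)) = (\<Sum>x<m. if ?y = x then a x else 0)" by (intro sum.cong) auto
      also have "\<dots> = h ?y" by (simp add: h_def)
      finally show "(\<Sum>x<m. a x * (of_bool (?y = x) - pmf P x)) = g ?y"
        by (simp add: right_diff_distrib sum_subtractf g_def c_def)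
    qed simp
    finally show ?thesis .
  qed
  have hb: "\<bar>h y\<bar> \<le> (\<Sum>x<m. \<bar>a x\<bar>)" for y
  proof (cases "y < m")
    case True
    then have "\<bar>a y\<bar> \<le> (\<Sum>x<m. \<bar>a x\<bar>)" by (intro member_le_sum) auto
    then show ?thesis using True by (simp add: h_def)
  qed (simp add: h_def sum_nonneg)
  then have gb: "\<bar>g y\<bar> \<le> (\<Sum>x<m. \<bar>a x\<bar>) + \<bar>c\<bar>" for y
    unfolding g_def using hb[of y] by linarith
  have Eh: "measure_pmf.expectation P h = c"
    unfolding c_def h_def by (subst integral_measure_pmf_real[of "{..<m}"]) (auto split: if_splits)
  have Eh2: "measure_pmf.expectation P (\<lambda>y. (h y)\<^sup>2) = (\<Sum>x<m. (a x)\<^sup>2 * pmf P x)"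
    unfolding h_def by (subst integral_measure_pmf_real[of "{..<m}"]) (auto split: if_splits)
  have ih: "integrable (measure_pmf P) h" 
    using hb by (auto intro!: measure_pmf.integrable_const_bound[of _ "\<Sum>x<m. \<bar>a x\<bar>"])
  have "(h y)\<^sup>2 \<le> (\<Sum>x<m. \<bar>a x\<bar>)\<^sup>2" for y using hb[of y] by (metis abs_ge_zero power2_abs power_mono)
  then have ih2: "integrable (measure_pmf P) (\<lambda>y. (h y)\<^sup>2)"
    by (auto intro!: measure_pmf.integrable_const_bound[of _ "(\<Sum>x<m. \<bar>a x\<bar>)\<^sup>2"])
  have Eg: "measure_pmf.expectation P g = 0" unfolding g_def using ih Eh by simp
  have sq: "(g y)\<^sup>2 = (h y)\<^sup>2 - 2 * c * h y + c\<^sup>2" for y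
    by (simp add: g_def power2_eq_square algebra_simps)
  have Eg2: "measure_pmf.expectation P (\<lambda>y. (g y)\<^sup>2) = (\<Sum>x<m. (a x)\<^sup>2 * pmf P x) - c\<^sup>2"
    unfolding sq using ih ih2 Eh Eh2 by (simp add: power2_eq_square)
  show ?thesis using clt_cos[OF gb Eg, of \<theta>] unfolding lin Eg2 c_def .
qed

end

section \<open>Convergence in law and in mean\<close>

lemma cts_step_bounds: "0 \<le> cts_step a b x" "cts_step a b x \<le> 1" if "a < b"
  using that by (auto simp: cts_step_def field_simps)

lemma cts_step_lipschitz:
  assumes "a < b" shows "\<bar>cts_step a b x - cts_step a b y\<bar> \<le> (1 / (b - a)) * \<bar>x - y\<bar>"
proof -
  have *: "cts_step a b x = max 0 (min 1 ((b - x) / (b - a)))" for x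
    using assms by (auto simp: cts_step_def field_simps)
  have "\<bar>cts_step a b x - cts_step a b y\<bar> \<le> \<bar>(b - x) / (b - a) - (b - y) / (b - a)\<bar>"
    unfolding * by (auto simp: max_def min_def)
  also have "\<dots> = (1 / (b - a)) * \<bar>x - y\<bar>"
    using assms by (simp add: diff_divide_distrib[symmetric] abs_minus_commute)
  finally show ?thesis .
qed

text \<open>Bounded second moments give uniform integrability: cutting at \<open>B\<close> costs at
  most \<open>C / B\<close> for every \<open>n\<close>. The limit is integrable by monotone
  convergence of its cut versions, whose means inherit a bound from the \<open>F n\<close>.\<close>

lemma expectation_conv:
  fixes F :: "nat \<Rightarrow> 'a \<Rightarrow> real" and G :: "'b \<Rightarrow> real"
  assumes M: "prob_space M" and N: "prob_space N"
    and F: "\<And>n. F n \<in> borel_measurable M" "\<And>n \<omega>. \<omega> \<in> space M \<Longrightarrow> 0 \<le> F n \<omega>"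
    and G: "G \<in> borel_measurable N" "\<And>\<omega>. \<omega> \<in> space N \<Longrightarrow> 0 \<le> G \<omega>"
    and sq: "\<And>n. integrable M (\<lambda>\<omega>. (F n \<omega>)\<^sup>2)" "\<And>n. (\<integral>\<omega>. (F n \<omega>)\<^sup>2 \<partial>M) \<le> C"
    and wc: "weak_conv_m (\<lambda>n. distr M borel (F n)) (distr N borel G)"
  shows "\<And>n. integrable M (F n)" "integrable N G" "(\<lambda>n. \<integral>\<omega>. F n \<omega> \<partial>M) \<longlonglongrightarrow> (\<integral>\<omega>. G \<omega> \<partial>N)"
proof -
  interpret M: prob_space M by fact
  interpret N: prob_space N by fact
  show iF: "integrable M (F n)" for n
    by (rule M.square_integrable_imp_integrable[OF F(1) sq(1)])
  have C0: "0 \<le> C" using order_trans[OF _ sq(2)[of 0]] by simp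
  have conv: "(\<lambda>n. \<integral>\<omega>. min (F n \<omega>) B \<partial>M) \<longlonglongrightarrow> (\<integral>\<omega>. min (G \<omega>) B \<partial>N)" if B: "0 < B" for B
  proof -
    \<comment> \<open>The outer maximum makes the test function bounded on the whole line; on
      nonnegative values it is just the cut at \<open>B\<close>.\<close>
    let ?h = "\<lambda>y. max 0 (min y B)"
    have "(\<lambda>n. integral\<^sup>L (distr M borel (F n)) ?h) \<longlonglongrightarrow> integral\<^sup>L (distr N borel G) ?h"
      by (rule weak_conv_imp_integral_bdd_continuous_conv[OF M.real_distribution_distr[OF F(1)]
            N.real_distribution_distr[OF G(1)] wc, where B = B])
         (use B in \<open>auto intro!: continuous_intros\<close>)
    moreover have "integral\<^sup>L (distr M borel (F n)) ?h = (\<integral>\<omega>. min (F n \<omega>) B \<partial>M)" for n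
      using F B by (subst integral_distr) (auto intro!: Bochner_Integration.integral_cong)
    moreover have "integral\<^sup>L (distr N borel G) ?h = (\<integral>\<omega>. min (G \<omega>) B \<partial>N)"
      using G B by (subst integral_distr) (auto intro!: Bochner_Integration.integral_cong)
    ultimately show ?thesis by simp
  qed
  have iFm: "integrable M (\<lambda>\<omega>. min (F n \<omega>) B)" if "0 < B" for n B
    by (rule M.integrable_const_bound[of _ B]) (use F that in auto)
  have iGm: "integrable N (\<lambda>\<omega>. min (G \<omega>) B)" if "0 < B" for B
    by (rule N.integrable_const_bound[of _ B]) (use G that in auto)
  have diff: "\<bar>(\<integral>\<omega>. F n \<omega> \<partial>M) - (\<integral>\<omega>. min (F n \<omega>) B \<partial>M)\<bar> \<le> C / B" if B: "0 < B" for n B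
  proof -
    have "\<bar>(\<integral>\<omega>. F n \<omega> \<partial>M) - (\<integral>\<omega>. min (F n \<omega>) B \<partial>M)\<bar> = \<bar>\<integral>\<omega>. F n \<omega> - min (F n \<omega>) B \<partial>M\<bar>"
      using iF iFm[OF B] by simp
    also have "\<dots> \<le> (\<integral>\<omega>. \<bar>F n \<omega> - min (F n \<omega>) B\<bar> \<partial>M)" by (rule integral_abs_bound)
    also have "\<dots> \<le> (\<integral>\<omega>. (F n \<omega>)\<^sup>2 / B \<partial>M)"
    proof (rule integral_mono)
      fix \<omega> assume "\<omega> \<in> space M"
      then have "0 \<le> F n \<omega>" using F by simp
      then have "F n \<omega> - B \<le> (F n \<omega>)\<^sup>2 / B" if "B \<le> F n \<omega>"
      proof -
        have "B * F n \<omega> \<le> F n \<omega> * F n \<omega>" using that \<open>0 \<le> F n \<omega>\<close> by (intro mult_right_mono)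
        then have "F n \<omega> \<le> (F n \<omega>)\<^sup>2 / B" using B by (simp add: pos_le_divide_eq power2_eq_square mult.commute)
        then show ?thesis using B by linarith
      qed
      then show "\<bar>F n \<omega> - min (F n \<omega>) B\<bar> \<le> (F n \<omega>)\<^sup>2 / B"
        using B by (cases "B \<le> F n \<omega>") (auto simp: min_def)
    qed (use iF iFm[OF B] sq in auto)
    also have "\<dots> = (\<integral>\<omega>. (F n \<omega>)\<^sup>2 \<partial>M) / B" by simp
    also have "\<dots> \<le> C / B" using sq(2) B by (intro divide_right_mono) auto
    finally show ?thesis .
  qed
  have EF: "(\<integral>\<omega>. F n \<omega> \<partial>M) \<le> C + 1" for n
  proof -
    have "(\<integral>\<omega>. F n \<omega> \<partial>M) \<le> (\<integral>\<omega>. (F n \<omega>)\<^sup>2 + 1 \<partial>M)"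
    proof (rule integral_mono)
      fix \<omega>
      have "0 \<le> (F n \<omega> - 1 / 2)\<^sup>2" by simp
      then show "F n \<omega> \<le> (F n \<omega>)\<^sup>2 + 1" by (simp add: power2_eq_square algebra_simps)
    qed (use iF sq in auto)
    also have "\<dots> \<le> C + 1" using sq by (simp add: M.prob_space)
    finally show ?thesis .
  qed
  have EG: "(\<integral>\<omega>. min (G \<omega>) B \<partial>N) \<le> C + 1" if B: "0 < B" for B
  proof (rule LIMSEQ_le_const2[OF conv[OF B]], intro exI allI impI)
    fix n
    have "(\<integral>\<omega>. min (F n \<omega>) B \<partial>M) \<le> (\<integral>\<omega>. F n \<omega> \<partial>M)" using iF iFm[OF B] by (intro integral_mono) auto
    then show "(\<integral>\<omega>. min (F n \<omega>) B \<partial>M) \<le> C + 1" using EF[of n] by linarith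
  qed
  let ?g = "\<lambda>n \<omega>. min (G \<omega>) (real (Suc n))"
  have mono: "AE \<omega> in N. mono (\<lambda>n. ?g n \<omega>)" by (auto simp: mono_def)
  have lim: "AE \<omega> in N. (\<lambda>n. ?g n \<omega>) \<longlonglongrightarrow> G \<omega>"
  proof (rule AE_I2)
    fix \<omega>
    obtain m where m: "G \<omega> \<le> real m" using real_arch_simple by blast
    have "?g n \<omega> = G \<omega>" if "n \<ge> m" for n using m that by simp
    then show "(\<lambda>n. ?g n \<omega>) \<longlonglongrightarrow> G \<omega>"
      by (intro tendsto_eventually) (rule eventually_sequentiallyI)
  qed
  have inc: "incseq (\<lambda>n. \<integral>\<omega>. ?g n \<omega> \<partial>N)"
    using iGm by (intro incseq_SucI integral_mono) auto
  have "bdd_above (range (\<lambda>n. \<integral>\<omega>. ?g n \<omega> \<partial>N))" using EG by (intro bdd_aboveI[of _ "C + 1"]) auto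
  then have "convergent (\<lambda>n. \<integral>\<omega>. ?g n \<omega> \<partial>N)"
    using LIMSEQ_incseq_SUP[OF _ inc] by (auto simp: convergent_def)
  then obtain L where L: "(\<lambda>n. \<integral>\<omega>. ?g n \<omega> \<partial>N) \<longlonglongrightarrow> L" by (auto simp: convergent_def)
  show iG: "integrable N G"
    by (rule integrable_monotone_convergence[OF iGm mono lim L G(1)]) simp
  have LG: "(\<lambda>n. \<integral>\<omega>. ?g n \<omega> \<partial>N) \<longlonglongrightarrow> (\<integral>\<omega>. G \<omega> \<partial>N)"
    using integral_monotone_convergence[OF iGm mono lim L G(1)] L by simp
  show "(\<lambda>n. \<integral>\<omega>. F n \<omega> \<partial>M) \<longlonglongrightarrow> (\<integral>\<omega>. G \<omega> \<partial>N)"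
  proof (rule tendsto_by_approx)
    fix e :: real assume e: "e > 0"
    have "\<forall>\<^sub>F n in sequentially. dist (\<integral>\<omega>. ?g n \<omega> \<partial>N) (\<integral>\<omega>. G \<omega> \<partial>N) < e"
      using LG e by (rule tendstoD)
    then obtain n0 where n0: "\<And>n. n \<ge> n0 \<Longrightarrow> dist (\<integral>\<omega>. ?g n \<omega> \<partial>N) (\<integral>\<omega>. G \<omega> \<partial>N) < e"
      unfolding eventually_sequentially by blast
    obtain n1 where n1: "C / e \<le> real n1" using real_arch_simple by blast
    define n where "n = max n0 n1"
    have "C / e \<le> real (Suc n)" using n1 by (simp add: n_def)
    then have Ce: "C / real (Suc n) \<le> e" using e by (simp add: divide_le_eq mult.commute)
    have "\<bar>(\<integral>\<omega>. F i \<omega> \<partial>M) - (\<integral>\<omega>. min (F i \<omega>) (real (Suc n)) \<partial>M)\<bar> \<le> e" for i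
      using diff[of "real (Suc n)" i] Ce by simp
    moreover have "\<bar>(\<integral>\<omega>. G \<omega> \<partial>N) - (\<integral>\<omega>. ?g n \<omega> \<partial>N)\<bar> \<le> e"
      using n0[of n] by (simp add: dist_real_def abs_minus_commute n_def)
    ultimately show "\<exists>b b'. b \<longlonglongrightarrow> b' \<and> (\<forall>\<^sub>F i in sequentially. \<bar>(\<integral>\<omega>. F i \<omega> \<partial>M) - b i\<bar> \<le> e) \<and>
        \<bar>(\<integral>\<omega>. G \<omega> \<partial>N) - b'\<bar> \<le> e"
      using conv[of "real (Suc n)"] by (intro exI[of _ "\<lambda>i. \<integral>\<omega>. min (F i \<omega>) (real (Suc n)) \<partial>M"]
          exI[of _ "\<integral>\<omega>. ?g n \<omega> \<partial>N"]) simp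
  qed
qed

context iid_sample
begin

text \<open>Convergence in law is tested on the piecewise linear \<open>cts_step\<close>, which is
  Lipschitz, so its composition with \<open>f\<close> falls under
  \<open>lipschitz_weak_limit\<close>. Replacing \<open>F n\<close> by \<open>f (Yn n)\<close> costs
  a small tail when the empirical estimator is near \<open>pmf P\<close>, and otherwise, by
  Chebyshev, at most \<open>C / (\<epsilon>\<^sup>2 * n)\<close>.\<close>

theorem functional_weak_conv:
  fixes N :: "'b measure" and F :: "nat \<Rightarrow> 'a \<Rightarrow> real"
  assumes W: "sq_bounded N W (pmf P)"
    and cos: "\<And>m a \<theta>. (\<integral>\<omega>. cos ((\<Sum>x<m. a x * W \<omega> x) + \<theta>) \<partial>N) =
      exp (- ((\<Sum>x<m. (a x)\<^sup>2 * pmf P x) - (\<Sum>x<m. a x * pmf P x)\<^sup>2) / 2) * cos \<theta>"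
    and f: "l2_lipschitz 1 f" and F: "\<And>n. F n \<in> borel_measurable M"
    and approx: "\<And>\<eta>. 0 < \<eta> \<Longrightarrow> \<exists>m. (\<Sum>x. pmf P (x + m)) < \<eta> \<and> (\<exists>\<epsilon>>0. \<forall>n>0. \<forall>\<omega>\<in>space M.
      l2 (Yn n \<omega>) < \<epsilon> * sqrt n \<longrightarrow> \<bar>F n \<omega> - f (Yn n \<omega>)\<bar> \<le> 2 * l2 (\<lambda>x. Yn n \<omega> x - trunc m (Yn n \<omega>) x))"
  shows "weak_conv_m (\<lambda>n. distr M borel (F n)) (distr N borel (\<lambda>\<omega>. f (W \<omega>)))"
proof (rule integral_cts_step_conv_imp_weak_conv)
  interpret W: sq_bounded N W "pmf P" by fact
  have fW: "(\<lambda>\<omega>. f (W \<omega>)) \<in> borel_measurable N"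
    by (rule l2_lipschitz_measurable[OF W.meas W.sq f])
  show "real_distribution (distr M borel (F n))" for n by (rule real_distribution_distr[OF F])
  show "real_distribution (distr N borel (\<lambda>\<omega>. f (W \<omega>)))" by (rule W.real_distribution_distr[OF fW])
  fix x y :: real assume xy: "x < y"
  define c where "c = 1 / (y - x)"
  have c: "c > 0" using xy by (simp add: c_def)
  let ?\<psi> = "cts_step x y"
  note lip = cts_step_lipschitz[OF xy, folded c_def]
  have \<psi>m: "?\<psi> \<in> borel_measurable borel"
    using cts_step_uniformly_continuous[OF xy] by (intro borel_measurable_continuous_onI uniformly_continuous_imp_continuous)
  have \<psi>f: "l2_lipschitz c (\<lambda>z. ?\<psi> (f z))"
    unfolding l2_lipschitz_def
  proof (intro allI impI)
    fix z z' :: "nat \<Rightarrow> real" assume "sq_summable z" "sq_summable z'"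
    then have "\<bar>f z - f z'\<bar> \<le> l2 (\<lambda>x. z x - z' x)" using f by (simp add: l2_lipschitz_def)
    then have "c * \<bar>f z - f z'\<bar> \<le> c * l2 (\<lambda>x. z x - z' x)" using c by simp
    with lip show "\<bar>?\<psi> (f z) - ?\<psi> (f z')\<bar> \<le> c * l2 (\<lambda>x. z x - z' x)" by (rule order_trans)
  qed
  have fY: "(\<lambda>\<omega>. f (Yn n \<omega>)) \<in> borel_measurable M" for n
    by (rule l2_lipschitz_measurable[OF sq_bounded.meas[OF sq_bounded_Yn] sq_summable_Yn f])
  have lim: "(\<lambda>n. \<integral>\<omega>. ?\<psi> (f (Yn n \<omega>)) \<partial>M) \<longlonglongrightarrow> (\<integral>\<omega>. ?\<psi> (f (W \<omega>)) \<partial>N)"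
    by (rule lipschitz_weak_limit[OF sq_bounded_Yn W _ \<psi>f, where B = 1])
       (use Yn_cos cos c cts_step_bounds[OF xy] in auto)
  have i1: "integrable M (\<lambda>\<omega>. ?\<psi> (F n \<omega>))" for n
    by (rule integrable_const_bound[of _ 1])
       (use cts_step_bounds[OF xy] measurable_compose[OF F \<psi>m] in auto)
  have i2: "integrable M (\<lambda>\<omega>. ?\<psi> (f (Yn n \<omega>)))" for n
    by (rule integrable_const_bound[of _ 1])
       (use cts_step_bounds[OF xy] measurable_compose[OF fY \<psi>m] in auto)
  have "(\<lambda>n. \<integral>\<omega>. ?\<psi> (F n \<omega>) \<partial>M) \<longlonglongrightarrow> (\<integral>\<omega>. ?\<psi> (f (W \<omega>)) \<partial>N)"
  proof (rule tendsto_by_approx)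
    fix e :: real assume e: "e > 0"
    \<comment> \<open>Chosen so that \<open>2 * c * (2 * \<delta>)\<close> is
      \<open>e / 2\<close>.\<close>
    define \<delta> where "\<delta> = e / (8 * c)"
    have \<delta>: "\<delta> > 0" using e c by (simp add: \<delta>_def)
    obtain m \<epsilon> where m: "(\<Sum>x. pmf P (x + m)) < \<delta>\<^sup>2" and \<epsilon>: "\<epsilon> > 0"
      and ap: "\<And>n \<omega>. \<lbrakk>0 < n; \<omega> \<in> space M; l2 (Yn n \<omega>) < \<epsilon> * sqrt n\<rbrakk> \<Longrightarrow>
        \<bar>F n \<omega> - f (Yn n \<omega>)\<bar> \<le> 2 * l2 (\<lambda>x. Yn n \<omega> x - trunc m (Yn n \<omega>) x)"
      using approx[of "\<delta>\<^sup>2"] \<delta> by auto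
    let ?t = "\<lambda>n \<omega>. l2 (\<lambda>x. Yn n \<omega> x - trunc m (Yn n \<omega>) x)"
    let ?b = "\<lambda>n \<omega>. 2 * c * ?t n \<omega> + (l2 (Yn n \<omega>))\<^sup>2 / (\<epsilon>\<^sup>2 * n)"
    have t: "integrable M (?t n)" "expectation (?t n) \<le> 2 * \<delta>" for n
    proof -
      show "integrable M (?t n)" by (rule sq_bounded.tail_l2_expectation(1)[OF sq_bounded_Yn \<delta>])
      have "expectation (?t n) \<le> \<delta> + (\<Sum>x. pmf P (x + m)) / \<delta>"
        by (rule sq_bounded.tail_l2_expectation(2)[OF sq_bounded_Yn \<delta>])
      also have "(\<Sum>x. pmf P (x + m)) / \<delta> \<le> \<delta>" using m \<delta> by (simp add: divide_le_eq power2_eq_square)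
      finally show "expectation (?t n) \<le> 2 * \<delta>" by simp
    qed
    obtain C where C: "\<And>n. expectation (\<lambda>\<omega>. (l2 (Yn n \<omega>))\<^sup>2) \<le> C" using l2_Yn_moments(2)[of 1] by auto
    have i3: "integrable M (\<lambda>\<omega>. (l2 (Yn n \<omega>))\<^sup>2)" for n using l2_Yn_moments(1)[of n 1] by simp
    have bound: "\<bar>(\<integral>\<omega>. ?\<psi> (F n \<omega>) \<partial>M) - (\<integral>\<omega>. ?\<psi> (f (Yn n \<omega>)) \<partial>M)\<bar> \<le> e / 2 + C / (\<epsilon>\<^sup>2 * n)" if n: "0 < n" for n
    proof -
      have "\<bar>(\<integral>\<omega>. ?\<psi> (F n \<omega>) \<partial>M) - (\<integral>\<omega>. ?\<psi> (f (Yn n \<omega>)) \<partial>M)\<bar> = \<bar>expectation (\<lambda>\<omega>. ?\<psi> (F n \<omega>) - ?\<psi> (f (Yn n \<omega>)))\<bar>"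
        using i1 i2 by simp
      also have "\<dots> \<le> expectation (\<lambda>\<omega>. \<bar>?\<psi> (F n \<omega>) - ?\<psi> (f (Yn n \<omega>))\<bar>)" by (rule integral_abs_bound)
      also have "\<dots> \<le> expectation (?b n)"
      proof (rule integral_mono)
        show "integrable M (?b n)" using t i3 by simp
        fix \<omega> assume \<omega>: "\<omega> \<in> space M"
        have t0: "0 \<le> ?t n \<omega>" by (intro l2_nonneg sq_summable_diff sq_summable_Yn sq_summable_trunc)
        show "\<bar>?\<psi> (F n \<omega>) - ?\<psi> (f (Yn n \<omega>))\<bar> \<le> ?b n \<omega>"
        proof (cases "l2 (Yn n \<omega>) < \<epsilon> * sqrt n")
          case True
          have "\<bar>?\<psi> (F n \<omega>) - ?\<psi> (f (Yn n \<omega>))\<bar> \<le> c * \<bar>F n \<omega> - f (Yn n \<omega>)\<bar>" by (rule lip)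
          also have "\<dots> \<le> c * (2 * ?t n \<omega>)" using ap[OF n \<omega> True] c by (intro mult_left_mono) auto
          also have "\<dots> \<le> ?b n \<omega>" by simp
          finally show ?thesis .
        next
          case False
          then have "(\<epsilon> * sqrt n)\<^sup>2 \<le> (l2 (Yn n \<omega>))\<^sup>2" using \<epsilon> by (intro power_mono) auto
          then have "1 \<le> (l2 (Yn n \<omega>))\<^sup>2 / (\<epsilon>\<^sup>2 * n)" using \<epsilon> n by (simp add: power_mult_distrib)
          moreover have "\<bar>?\<psi> (F n \<omega>) - ?\<psi> (f (Yn n \<omega>))\<bar> \<le> 1"
            using cts_step_bounds[OF xy, of "F n \<omega>"] cts_step_bounds[OF xy, of "f (Yn n \<omega>)"] by (auto simp: abs_le_iff)
          moreover have "0 \<le> 2 * c * ?t n \<omega>" using c t0 by simp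
          ultimately show ?thesis by linarith
        qed
      qed (use i1 i2 in auto)
      also have "\<dots> = 2 * c * expectation (?t n) + expectation (\<lambda>\<omega>. (l2 (Yn n \<omega>))\<^sup>2) / (\<epsilon>\<^sup>2 * n)"
        using t i3 by simp
      also have "\<dots> \<le> 2 * c * (2 * \<delta>) + C / (\<epsilon>\<^sup>2 * n)"
        using t C c by (intro add_mono mult_left_mono divide_right_mono) auto
      finally show ?thesis using c by (simp add: \<delta>_def)
    qed
    have "(\<lambda>n. (C / \<epsilon>\<^sup>2) * (1 / real n)) \<longlonglongrightarrow> (C / \<epsilon>\<^sup>2) * 0"
      by (intro tendsto_mult tendsto_const lim_1_over_n)
    then have "(\<lambda>n. C / (\<epsilon>\<^sup>2 * n)) \<longlonglongrightarrow> 0" by simp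
    then have "\<forall>\<^sub>F n in sequentially. C / (\<epsilon>\<^sup>2 * n) < e / 2"
      using e by (intro order_tendstoD(2)) auto
    then have "\<forall>\<^sub>F n in sequentially. \<bar>(\<integral>\<omega>. ?\<psi> (F n \<omega>) \<partial>M) - (\<integral>\<omega>. ?\<psi> (f (Yn n \<omega>)) \<partial>M)\<bar> \<le> e"
      using eventually_gt_at_top[of 0]
    proof eventually_elim
      case (elim n)
      then show ?case using bound[of n] by linarith
    qed
    then show "\<exists>b b'. b \<longlonglongrightarrow> b' \<and> (\<forall>\<^sub>F n in sequentially. \<bar>(\<integral>\<omega>. ?\<psi> (F n \<omega>) \<partial>M) - b n\<bar> \<le> e) \<and>
        \<bar>(\<integral>\<omega>. ?\<psi> (f (W \<omega>)) \<partial>N) - b'\<bar> \<le> e"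
      using lim e by (intro exI[of _ "\<lambda>n. \<integral>\<omega>. ?\<psi> (f (Yn n \<omega>)) \<partial>M"] exI[of _ "\<integral>\<omega>. ?\<psi> (f (W \<omega>)) \<partial>N"]) simp
  qed
  then show "(\<lambda>n. integral\<^sup>L (distr M borel (F n)) ?\<psi>) \<longlonglongrightarrow> integral\<^sup>L (distr N borel (\<lambda>\<omega>. f (W \<omega>))) ?\<psi>"
    using \<psi>m F fW by (simp add: integral_distr)
qed

end

section \<open>The Gaussian limit\<close>

context prob_space
begin

lemma gaussian_rv_square_integrable:
  assumes "gaussian_rv M Z"
  shows "Z \<in> borel_measurable M" "integrable M (\<lambda>\<omega>. (Z \<omega>)\<^sup>2)" "integrable M Z"
proof -
  show m: "Z \<in> borel_measurable M" using assms by (simp add: gaussian_rv_def)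
  consider \<mu> where "AE \<omega> in M. Z \<omega> = \<mu>"
    | \<mu> \<sigma> where "\<sigma> > 0" "distributed M lborel Z (normal_density \<mu> \<sigma>)"
    using assms by (auto simp: gaussian_rv_def)
  then show sq: "integrable M (\<lambda>\<omega>. (Z \<omega>)\<^sup>2)"
  proof cases
    case 1
    have "AE \<omega> in M. norm ((Z \<omega>)\<^sup>2) \<le> \<mu>\<^sup>2" using 1 by eventually_elim simp
    then show ?thesis using m by (intro integrable_const_bound[of _ "\<mu>\<^sup>2"]) auto
  next
    case 2
    have 1: "integrable M (\<lambda>\<omega>. (Z \<omega> - \<mu>)\<^sup>2)"
      using integrable_normal_moment[OF 2(1), of \<mu> 2] distributed_integrable[OF 2(2), of "\<lambda>y. (y - \<mu>)\<^sup>2"] by simp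
    have 2: "integrable M (\<lambda>\<omega>. Z \<omega>)"
      using integrable_normal_moment_nz_1[OF 2(1), of \<mu>] distributed_integrable[OF 2(2), of "\<lambda>y. y"] by simp
    have "integrable M (\<lambda>\<omega>. (Z \<omega> - \<mu>)\<^sup>2 + 2 * \<mu> * Z \<omega> - \<mu>\<^sup>2)" using 1 2 by simp
    then show ?thesis by (simp add: power2_eq_square algebra_simps)
  qed
  show "integrable M Z" by (rule square_integrable_imp_integrable[OF m sq])
qed

lemma gaussian_rv_cases:
  assumes "gaussian_rv M Z" "expectation Z = 0" "expectation (\<lambda>\<omega>. (Z \<omega>)\<^sup>2) = V"
  obtains "V = 0" "AE \<omega> in M. Z \<omega> = 0" 
    | "V > 0" "distributed M lborel Z (normal_density 0 (sqrt V))"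
proof -
  consider \<mu> where "AE \<omega> in M. Z \<omega> = \<mu>"
    | \<mu> \<sigma> where "\<sigma> > 0" "distributed M lborel Z (normal_density \<mu> \<sigma>)"
    using assms by (auto simp: gaussian_rv_def)
  then show ?thesis
  proof cases
    case 1
    have m: "Z \<in> borel_measurable M" using assms by (simp add: gaussian_rv_def)
    have "expectation Z = expectation (\<lambda>_. \<mu>)" by (rule integral_cong_AE) (use 1 m in auto)
    then have "\<mu> = 0" using assms by (simp add: prob_space)
    then have ae: "AE \<omega> in M. Z \<omega> = 0" using 1 by simp
    have "expectation (\<lambda>\<omega>. (Z \<omega>)\<^sup>2) = expectation (\<lambda>_. 0)"
      by (rule integral_cong_AE) (use ae m in auto)
    then show ?thesis using that(1) ae assms by simp
  next
    case 2
    have \<mu>: "\<mu> = 0" using normal_distributed_expectation[OF 2] assms(2) by simp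
    have "V = \<sigma>\<^sup>2" using normal_distributed_variance[OF 2] assms by simp
    then show ?thesis using that(2) 2 \<mu> by simp
  qed
qed

lemma gaussian_rv_cos:
  assumes "gaussian_rv M Z" "expectation Z = 0" "expectation (\<lambda>\<omega>. (Z \<omega>)\<^sup>2) = V"
  shows "expectation (\<lambda>\<omega>. cos (Z \<omega> + \<theta>)) = exp (- V / 2) * cos \<theta>"
  using gaussian_rv_cases[OF assms]
proof cases
  case 1
  have m: "Z \<in> borel_measurable M" using assms by (simp add: gaussian_rv_def)
  have "expectation (\<lambda>\<omega>. cos (Z \<omega> + \<theta>)) = expectation (\<lambda>_. cos \<theta>)"
    by (rule integral_cong_AE) (use 1 m in auto)
  then show ?thesis using 1 by (simp add: prob_space)
next
  case 2
  define s where "s = sqrt V"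
  have s: "s > 0" "s\<^sup>2 = V" using 2 by (auto simp: s_def)
  have d: "distributed M lborel (\<lambda>\<omega>. Z \<omega> / s) std_normal_density"
    using 2(2) normal_standard_normal_convert[OF s(1), of Z 0] by (simp add: s_def)
  have "expectation (\<lambda>\<omega>. cos (Z \<omega> + \<theta>)) = expectation (\<lambda>\<omega>. cos (s * (Z \<omega> / s) + \<theta>))" using s by simp
  also have "\<dots> = (\<integral>y. std_normal_density y * cos (s * y + \<theta>) \<partial>lborel)"
    using distributed_integral[OF d, of "\<lambda>y. cos (s * y + \<theta>)"] by simp
  also have "\<dots> = (\<integral>y. cos (s * y + \<theta>) \<partial>std_normal_distribution)"
    by (subst integral_density) auto
  finally show ?thesis by (simp add: integral_cos_std_normal s)
qed

text \<open>A normal density is positive everywhere, in particular on the interval of length one to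
  the left of \<open>c\<close>.\<close>

lemma gaussian_rv_lower_tail:
  assumes Z: "gaussian_rv M Z" "expectation Z = 0" "expectation (\<lambda>\<omega>. (Z \<omega>)\<^sup>2) = V" and V: "V > 0"
  shows "prob {\<omega> \<in> space M. Z \<omega> < c} > 0"
  using gaussian_rv_cases[OF Z]
proof cases
  case 2
  have eq: "emeasure M {\<omega> \<in> space M. Z \<omega> < c} = (\<integral>\<^sup>+y. ennreal (normal_density 0 (sqrt V) y) * indicator {..<c} y \<partial>lborel)"
    using distributed_emeasure[OF 2(2), of "{..<c}"] by (simp add: vimage_def Int_def conj_commute)
  have "emeasure M {\<omega> \<in> space M. Z \<omega> < c} \<noteq> 0"
  proof
    assume "emeasure M {\<omega> \<in> space M. Z \<omega> < c} = 0"
    then have "AE y in lborel. ennreal (normal_density 0 (sqrt V) y) * indicator {..<c} y = 0"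
      unfolding eq by (subst (asm) nn_integral_0_iff_AE) auto
    then have "AE y in lborel. y \<notin> {c - 1..<c}"
    proof eventually_elim
      case (elim y)
      have "normal_density 0 (sqrt V) y > 0" using V by (intro normal_density_pos) simp
      then show ?case using elim by (auto simp: indicator_def split: if_splits)
    qed
    then have "emeasure lborel {c - 1..<c} = 0" by (subst (asm) AE_iff_measurable[of "{c - 1..<c}"]) auto
    then show False by simp
  qed
  then show ?thesis by (simp add: emeasure_eq_measure zero_less_measure_iff)
qed (use V in simp)

end

text \<open>The variance under \<open>P\<close> of the function that is \<open>a\<close> below
  \<open>m\<close> and zero from \<open>m\<close> on; equally the variance of the linear form with
  coefficients \<open>a\<close> in the limit process.\<close>

definition cov_form :: "nat pmf \<Rightarrow> (nat \<Rightarrow> real) \<Rightarrow> nat \<Rightarrow> real" where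
  "cov_form P a m = (\<Sum>x<m. (a x)\<^sup>2 * pmf P x) - (\<Sum>x<m. a x * pmf P x)\<^sup>2"

locale gaussian_limit = prob_space N for N :: "'b measure" +
  fixes Y :: "nat \<Rightarrow> 'b \<Rightarrow> real" and P :: "nat pmf"
  assumes limit: "limit_process (pmf P) N Y"
begin

lemma finite_linear_gaussian: "finite J \<Longrightarrow> gaussian_rv N (\<lambda>\<omega>. \<Sum>x\<in>J. a x * Y x \<omega>)"
proof -
  assume J: "finite J"
  have *: "\<forall>J a. finite J \<longrightarrow> gaussian_rv N (\<lambda>\<omega>. \<Sum>x\<in>J. a x * Y x \<omega>)"
    using limit unfolding limit_process_def gaussian_process_def by (rule conjunct1)
  show ?thesis by (rule *[THEN spec[of _ J], THEN spec[of _ a], THEN mp, OF J])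
qed

lemma linear_gaussian: "gaussian_rv N (\<lambda>\<omega>. \<Sum>x<m. a x * Y x \<omega>)"
  by (rule finite_linear_gaussian[OF finite_lessThan])

lemma Y_gaussian: "gaussian_rv N (Y x)"
  using finite_linear_gaussian[of "{x}" "\<lambda>_. 1"] by simp

lemmas Y_square = gaussian_rv_square_integrable[OF Y_gaussian]

lemma Y_prod:
  "integrable N (\<lambda>\<omega>. Y x \<omega> * Y y \<omega>)"
  "expectation (\<lambda>\<omega>. Y x \<omega> * Y y \<omega>) = (if x = y then pmf P x else 0) - pmf P x * pmf P y"
proof -
  show "integrable N (\<lambda>\<omega>. Y x \<omega> * Y y \<omega>)"
  proof (rule Bochner_Integration.integrable_bound[of _ "\<lambda>\<omega>. (Y x \<omega>)\<^sup>2 + (Y y \<omega>)\<^sup>2"])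
    have "\<bar>a * b\<bar> \<le> a\<^sup>2 + b\<^sup>2" for a b :: real
    proof -
      have "0 \<le> (\<bar>a\<bar> - \<bar>b\<bar>)\<^sup>2" by simp
      then have "2 * \<bar>a * b\<bar> \<le> a\<^sup>2 + b\<^sup>2" by (simp add: power2_eq_square algebra_simps abs_mult)
      moreover have "0 \<le> \<bar>a * b\<bar>" by simp
      ultimately show ?thesis by linarith
    qed
    then show "AE \<omega> in N. norm (Y x \<omega> * Y y \<omega>) \<le> norm ((Y x \<omega>)\<^sup>2 + (Y y \<omega>)\<^sup>2)" by simp
  qed (use Y_square in \<open>auto intro: borel_measurable_times\<close>)
  have "cov N (Y x) (Y y) = (if x = y then pmf P x else 0) - pmf P x * pmf P y"
    using limit by (simp add: limit_process_def)
  then show "expectation (\<lambda>\<omega>. Y x \<omega> * Y y \<omega>) = (if x = y then pmf P x else 0) - pmf P x * pmf P y"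
    using limit by (simp add: cov_def limit_process_def)
qed

lemma linear_mean: "expectation (\<lambda>\<omega>. \<Sum>x<m. a x * Y x \<omega>) = 0"
  using Y_square limit by (simp add: limit_process_def)

lemma linear_variance: "expectation (\<lambda>\<omega>. (\<Sum>x<m. a x * Y x \<omega>)\<^sup>2) = cov_form P a m"
proof -
  have "(\<Sum>x<m. a x * Y x \<omega>)\<^sup>2 = (\<Sum>x<m. \<Sum>y<m. (a x * a y) * (Y x \<omega> * Y y \<omega>))" for \<omega>
    unfolding power2_eq_square sum_product by (intro sum.cong) auto
  then have "expectation (\<lambda>\<omega>. (\<Sum>x<m. a x * Y x \<omega>)\<^sup>2) =
      (\<Sum>x<m. \<Sum>y<m. (a x * a y) * expectation (\<lambda>\<omega>. Y x \<omega> * Y y \<omega>))"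
    using Y_prod(1) by simp
  also have "\<dots> = (\<Sum>x<m. \<Sum>y<m. (if x = y then (a x * a y) * pmf P x else 0) - (a x * pmf P x) * (a y * pmf P y))"
    unfolding Y_prod(2) by (intro sum.cong) (auto simp: algebra_simps)
  also have "\<dots> = (\<Sum>x<m. (a x)\<^sup>2 * pmf P x) - (\<Sum>x<m. a x * pmf P x) * (\<Sum>y<m. a y * pmf P y)"
    by (simp add: sum_subtractf sum_product power2_eq_square)
  finally show ?thesis by (simp add: cov_form_def power2_eq_square)
qed

lemma Y_cos: "expectation (\<lambda>\<omega>. cos ((\<Sum>x<m. a x * Y x \<omega>) + \<theta>)) = exp (- cov_form P a m / 2) * cos \<theta>"
  by (rule gaussian_rv_cos[OF linear_gaussian linear_mean linear_variance])

lemma linear_lower_tail: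
  "cov_form P a m > 0 \<Longrightarrow> prob {\<omega> \<in> space N. (\<Sum>x<m. a x * Y x \<omega>) < c} > 0"
  by (rule gaussian_rv_lower_tail[OF linear_gaussian linear_mean linear_variance])

lemma Y_sq: "expectation (\<lambda>\<omega>. (Y x \<omega>)\<^sup>2) = pmf P x * (1 - pmf P x)"
  using Y_prod(2)[of x x] by (simp add: power2_eq_square algebra_simps)

sublocale sq_bounded N "\<lambda>\<omega> x. Y x \<omega>" "pmf P"
proof unfold_locales
  show "sq_summable (\<lambda>x. Y x \<omega>)" if "\<omega> \<in> space N" for \<omega>
    using limit that by (simp add: limit_process_def)
  show "expectation (\<lambda>\<omega>. (Y x \<omega>)\<^sup>2) \<le> pmf P x" for x
    unfolding Y_sq by (simp add: mult_left_le pmf_le_1)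
qed (use Y_square pmf_nat_sums in auto)

lemma l2_Y_second_moment:
  "integrable N (\<lambda>\<omega>. (l2 (\<lambda>x. Y x \<omega>))\<^sup>2)"
  "expectation (\<lambda>\<omega>. (l2 (\<lambda>x. Y x \<omega>))\<^sup>2) = (\<Sum>x. pmf P x * (1 - pmf P x))"
proof -
  have eq: "(l2 (\<lambda>x. Y x \<omega>))\<^sup>2 = (\<Sum>x. (Y x \<omega>)\<^sup>2)" if "\<omega> \<in> space N" for \<omega>
    by (rule l2_sq[OF sq[OF that]])
  have 1: "AE \<omega> in N. summable (\<lambda>x. norm ((Y x \<omega>)\<^sup>2))" using sq by (intro AE_I2) simp
  have 2: "summable (\<lambda>x. expectation (\<lambda>\<omega>. norm ((Y x \<omega>)\<^sup>2)))"
    by (rule summable_comparison_test'[OF pmf_nat_sums(1)[of P]]) (use sq_int in simp)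
  have "integrable N (\<lambda>\<omega>. \<Sum>x. (Y x \<omega>)\<^sup>2)" by (rule integrable_suminf[OF sq_int(1) 1 2])
  then show "integrable N (\<lambda>\<omega>. (l2 (\<lambda>x. Y x \<omega>))\<^sup>2)"
    by (subst Bochner_Integration.integrable_cong[OF refl eq]) auto
  have "expectation (\<lambda>\<omega>. (l2 (\<lambda>x. Y x \<omega>))\<^sup>2) = expectation (\<lambda>\<omega>. \<Sum>x. (Y x \<omega>)\<^sup>2)"
    by (rule Bochner_Integration.integral_cong[OF refl eq])
  also have "\<dots> = (\<Sum>x. expectation (\<lambda>\<omega>. (Y x \<omega>)\<^sup>2))"
    by (rule integral_suminf[OF sq_int(1) 1 2])
  finally show "expectation (\<lambda>\<omega>. (l2 (\<lambda>x. Y x \<omega>))\<^sup>2) = (\<Sum>x. pmf P x * (1 - pmf P x))"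
    by (simp add: Y_sq)
qed

end

section \<open>Comparison of laws through Lipschitz functionals\<close>

lemma l2_lipschitz_l2: "l2_lipschitz 1 l2"
proof -
  have "\<bar>l2 z - l2 z'\<bar> \<le> l2 (\<lambda>x. z x - z' x)" if "sq_summable z" "sq_summable z'" for z z'
    using lnorm_diff_le[OF that, of 2] unfolding lnorm_2[OF that(1)] lnorm_2[OF that(2)] by simp
  then show ?thesis by (simp add: l2_lipschitz_def)
qed

lemma sq_bounded_mono:
  assumes "sq_bounded M Z v" "summable v'" "\<And>x. v x \<le> v' x"
  shows "sq_bounded M Z v'"
proof -
  interpret sq_bounded M Z v by fact
  show ?thesis 
    by unfold_locales (use meas sq sq_int(1) assms(2) order_trans[OF sq_int(2) assms(3)] in simp_all)
qed

text \<open>The limit theorem for a constant sequence: cosines of linear forms determine the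
  expectations of bounded Lipschitz functionals.\<close>

lemma lipschitz_expectation_eq:
  assumes Z: "sq_bounded M Z v" and W: "sq_bounded N W v"
    and cos: "\<And>m a \<theta>. (\<integral>\<omega>. cos ((\<Sum>x<m. a x * Z \<omega> x) + \<theta>) \<partial>M) = (\<integral>\<omega>. cos ((\<Sum>x<m. a x * W \<omega> x) + \<theta>) \<partial>N)"
    and f: "l2_lipschitz C f" "\<And>z. \<bar>f z\<bar> \<le> B" "0 \<le> C"
  shows "(\<integral>\<omega>. f (Z \<omega>) \<partial>M) = (\<integral>\<omega>. f (W \<omega>) \<partial>N)"
proof -
  have "(\<lambda>n::nat. \<integral>\<omega>. f (Z \<omega>) \<partial>M) \<longlonglongrightarrow> (\<integral>\<omega>. f (W \<omega>) \<partial>N)"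
    by (rule lipschitz_weak_limit[OF Z W _ f]) (simp add: cos)
  then show ?thesis by (simp add: LIMSEQ_const_iff)
qed

lemma expectation_pos:
  fixes f :: "'c \<Rightarrow> real"
  assumes f: "integrable M' f" "\<And>\<omega>. \<omega> \<in> space M' \<Longrightarrow> 0 \<le> f \<omega>"
    and A: "A \<in> sets M'" "emeasure M' A \<noteq> 0" "\<And>\<omega>. \<omega> \<in> A \<Longrightarrow> 0 < f \<omega>"
  shows "0 < (\<integral>\<omega>. f \<omega> \<partial>M')"
proof (rule ccontr)
  have nn: "AE \<omega> in M'. 0 \<le> f \<omega>" using f(2) by (rule AE_I2)
  assume "\<not> 0 < (\<integral>\<omega>. f \<omega> \<partial>M')"
  then have "(\<integral>\<omega>. f \<omega> \<partial>M') = 0" using integral_nonneg_AE[OF nn] by simp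
  then have "AE \<omega> in M'. f \<omega> = 0" using integral_nonneg_eq_0_iff_AE[OF f(1) nn] by simp
  then have "AE \<omega> in M'. \<omega> \<notin> A" by eventually_elim (use A(3) in force)
  then have "emeasure M' A = 0" using A(1) sets.sets_into_space[OF A(1)]
    by (subst (asm) AE_iff_measurable[of A]) auto
  then show False using A(2) by simp
qed

text \<open>Makes a Lipschitz \<open>h\<close> bounded without changing the set where it is
  positive, so that positive probability of that set can be read off an expectation.\<close>

definition cutoff :: "((nat \<Rightarrow> real) \<Rightarrow> real) \<Rightarrow> (nat \<Rightarrow> real) \<Rightarrow> real" where
  "cutoff h z = min 1 (max 0 (h z))"

lemma cutoff_props: "0 \<le> cutoff h z" "\<bar>cutoff h z\<bar> \<le> 1" "0 < cutoff h z \<longleftrightarrow> 0 < h z"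
  by (auto simp: cutoff_def)

lemma cutoff_lipschitz: "l2_lipschitz C h \<Longrightarrow> l2_lipschitz C (cutoff h)"
  unfolding l2_lipschitz_def
proof (intro allI impI)
  fix z z' :: "nat \<Rightarrow> real"
  assume h: "\<forall>z z'. sq_summable z \<longrightarrow> sq_summable z' \<longrightarrow> \<bar>h z - h z'\<bar> \<le> C * l2 (\<lambda>x. z x - z' x)"
    and "sq_summable z" "sq_summable z'"
  then have "\<bar>h z - h z'\<bar> \<le> C * l2 (\<lambda>x. z x - z' x)" by blast
  moreover have "\<bar>cutoff h z - cutoff h z'\<bar> \<le> \<bar>h z - h z'\<bar>"
    by (auto simp: cutoff_def min_def max_def)
  ultimately show "\<bar>cutoff h z - cutoff h z'\<bar> \<le> C * l2 (\<lambda>x. z x - z' x)" by linarith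
qed

text \<open>Separability in a form ready for use: the lists are countably many, and they will be the
  centres of a countable cover by balls.\<close>

lemma rational_dense:
  assumes z: "sq_summable z" and e: "\<epsilon> > 0"
  shows "\<exists>qs :: rat list. l2 (\<lambda>x. z x - extend_zero (map of_rat qs) x) < \<epsilon>"
proof -
  have "\<forall>\<^sub>F m in sequentially. l2 (\<lambda>x. z x - trunc m z x) < \<epsilon> / 2"
    using l2_tail_tendsto_0[OF z] e by (intro order_tendstoD(2)) auto
  then obtain m where m: "l2 (\<lambda>x. z x - trunc m z x) < \<epsilon> / 2" 
    unfolding eventually_sequentially by blast
  \<comment> \<open>With \<open>m\<close> entries off by less than \<open>d\<close> each, the error
    is at most \<open>m * d < \<epsilon> / 2\<close>; the added one covers
    \<open>m = 0\<close>.\<close>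
  define d where "d = \<epsilon> / (2 * (real m + 1))"
  have d: "d > 0" using e by (simp add: d_def)
  have "\<exists>q. \<bar>z x - real_of_rat q\<bar> < d" for x
  proof -
    obtain q where "z x - d < real_of_rat q" "real_of_rat q < z x + d"
      using of_rat_dense[of "z x - d" "z x + d"] d by auto
    then show ?thesis by (intro exI[of _ q]) (simp add: abs_less_iff)
  qed
  then obtain Q where Q: "\<And>x. \<bar>z x - real_of_rat (Q x)\<bar> < d" by metis
  define c where "c = extend_zero (map of_rat (map Q [0..<m]))"
  have c: "c x = (if x < m then of_rat (Q x) else 0)" for x by (simp add: c_def extend_zero_def)
  have sc: "sq_summable c" by (rule sq_summable_finite_support[of m]) (simp add: c)
  have "l2 (\<lambda>x. trunc m z x - c x) \<le> m * d"
  proof -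
    have "l2 (\<lambda>x. trunc m z x - c x) = sqrt (\<Sum>x<m. (z x - of_rat (Q x))\<^sup>2)"
      unfolding l2_def by (subst suminf_finite[of "{..<m}"]) (auto simp: trunc_def c)
    also have "\<dots> \<le> (\<Sum>x<m. \<bar>z x - of_rat (Q x)\<bar>)"
      using L2_set_le_sum_abs[of "\<lambda>x. z x - of_rat (Q x)" "{..<m}"] by (simp add: L2_set_def)
    also have "\<dots> \<le> (\<Sum>x<m. d)" using Q by (intro sum_mono less_imp_le)
    finally show ?thesis by simp
  qed
  also have "m * d < \<epsilon> / 2" using e by (simp add: d_def field_simps)
  finally have 2: "l2 (\<lambda>x. trunc m z x - c x) < \<epsilon> / 2" .
  have "l2 (\<lambda>x. (z x - trunc m z x) + (trunc m z x - c x)) \<le> l2 (\<lambda>x. z x - trunc m z x) + l2 (\<lambda>x. trunc m z x - c x)"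
    by (rule l2_triangle) (intro sq_summable_diff z sc sq_summable_trunc)+
  then have "l2 (\<lambda>x. z x - c x) < \<epsilon>" using m 2 by simp
  then show ?thesis unfolding c_def by blast
qed

section \<open>Independent copies and small balls\<close>

context gaussian_limit
begin

abbreviation NN :: "('b \<times> 'b) measure" where "NN \<equiv> N \<Otimes>\<^sub>M N"

lemma N_sf: "sigma_finite_measure N" ..

lemma prob_space_NN: "prob_space NN"
proof -
  interpret pair_prob_space N N ..
  show ?thesis by (rule P.prob_space_axioms)
qed

lemma measurable_fst_snd:
  assumes "f \<in> borel_measurable N"
  shows "(\<lambda>q. f (fst q)) \<in> borel_measurable NN" "(\<lambda>q. f (snd q)) \<in> borel_measurable NN"
  using assms by measurable

lemma integral_fst_snd:
  fixes f :: "'b \<Rightarrow> real"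
  assumes f: "integrable N f"
  shows "integrable NN (\<lambda>q. f (fst q))" "(\<integral>q. f (fst q) \<partial>NN) = expectation f"
    "integrable NN (\<lambda>q. f (snd q))" "(\<integral>q. f (snd q) \<partial>NN) = expectation f"
proof -
  have d1: "distr NN N fst = N" by (rule prob_space.distr_pair_fst[OF prob_space_axioms])
  interpret pair_prob_space N N ..
  have d2: "distr NN N snd = N"
  proof -
    have "distr NN N snd = distr (distr NN NN (\<lambda>(x, y). (y, x))) N fst"
      by (subst distr_distr) (auto simp: comp_def case_prod_beta)
    then show ?thesis by (simp add: distr_pair_swap[symmetric] d1)
  qed
  have m: "f \<in> borel_measurable N" using f by simp
  show "integrable NN (\<lambda>q. f (fst q))"
    using integrable_distr[of fst NN N f] f d1 by simp
  show "integrable NN (\<lambda>q. f (snd q))"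
    using integrable_distr[of snd NN N f] f d2 by simp
  show "(\<integral>q. f (fst q) \<partial>NN) = (\<integral>\<omega>. f \<omega> \<partial>N)"
    using integral_distr[of fst NN N f] m d1 by simp
  show "(\<integral>q. f (snd q) \<partial>NN) = (\<integral>\<omega>. f \<omega> \<partial>N)"
    using integral_distr[of snd NN N f] m d2 by simp
qed

lemma pair_cos:
  "(\<integral>q. cos ((\<Sum>x<m. a x * Y x (fst q)) + (\<Sum>x<l. b x * Y x (snd q)) + \<theta>) \<partial>NN) =
    exp (- (cov_form P a m + cov_form P b l) / 2) * cos \<theta>"
proof -
  interpret pair_prob_space N N ..
  let ?A = "\<lambda>\<omega>. \<Sum>x<m. a x * Y x \<omega>" and ?B = "\<lambda>\<omega>. \<Sum>x<l. b x * Y x \<omega>"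
  have mA: "?A \<in> borel_measurable N" and mB: "?B \<in> borel_measurable N"
    using meas by (auto intro!: borel_measurable_sum borel_measurable_times)
  have "(\<lambda>q. cos (?A (fst q) + ?B (snd q) + \<theta>)) \<in> borel_measurable NN"
    using measurable_fst_snd(1)[OF mA] measurable_fst_snd(2)[OF mB] by measurable
  then have i: "integrable NN (\<lambda>q. cos (?A (fst q) + ?B (snd q) + \<theta>))"
    by (intro P.integrable_const_bound[of _ 1]) auto
  have "(\<integral>q. cos (?A (fst q) + ?B (snd q) + \<theta>) \<partial>NN) = (\<integral>\<omega>. (\<integral>\<omega>'. cos (?A \<omega> + ?B \<omega>' + \<theta>) \<partial>N) \<partial>N)"
    using integral_fst'[OF i] by simp
  also have "\<dots> = (\<integral>\<omega>. exp (- cov_form P b l / 2) * cos (?A \<omega> + \<theta>) \<partial>N)"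
  proof (rule Bochner_Integration.integral_cong[OF refl])
    fix \<omega>
    show "(\<integral>\<omega>'. cos (?A \<omega> + ?B \<omega>' + \<theta>) \<partial>N) = exp (- cov_form P b l / 2) * cos (?A \<omega> + \<theta>)"
      using Y_cos[where a = b and m = l and \<theta> = "?A \<omega> + \<theta>"] by (simp add: add.commute add.left_commute)
  qed
  also have "\<dots> = exp (- cov_form P b l / 2) * (exp (- cov_form P a m / 2) * cos \<theta>)"
    using Y_cos[where a = a and m = m and \<theta> = \<theta>] by simp
  also have "\<dots> = exp (- (cov_form P a m + cov_form P b l) / 2) * cos \<theta>"
    by (simp add: exp_add[symmetric] add_divide_distrib diff_divide_distrib add.commute)
  finally show ?thesis .
qed

lemma expectation_pos_imp:
  fixes f :: "'b \<Rightarrow> real"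
  assumes pos: "0 < (\<integral>\<omega>. f \<omega> \<partial>N)" and f: "f \<in> borel_measurable N" "\<And>\<omega>. \<omega> \<in> space N \<Longrightarrow> 0 \<le> f \<omega>"
  shows "0 < prob {\<omega> \<in> space N. 0 < f \<omega>}"
proof (rule ccontr)
  have [measurable]: "f \<in> borel_measurable N" by (rule f(1))
  have S: "{\<omega> \<in> space N. 0 < f \<omega>} \<in> events" by measurable
  assume "\<not> ?thesis"
  then have "prob {\<omega> \<in> space N. 0 < f \<omega>} = 0" by (simp add: zero_less_measure_iff)
  then have "AE \<omega> in N. \<omega> \<notin> {\<omega> \<in> space N. 0 < f \<omega>}" using prob_eq_0[OF S] by simp
  then have "AE \<omega> in N. f \<omega> = 0" using AE_space by eventually_elim (use f(2) in force)
  then have "(\<integral>\<omega>. f \<omega> \<partial>N) = (\<integral>\<omega>. 0 \<partial>N)" using f(1) by (intro integral_cong_AE) auto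
  then show False using pos by simp
qed

lemma lipschitz_Y_measurable: "l2_lipschitz C h \<Longrightarrow> (\<lambda>\<omega>. h (\<lambda>x. Y x \<omega>)) \<in> borel_measurable N"
  using l2_lipschitz_measurable[OF meas sq] by blast

text \<open>By \<open>lin\<close> a linear form in \<open>Z\<close> splits into forms in two
  independent copies whose variances add up to that of the same form in the process. Hence
  \<open>Z\<close> and the process agree on Lipschitz functionals, and an event exhibited on the
  product space has positive probability for the process itself. \<open>v\<close> may exceed
  \<open>pmf P\<close>, so crude moment bounds on \<open>Z\<close> will do.\<close>

lemma transfer_positive:
  assumes Z: "sq_bounded NN Z v" "\<And>x. pmf P x \<le> v x"
    and lin: "\<And>m a. \<exists>l b c. (\<forall>q. (\<Sum>x<m. a x * Z q x) = (\<Sum>x<l. b x * Y x (fst q)) + (\<Sum>x<l. c x * Y x (snd q)))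
      \<and> cov_form P b l + cov_form P c l = cov_form P a m"
    and h: "l2_lipschitz C h" "0 \<le> C"
    and A: "A \<in> sets NN" "emeasure NN A \<noteq> 0" "\<And>q. q \<in> A \<Longrightarrow> 0 < h (Z q)"
  shows "0 < prob {\<omega> \<in> space N. 0 < h (\<lambda>x. Y x \<omega>)}"
proof -
  interpret Z: sq_bounded NN Z v by fact
  note l = cutoff_lipschitz[OF h(1)]
  have m: "(\<lambda>q. cutoff h (Z q)) \<in> borel_measurable NN"
    by (rule l2_lipschitz_measurable[OF Z.meas Z.sq l])
  have cos: "(\<integral>q. cos ((\<Sum>x<m. a x * Z q x) + \<theta>) \<partial>NN) = (\<integral>\<omega>. cos ((\<Sum>x<m. a x * Y x \<omega>) + \<theta>) \<partial>N)" for m a \<theta>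
  proof -
    obtain l b c where e: "\<And>q. (\<Sum>x<m. a x * Z q x) = (\<Sum>x<l. b x * Y x (fst q)) + (\<Sum>x<l. c x * Y x (snd q))"
      and V: "cov_form P b l + cov_form P c l = cov_form P a m" using lin by blast
    show ?thesis unfolding e pair_cos V Y_cos ..
  qed
  have "0 < (\<integral>q. cutoff h (Z q) \<partial>NN)"
  proof (rule expectation_pos[OF _ _ A(1,2)])
    show "integrable NN (\<lambda>q. cutoff h (Z q))"
      by (rule Z.integrable_const_bound[of _ 1]) (use m cutoff_props(2) in auto)
  qed (use A cutoff_props in auto)
  also have "(\<integral>q. cutoff h (Z q) \<partial>NN) = (\<integral>\<omega>. cutoff h (\<lambda>x. Y x \<omega>) \<partial>N)"
    by (rule lipschitz_expectation_eq[OF Z(1) sq_bounded_mono[OF sq_bounded_axioms Z.v Z(2)] cos l cutoff_props(2) h(2)])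
  finally have "0 < prob {\<omega> \<in> space N. 0 < cutoff h (\<lambda>x. Y x \<omega>)}"
    by (rule expectation_pos_imp) (use lipschitz_Y_measurable[OF l] cutoff_props in auto)
  then show ?thesis unfolding cutoff_props(3) .
qed

text \<open>Countably many balls cover the space, so not all of them are null. Nothing is known
  about the centre found.\<close>

lemma shifted_ball:
  assumes e: "\<epsilon> > 0"
  shows "\<exists>c. sq_summable c \<and> {\<omega> \<in> space N. l2 (\<lambda>x. Y x \<omega> - c x) < \<epsilon>} \<in> sets N
    \<and> emeasure N {\<omega> \<in> space N. l2 (\<lambda>x. Y x \<omega> - c x) < \<epsilon>} \<noteq> 0"
proof (rule ccontr)
  define c where "c qs = extend_zero (map real_of_rat qs)" for qs
  define B where "B qs = {\<omega> \<in> space N. l2 (\<lambda>x. Y x \<omega> - c qs x) < \<epsilon>}" for qs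
  have sc: "sq_summable (c qs)" for qs
    by (rule sq_summable_finite_support[of "length qs"]) (simp add: c_def extend_zero_def)
  have l: "l2_lipschitz 1 (\<lambda>z. l2 (\<lambda>x. z x - c qs x))" for qs
    unfolding l2_lipschitz_def
  proof (intro allI impI)
    fix z z' :: "nat \<Rightarrow> real" assume s: "sq_summable z" "sq_summable z'"
    have "\<bar>l2 (\<lambda>x. z x - c qs x) - l2 (\<lambda>x. z' x - c qs x)\<bar> \<le> 1 * l2 (\<lambda>x. (z x - c qs x) - (z' x - c qs x))"
      by (rule l2_lipschitz_l2[unfolded l2_lipschitz_def, rule_format, OF sq_summable_diff[OF s(1) sc]
            sq_summable_diff[OF s(2) sc]])
    then show "\<bar>l2 (\<lambda>x. z x - c qs x) - l2 (\<lambda>x. z' x - c qs x)\<bar> \<le> 1 * l2 (\<lambda>x. z x - z' x)" by simp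
  qed
  have B: "B qs \<in> sets N" for qs
    unfolding B_def using lipschitz_Y_measurable[OF l] by measurable
  assume "\<not> ?thesis"
  then have "emeasure N (B qs) = 0" for qs using sc[of qs] B[of qs] unfolding B_def by blast
  then have "(\<Union>qs. B qs) \<in> null_sets N" using B by (intro null_sets_UN) auto
  moreover have "(\<Union>qs. B qs) = space N"
    using rational_dense[OF sq e] by (auto simp: B_def c_def)
  ultimately show False using emeasure_space_1 by (simp add: null_sets_def)
qed

text \<open>Symmetrisation removes the unknown centre \<open>c\<close>: the difference of two
  independent copies, divided by \<open>sqrt 2\<close>, has the law of the process, and it has norm
  below \<open>\<epsilon>\<close> if both copies lie within \<open>\<epsilon> / 2\<close> of
  \<open>c\<close>.\<close>

lemma small_ball:
  assumes e: "\<epsilon> > 0" shows "0 < prob {\<omega> \<in> space N. l2 (\<lambda>x. Y x \<omega>) < \<epsilon>}"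
proof -
  interpret pair_prob_space N N ..
  obtain c where c: "sq_summable c" and "{\<omega> \<in> space N. l2 (\<lambda>x. Y x \<omega> - c x) < \<epsilon> / 2} \<in> sets N"
    "emeasure N {\<omega> \<in> space N. l2 (\<lambda>x. Y x \<omega> - c x) < \<epsilon> / 2} \<noteq> 0"
    using shifted_ball[of "\<epsilon> / 2"] e by auto
  then obtain B where B: "B \<in> sets N" "emeasure N B \<noteq> 0"
    and BI: "\<And>\<omega>. \<omega> \<in> B \<Longrightarrow> \<omega> \<in> space N \<and> l2 (\<lambda>x. Y x \<omega> - c x) < \<epsilon> / 2" by blast
  define t where "t = 1 / sqrt 2"
  have t: "t\<^sup>2 = 1 / 2" "0 < t" "t \<le> 1" by (auto simp: t_def power_divide)
  define Z where "Z q x = t * Y x (fst q) - t * Y x (snd q)" for q x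
  have "0 < measure N {\<omega> \<in> space N. 0 < \<epsilon> - l2 (\<lambda>x. Y x \<omega>)}"
  proof (rule transfer_positive[where Z = Z and v = "\<lambda>x. 2 * pmf P x" and C = 1 and A = "B \<times> B" and h = "\<lambda>z. \<epsilon> - l2 z"])
    have Zm: "(\<lambda>q. Z q x) \<in> borel_measurable NN" for x
      unfolding Z_def using measurable_fst_snd[OF meas[of x]] by simp
    have sqZ: "(Z q x)\<^sup>2 \<le> (Y x (fst q))\<^sup>2 + (Y x (snd q))\<^sup>2" for q x
    proof -
      have "(Z q x)\<^sup>2 = t\<^sup>2 * (Y x (fst q) - Y x (snd q))\<^sup>2"
        by (simp add: Z_def right_diff_distrib[symmetric] power_mult_distrib)
      then have "(Z q x)\<^sup>2 = (Y x (fst q) - Y x (snd q))\<^sup>2 / 2" by (simp only: t(1))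
      moreover have "0 \<le> (Y x (fst q) + Y x (snd q))\<^sup>2" by simp
      moreover have "(u - v)\<^sup>2 / 2 + (u + v)\<^sup>2 / 2 = u\<^sup>2 + v\<^sup>2" for u v :: real
        by (simp add: power2_eq_square field_simps)
      ultimately show ?thesis by (smt (verit) divide_nonneg_pos)
    qed
    show "sq_bounded NN Z (\<lambda>x. 2 * pmf P x)"
    proof unfold_locales
      show "(\<lambda>q. Z q x) \<in> borel_measurable NN" for x by (rule Zm)
      show "sq_summable (Z q)" if "q \<in> space NN" for q
      proof -
        have "fst q \<in> space N" "snd q \<in> space N" using that by (auto simp: space_pair_measure)
        then show ?thesis unfolding Z_def by (intro sq_summable_diff sq_summable_cmult sq)
      qed
      show "summable (\<lambda>x. 2 * pmf P x)" by (intro summable_mult pmf_nat_sums)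
      show iZ: "integrable NN (\<lambda>q. (Z q x)\<^sup>2)" for x
        by (rule Bochner_Integration.integrable_bound[OF Bochner_Integration.integrable_add[OF
              integral_fst_snd(1)[OF sq_int(1)[of x]] integral_fst_snd(3)[OF sq_int(1)[of x]]]])
           (use Zm sqZ in auto)
      show "(\<integral>q. (Z q x)\<^sup>2 \<partial>NN) \<le> 2 * pmf P x" for x
      proof -
        have "(\<integral>q. (Z q x)\<^sup>2 \<partial>NN) \<le> (\<integral>q. (Y x (fst q))\<^sup>2 + (Y x (snd q))\<^sup>2 \<partial>NN)"
          using integral_fst_snd[OF sq_int(1)[of x]] iZ sqZ by (intro integral_mono) auto
        also have "\<dots> = 2 * (\<integral>\<omega>. (Y x \<omega>)\<^sup>2 \<partial>N)" using integral_fst_snd[OF sq_int(1)[of x]] by simp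
        also have "\<dots> \<le> 2 * pmf P x" using sq_int(2)[of x] by simp
        finally show ?thesis .
      qed
    qed
    show "pmf P x \<le> 2 * pmf P x" for x by simp
    fix m and a :: "nat \<Rightarrow> real"
    show "\<exists>l b c. (\<forall>q. (\<Sum>x<m. a x * Z q x) = (\<Sum>x<l. b x * Y x (fst q)) + (\<Sum>x<l. c x * Y x (snd q)))
      \<and> cov_form P b l + cov_form P c l = cov_form P a m"
    proof (intro exI conjI allI)
      show "(\<Sum>x<m. a x * Z q x) = (\<Sum>x<m. (t * a x) * Y x (fst q)) + (\<Sum>x<m. (- t * a x) * Y x (snd q))" for q
        unfolding Z_def sum.distrib[symmetric] by (intro sum.cong) (auto simp: algebra_simps)
      have "cov_form P (\<lambda>x. s * a x) m = s\<^sup>2 * cov_form P a m" for s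
        by (simp add: cov_form_def power_mult_distrib mult.assoc sum_distrib_left[symmetric] right_diff_distrib)
      from this[of t] this[of "- t"]
      show "cov_form P (\<lambda>x. t * a x) m + cov_form P (\<lambda>x. - t * a x) m = cov_form P a m"
        by (simp add: t(1))
    qed
  next
    have l: "l2_lipschitz C h \<Longrightarrow> l2_lipschitz C (\<lambda>z. \<epsilon> - h z)" for C h
      by (simp add: l2_lipschitz_def abs_minus_commute)
    show "l2_lipschitz 1 (\<lambda>z. \<epsilon> - l2 z)" by (rule l[OF l2_lipschitz_l2])
    show "B \<times> B \<in> sets NN" using B by auto
    show "emeasure NN (B \<times> B) \<noteq> 0" 
      using B(2) by (subst sigma_finite_measure.emeasure_pair_measure_Times[OF N_sf B(1) B(1)]) simp
    fix q assume "q \<in> B \<times> B"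
    then have q: "fst q \<in> B" "snd q \<in> B" by auto
    let ?u = "\<lambda>x. Y x (fst q) - c x" and ?v = "\<lambda>x. Y x (snd q) - c x"
    have s: "sq_summable ?u" "sq_summable ?v" using q BI sq c by (auto intro!: sq_summable_diff)
    have "l2 (Z q) = l2 (\<lambda>x. t * (?u x - ?v x))"
      by (intro arg_cong[where f = l2]) (auto simp: Z_def algebra_simps)
    also have "\<dots> \<le> l2 (\<lambda>x. ?u x - ?v x)"
      using t by (intro l2_mono(2) sq_summable_diff s) (auto simp: abs_mult mult_left_le_one_le)
    also have "\<dots> \<le> l2 ?u + l2 (\<lambda>x. - ?v x)"
    proof -
      have "sq_summable (\<lambda>x. - ?v x)" using s(2) by (simp only: power2_minus)
      from l2_triangle[OF s(1) this] show ?thesis by simp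
    qed
    also have "l2 (\<lambda>x. - ?v x) = l2 ?v" by (simp add: l2_def power2_commute)
    also have "l2 ?u + l2 ?v < \<epsilon>" using BI[OF q(1)] BI[OF q(2)] by simp
    finally show "0 < \<epsilon> - l2 (Z q)" by simp
  qed simp
  then show ?thesis by simp
qed

end

section \<open>Averaging two entries of a flat block, and strict inequality\<close>

text \<open>The orthogonal projection onto the sequences that agree at \<open>r\<close> and
  \<open>Suc r\<close>; what it removes is determined by the difference of these two
  entries.\<close>

definition avg :: "nat \<Rightarrow> (nat \<Rightarrow> real) \<Rightarrow> nat \<Rightarrow> real" where
  "avg r z x = (if x = r \<or> x = Suc r then (z r + z (Suc r)) / 2 else z x)"

lemma avg_l2:
  assumes "sq_summable z" shows "sq_summable (avg r z)" "l2 (avg r z) \<le> l2 z"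
proof -
  have eq: "avg r z x = z x" if "x \<ge> Suc (Suc r)" for x using that by (simp add: avg_def)
  have "(\<Sum>x<r. (avg r z x)\<^sup>2) = (\<Sum>x<r. (z x)\<^sup>2)" by (intro sum.cong) (auto simp: avg_def)
  moreover have "(avg r z r)\<^sup>2 + (avg r z (Suc r))\<^sup>2 \<le> (z r)\<^sup>2 + (z (Suc r))\<^sup>2"
  proof -
    have "0 \<le> (z r - z (Suc r))\<^sup>2" by simp
    then show ?thesis by (simp add: avg_def power2_eq_square field_simps)
  qed
  ultimately have le: "(\<Sum>x<Suc (Suc r). (avg r z x)\<^sup>2) \<le> (\<Sum>x<Suc (Suc r). (z x)\<^sup>2)" by simp
  from sq_le_extend[OF eq assms le] show "sq_summable (avg r z)" "l2 (avg r z) \<le> l2 z" by auto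
qed

lemma avg_diff: "avg r z x - avg r z' x = avg r (\<lambda>x. z x - z' x) x"
  by (simp add: avg_def diff_divide_distrib add_divide_distrib)

text \<open>Only the partial sum that separates the two averaged entries changes.\<close>

lemma sum_avg:
  "sum z {..<t} = sum (avg r z) {..<t} + (if t = Suc r then (z r - z (Suc r)) / 2 else 0)"
proof (induction t)
  case (Suc t)
  then show ?case by (auto simp: avg_def field_simps)
qed simp

text \<open>The partial sum between the two averaged entries stays below the majorant.\<close>

lemma gren_blocks_avg:
  assumes p: "monotone_decreasing p" "\<And>x. 0 \<le> p x" "p \<longlonglongrightarrow> 0"
    and r: "flat p r" and z: "z r \<le> z (Suc r)"
  shows "gren_blocks p z x = gren_blocks p (avg r z) x"
proof -
  obtain M where M: "M \<ge> Suc (Suc r) + Suc x" and k: "\<And>z. kkt (flat p) z (gren_blocks p z) M"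
    using kkt_gren_blocks_cofinal[OF p] by blast
  define g where "g = gren_blocks p (avg r z)"
  define w where "w = avg r z"
  have kw: "kkt (flat p) w g M" unfolding w_def g_def by (rule k)
  have Wle: "sum w {..<t} \<le> sum g {..<t}" if "t \<le> M" for t using kw that by (simp add: kkt_def)
  have zw: "sum z {..<t} = sum w {..<t}" if "t \<noteq> Suc r" for t using sum_avg[of z t r] that by (simp add: w_def)
  have zw': "sum z {..<t} \<le> sum w {..<t}" for t using sum_avg[of z t r] z by (simp add: w_def)
  have dec: "g (Suc r) \<le> g r" using kw r M unfolding kkt_def by simp
  \<comment> \<open>The slopes tie even if there is contact at \<open>Suc r\<close>: contact gives
    \<open>g r \<le> w r\<close> and \<open>w (Suc r) \<le> g (Suc r)\<close>, the averaged entries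
    are equal, and \<open>g\<close> does not increase.\<close>
  have gr: "g (Suc r) = g r"
  proof (cases "sum w {..<Suc r} < sum g {..<Suc r}")
    case True
    then show ?thesis using kw M unfolding kkt_def by simp
  next
    case False
    then have eq: "sum w {..<Suc r} = sum g {..<Suc r}" using Wle[of "Suc r"] M by simp
    have "g r \<le> w r" using eq Wle[of r] M by simp
    moreover have "w (Suc r) \<le> g (Suc r)" using eq Wle[of "Suc (Suc r)"] M by simp
    moreover have "w r = w (Suc r)" by (simp add: w_def avg_def)
    ultimately show ?thesis using dec by simp
  qed
  have "kkt (flat p) z g M"
    unfolding kkt_def
  proof (intro conjI allI impI)
    show "sum z {..<t} \<le> sum g {..<t}" if "t \<le> M" for t using zw'[of t] Wle[OF that] by simp
    show "sum g {..<M} = sum z {..<M}" using zw[of M] M kw by (simp add: kkt_def)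
    fix t assume t: "Suc t < M"
    show "g (Suc t) \<le> g t" if "flat p t" using kw t that unfolding kkt_def by blast
    assume lt: "sum z {..<Suc t} < sum g {..<Suc t}"
    have "flat p t \<and> g (Suc t) = g t"
    proof (cases "t = r")
      case True
      then show ?thesis using r gr by simp
    next
      case False
      then have "sum w {..<Suc t} < sum g {..<Suc t}" using zw[of "Suc t"] lt by simp
      then show ?thesis using kw t unfolding kkt_def by blast
    qed
    then show "flat p t" "g (Suc t) = g t" by auto
  qed
  from kkt_unique[OF k this, of x] show ?thesis using M by (simp add: g_def)
qed

lemma sum_split_pair:
  fixes f :: "nat \<Rightarrow> real"
  assumes "Suc r < l" shows "sum f {..<l} = f r + f (Suc r) + sum f ({..<l} - {r, Suc r})"
proof -
  have "sum f {..<l} = sum f {r, Suc r} + sum f ({..<l} - {r, Suc r})"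
    by (rule sum.subset_diff[of "{r, Suc r}", THEN trans]) (use assms in auto)
  then show ?thesis by simp
qed

lemma cov_form_extend: "m \<le> l \<Longrightarrow> cov_form P (\<lambda>x. if x < m then a x else 0) l = cov_form P a m"
proof -
  assume ml: "m \<le> l"
  have "(\<Sum>x<l. (if x < m then a x else 0)\<^sup>2 * pmf P x) = (\<Sum>x<m. (a x)\<^sup>2 * pmf P x)"
    using sum_extend_zero[OF ml, of "\<lambda>x. (a x)\<^sup>2" "pmf P"] by (simp add: if_distrib[of "\<lambda>u. u\<^sup>2"] cong: if_cong)
  then show ?thesis using sum_extend_zero[OF ml, of a "pmf P"] by (simp add: cov_form_def)
qed

lemma gren_blocks_lipschitz:
  assumes p: "monotone_decreasing p" "\<And>x. 0 \<le> p x" "p \<longlonglongrightarrow> 0" and k: "2 \<le> k"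
  shows "l2_lipschitz 1 (\<lambda>z. lnorm k (gren_blocks p z))"
  unfolding l2_lipschitz_def
proof (intro allI impI)
  fix z z' :: "nat \<Rightarrow> real" assume s: "sq_summable z" "sq_summable z'"
  have "\<bar>lnorm k (gren_blocks p z) - lnorm k (gren_blocks p z')\<bar> \<le> l2 (\<lambda>x. gren_blocks p z x - gren_blocks p z' x)"
    by (rule lnorm_diff_le[OF gren_blocks_l2(1)[OF p s(1)] gren_blocks_l2(1)[OF p s(2)] k])
  also have "\<dots> \<le> 1 * l2 (\<lambda>x. z x - z' x)"
    using gren_blocks_contraction(2)[OF p sq_summable_diff[OF s]] by simp
  finally show "\<bar>lnorm k (gren_blocks p z) - lnorm k (gren_blocks p z')\<bar> \<le> 1 * l2 (\<lambda>x. z x - z' x)" .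
qed

lemma lnorm_lipschitz: "2 \<le> k \<Longrightarrow> l2_lipschitz 1 (lnorm k)"
  using lnorm_diff_le by (simp add: l2_lipschitz_def)

context gaussian_limit
begin

abbreviation Yseq :: "'b \<Rightarrow> nat \<Rightarrow> real" where "Yseq \<omega> \<equiv> (\<lambda>x. Y x \<omega>)"

text \<open>The process is its average \<open>avg r\<close> plus a part \<open>T\<close> that
  carries the difference \<open>D\<close>. As \<open>pmf P\<close> agrees at \<open>r\<close> and
  \<open>Suc r\<close>, the two are uncorrelated, so the average from one copy and the difference
  from an independent copy recombine to the same law. On the product space the two requirements then
  concern different factors.\<close>

lemma avg_difference_event:
  assumes r: "flat (pmf P) r" and t: "t > 0"
  shows "0 < prob {\<omega> \<in> space N. l2 (avg r (Yseq \<omega>)) < t \<and> Y r \<omega> - Y (Suc r) \<omega> < - 2 * t}"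
proof -
  define D where "D \<omega> = Y r \<omega> - Y (Suc r) \<omega>" for \<omega>
  \<comment> \<open>Positive exactly when both requirements hold, and Lipschitz as a minimum of
    Lipschitz functionals.\<close>
  define h where "h z = min (t - l2 (avg r z)) (- 2 * t - (z r - z (Suc r)))" for z
  define T where "T \<omega> x = (if x = r then D \<omega> / 2 else if x = Suc r then - D \<omega> / 2 else 0)" for \<omega> x
  define Z where "Z q x = avg r (Yseq (fst q)) x + T (snd q) x" for q x
  define R where "R \<omega> = (Y r \<omega>)\<^sup>2 + (Y (Suc r) \<omega>)\<^sup>2" for \<omega>
  define B1 where "B1 = {\<omega> \<in> space N. l2 (avg r (Yseq \<omega>)) < t}"
  define B2 where "B2 = {\<omega> \<in> space N. D \<omega> < - 2 * t}"
  \<comment> \<open>At the two special positions the square of \<open>Z\<close> is dominated by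
    squares of \<open>Y r\<close> and \<open>Y (Suc r)\<close> from both copies, hence the extra
    term; elsewhere \<open>Z\<close> is the first copy.\<close>
  define v where "v x = pmf P x + (if x = r \<or> x = Suc r then 2 * (pmf P r + pmf P (Suc r)) else 0)" for x
  note Ym[measurable] = meas
  have Dm[measurable]: "D \<in> borel_measurable N" unfolding D_def[abs_def] by measurable
  have lavg: "l2_lipschitz 1 (\<lambda>z. l2 (avg r z))"
    unfolding l2_lipschitz_def
  proof (intro allI impI)
    fix z z' :: "nat \<Rightarrow> real" assume s: "sq_summable z" "sq_summable z'"
    have "\<bar>l2 (avg r z) - l2 (avg r z')\<bar> \<le> 1 * l2 (\<lambda>x. avg r z x - avg r z' x)"
      by (rule l2_lipschitz_l2[unfolded l2_lipschitz_def, rule_format, OF avg_l2(1)[OF s(1)] avg_l2(1)[OF s(2)]])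
    also have "l2 (\<lambda>x. avg r z x - avg r z' x) = l2 (avg r (\<lambda>x. z x - z' x))"
      by (rule arg_cong[where f = l2]) (rule ext, rule avg_diff)
    also have "1 * l2 (avg r (\<lambda>x. z x - z' x)) \<le> 1 * l2 (\<lambda>x. z x - z' x)"
      by (rule mult_left_mono[OF avg_l2(2)[OF sq_summable_diff[OF s]]]) simp
    finally show "\<bar>l2 (avg r z) - l2 (avg r z')\<bar> \<le> 1 * l2 (\<lambda>x. z x - z' x)" .
  qed
  have lh: "l2_lipschitz 2 h"
    unfolding l2_lipschitz_def
  proof (intro allI impI)
    fix z z' :: "nat \<Rightarrow> real" assume s: "sq_summable z" "sq_summable z'"
    let ?d = "l2 (\<lambda>x. z x - z' x)"
    have 1: "\<bar>l2 (avg r z) - l2 (avg r z')\<bar> \<le> ?d" using lavg s unfolding l2_lipschitz_def by simp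
    have 2: "\<bar>z x - z' x\<bar> \<le> ?d" for x using abs_le_l2[OF sq_summable_diff[OF s], of x] .
    have m: "\<bar>min a b - min a' b'\<bar> \<le> max \<bar>a - a'\<bar> \<bar>b - b'\<bar>" for a b a' b' :: real
      by (auto simp: min_def max_def)
    have "\<bar>h z - h z'\<bar> \<le> max \<bar>(t - l2 (avg r z)) - (t - l2 (avg r z'))\<bar>
        \<bar>(- 2 * t - (z r - z (Suc r))) - (- 2 * t - (z' r - z' (Suc r)))\<bar>"
      unfolding h_def by (rule m)
    also have "\<dots> \<le> 2 * ?d"
      using 1 2[of r] 2[of "Suc r"] by (auto simp: max_def abs_le_iff)
    finally show "\<bar>h z - h z'\<bar> \<le> 2 * ?d" .
  qed
  have B: "B1 \<in> sets N" "B2 \<in> sets N"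
    unfolding B1_def B2_def using lipschitz_Y_measurable[OF lavg] by measurable
  have "0 < prob {\<omega> \<in> space N. l2 (Yseq \<omega>) < t}" using small_ball[OF t] .
  also have "\<dots> \<le> prob B1"
    by (rule finite_measure_mono[OF _ B(1)]) (auto simp: B1_def intro: le_less_trans[OF avg_l2(2)[OF sq]])
  finally have B1pos: "emeasure N B1 \<noteq> 0" by (simp add: emeasure_eq_measure)
  let ?a = "\<lambda>x. if x = r then 1 else if x = Suc r then - 1 else (0::real)"
  have pr: "pmf P (Suc r) = pmf P r" "0 < pmf P r" using r by (auto simp: flat_def)
  have "(\<Sum>x<Suc (Suc r). ?a x * Y x \<omega>) = D \<omega>" for \<omega>
    by (simp add: sum_split_pair[of r] D_def)
  moreover have "cov_form P ?a (Suc (Suc r)) > 0"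
    using pr by (simp add: cov_form_def sum_split_pair[of r])
  ultimately have "prob B2 > 0"
    using linear_lower_tail[of ?a "Suc (Suc r)" "- 2 * t"] by (simp add: B2_def)
  then have B2pos: "emeasure N B2 \<noteq> 0" by (simp add: emeasure_eq_measure)
  have avgT: "avg r (Z q) = avg r (Yseq (fst q))" for q
    by (auto simp: avg_def Z_def T_def fun_eq_iff field_simps)
  have DZ: "Z q r - Z q (Suc r) = D (snd q)" for q by (simp add: Z_def T_def avg_def)
  have Rm: "integrable N R" unfolding R_def[abs_def] using sq_int by simp
  have ER: "expectation R \<le> pmf P r + pmf P (Suc r)"
    unfolding R_def using sq_int(1) sq_int(2)[of r] sq_int(2)[of "Suc r"] by simp
  let ?b = "\<lambda>q x. (Y x (fst q))\<^sup>2 + (if x = r \<or> x = Suc r then R (fst q) + R (snd q) else 0)"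
  have sqZ: "(Z q x)\<^sup>2 \<le> ?b q x" for q x
  proof (cases "x = r \<or> x = Suc r")
    case True
    have q4: "((u + w) / 2 + (s - y) / 2)\<^sup>2 \<le> u\<^sup>2 + w\<^sup>2 + (s\<^sup>2 + y\<^sup>2)" for u w s y :: real
    proof -
      \<comment> \<open>The six squares add up to four times the sum of the squares of
        \<open>u\<close>, \<open>w\<close>, \<open>s\<close>, \<open>y\<close> minus the square of
        \<open>u + w + s - y\<close>.\<close>
      have "0 \<le> (u - w)\<^sup>2 + (s + y)\<^sup>2 + (u - s)\<^sup>2 + (u + y)\<^sup>2 + (w - s)\<^sup>2 + (w + y)\<^sup>2" by simp
      then show ?thesis by (simp add: power2_eq_square field_simps)
    qed
    have "(Z q x)\<^sup>2 \<le> R (fst q) + R (snd q)"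
    proof (cases "x = r")
      case True
      then show ?thesis
        using q4[of "Y r (fst q)" "Y (Suc r) (fst q)" "Y r (snd q)" "Y (Suc r) (snd q)"]
        by (simp add: Z_def T_def D_def avg_def R_def)
    next
      case False
      with \<open>x = r \<or> x = Suc r\<close> show ?thesis
        using q4[of "Y r (fst q)" "Y (Suc r) (fst q)" "Y (Suc r) (snd q)" "Y r (snd q)"]
        by (simp add: Z_def T_def D_def avg_def R_def diff_divide_distrib)
    qed
    moreover have "0 \<le> (Y x (fst q))\<^sup>2" by simp
    ultimately show ?thesis using True by (simp only: if_True)
  next
    case False
    then show ?thesis by (simp add: Z_def T_def avg_def)
  qed
  have Tm: "(\<lambda>q. T (snd q) x) \<in> borel_measurable NN" for x
    unfolding T_def using measurable_fst_snd(2)[OF Dm] by simp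
  have Zm: "(\<lambda>q. Z q x) \<in> borel_measurable NN" for x
    unfolding Z_def avg_def using measurable_fst_snd(1)[OF meas] Tm
    by (cases "x = r \<or> x = Suc r") simp_all
  have ib: "integrable NN (\<lambda>q. ?b q x)" for x
    using integral_fst_snd(1)[OF sq_int(1)[of x]] integral_fst_snd(1,3)[OF Rm]
    by (cases "x = r \<or> x = Suc r") simp_all
  have "0 < prob {\<omega> \<in> space N. 0 < h (Yseq \<omega>)}"
  proof (rule transfer_positive[where Z = Z and v = v and C = 2 and A = "B1 \<times> B2"])
    interpret NN: prob_space NN by (rule prob_space_NN)
    show "sq_bounded NN Z v"
    proof unfold_locales
      show "(\<lambda>q. Z q x) \<in> borel_measurable NN" for x by (rule Zm)
      show "sq_summable (Z q)" if "q \<in> space NN" for q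
      proof -
        have "fst q \<in> space N" using that by (auto simp: space_pair_measure)
        then show ?thesis
          unfolding Z_def by (intro sq_summable_add avg_l2 sq sq_summable_finite_support[of "Suc (Suc r)" "T (snd q)"])
            (auto simp: T_def)
      qed
      show "summable v"
        unfolding v_def by (intro summable_add pmf_nat_sums summable_finite[of "{r, Suc r}"]) auto
      show iZ: "integrable NN (\<lambda>q. (Z q x)\<^sup>2)" for x
        by (rule Bochner_Integration.integrable_bound[OF ib[of x]]) (use Zm order_trans[OF sqZ abs_ge_self] in auto)
      show "(\<integral>q. (Z q x)\<^sup>2 \<partial>NN) \<le> v x" for x
      proof -
        have "(\<integral>q. (Z q x)\<^sup>2 \<partial>NN) \<le> (\<integral>q. ?b q x \<partial>NN)"
          using iZ ib sqZ by (intro integral_mono) auto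
        also have "\<dots> = expectation (\<lambda>\<omega>. (Y x \<omega>)\<^sup>2) + (if x = r \<or> x = Suc r then 2 * expectation R else 0)"
          using integral_fst_snd[OF sq_int(1)[of x]] integral_fst_snd[OF Rm] by simp
        also have "\<dots> \<le> v x" using sq_int(2)[of x] ER by (auto simp: v_def)
        finally show ?thesis .
      qed
    qed
    show "pmf P x \<le> v x" for x by (simp add: v_def)
    fix m and a :: "nat \<Rightarrow> real"
    define l where "l = max m (Suc (Suc r))"
    define a' where "a' x = (if x < m then a x else 0)" for x
    have l: "m \<le> l" "Suc r < l" by (auto simp: l_def)
    \<comment> \<open>\<open>b\<close> acts on the average and \<open>c\<close>, through
      \<open>\<kappa>\<close>, on the difference. Because \<open>pmf P\<close> agrees at
      \<open>r\<close> and \<open>Suc r\<close>, the mean of \<open>c\<close> under \<open>P\<close>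
      is zero and the quadratic terms of \<open>b\<close> and \<open>c\<close> recombine to those of
      \<open>a'\<close>.\<close>
    define b where "b = avg r a'"
    define \<kappa> where "\<kappa> = (a' r - a' (Suc r)) / 2"
    define c where "c x = (if x = r then \<kappa> else if x = Suc r then - \<kappa> else 0)" for x
    let ?I = "{..<l} - {r, Suc r}"
    note sp = sum_split_pair[OF l(2)]
    have Ib: "b x = a' x" "c x = 0" if "x \<in> ?I" for x using that by (auto simp: b_def avg_def c_def)
    have b: "b r = (a' r + a' (Suc r)) / 2" "b (Suc r) = (a' r + a' (Suc r)) / 2" by (auto simp: b_def avg_def)
    have c: "c r = \<kappa>" "c (Suc r) = - \<kappa>" by (auto simp: c_def)
    have cov: "cov_form P b l + cov_form P c l = cov_form P a m"
    proof -
      have s1: "(\<Sum>x\<in>?I. (b x)\<^sup>2 * pmf P x) = (\<Sum>x\<in>?I. (a' x)\<^sup>2 * pmf P x)" "(\<Sum>x\<in>?I. b x * pmf P x) = (\<Sum>x\<in>?I. a' x * pmf P x)"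
        "(\<Sum>x\<in>?I. (c x)\<^sup>2 * pmf P x) = 0" "(\<Sum>x\<in>?I. c x * pmf P x) = 0"
        using Ib by (auto intro!: sum.cong sum.neutral)
      have "cov_form P b l + cov_form P c l = cov_form P a' l"
        unfolding cov_form_def sp s1 b c pr(1) by (simp add: \<kappa>_def power2_eq_square field_simps)
      then show ?thesis using cov_form_extend[OF l(1), of P a] by (simp add: a'_def[abs_def])
    qed
    have sum: "(\<Sum>x<m. a x * Z q x) = (\<Sum>x<l. b x * Y x (fst q)) + (\<Sum>x<l. c x * Y x (snd q))" for q
    proof -
      have s2: "(\<Sum>x\<in>?I. a' x * Z q x) = (\<Sum>x\<in>?I. a' x * Y x (fst q))" "(\<Sum>x\<in>?I. b x * Y x (fst q)) = (\<Sum>x\<in>?I. a' x * Y x (fst q))"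
        "(\<Sum>x\<in>?I. c x * Y x (snd q)) = 0"
        using Ib by (auto intro!: sum.cong sum.neutral simp: Z_def T_def avg_def)
      have "(\<Sum>x<m. a x * Z q x) = (\<Sum>x<l. a' x * Z q x)"
        using sum_extend_zero[OF l(1), of a "Z q"] by (simp add: a'_def)
      also have "\<dots> = (\<Sum>x<l. b x * Y x (fst q)) + (\<Sum>x<l. c x * Y x (snd q))"
        unfolding sp s2 b c by (simp add: Z_def T_def avg_def D_def \<kappa>_def field_simps)
      finally show ?thesis .
    qed
    show "\<exists>l b c. (\<forall>q. (\<Sum>x<m. a x * Z q x) = (\<Sum>x<l. b x * Y x (fst q)) + (\<Sum>x<l. c x * Y x (snd q)))
      \<and> cov_form P b l + cov_form P c l = cov_form P a m"
      using sum cov by blast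
  next
    show "B1 \<times> B2 \<in> sets NN" using B by auto
    show "emeasure NN (B1 \<times> B2) \<noteq> 0"
      using B1pos B2pos by (subst sigma_finite_measure.emeasure_pair_measure_Times[OF N_sf B]) simp
    fix q assume "q \<in> B1 \<times> B2"
    then show "0 < h (Z q)" unfolding h_def avgT DZ by (auto simp: B1_def B2_def)
  qed (use lh in auto)
  then show ?thesis by (simp add: h_def)
qed

text \<open>A difference beyond \<open>2 * t\<close> pushes one of the two coordinates beyond
  \<open>t\<close> in absolute value, and with it every norm, while the majorant sees only the
  averaged sequence, whose norms are below \<open>t\<close>. One event serves all
  \<open>k\<close>.\<close>

lemma strict_event:
  assumes p: "monotone_decreasing (pmf P)" and ns: "\<not> strictly_monotone (pmf P)" and t: "t > 0"
  shows "\<exists>U\<in>sets N. 0 < prob U \<and> (\<forall>\<omega>\<in>U. \<forall>k\<ge>2.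
    lnorm k (gren_blocks (pmf P) (Yseq \<omega>)) < t \<and> t < lnorm k (Yseq \<omega>))"
proof -
  have pp: "\<And>x. 0 \<le> pmf P x" "pmf P \<longlonglongrightarrow> 0" using summable_LIMSEQ_zero[OF pmf_nat_sums(1)] by auto
  obtain r where r0: "0 < pmf P r" "\<not> pmf P (Suc r) < pmf P r" using ns by (auto simp: strictly_monotone_def)
  moreover have "pmf P (Suc r) \<le> pmf P r" using p by (simp add: monotone_decreasing_def)
  ultimately have r: "flat (pmf P) r" by (simp add: flat_def)
  define U where "U = {\<omega> \<in> space N. l2 (avg r (Yseq \<omega>)) < t \<and> Y r \<omega> - Y (Suc r) \<omega> < - 2 * t}"
  have pos: "0 < prob U" unfolding U_def by (rule avg_difference_event[OF r t])
  then have "U \<in> sets N" using measure_notin_sets by fastforce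
  moreover have "lnorm k (gren_blocks (pmf P) (Yseq \<omega>)) < t \<and> t < lnorm k (Yseq \<omega>)"
    if "\<omega> \<in> U" and k: "2 \<le> k" for \<omega> k
  proof
    have U: "\<omega> \<in> space N" "l2 (avg r (Yseq \<omega>)) < t" "Y r \<omega> - Y (Suc r) \<omega> < - 2 * t"
      using that by (auto simp: U_def)
    note s = sq[OF U(1)]
    have "gren_blocks (pmf P) (Yseq \<omega>) = gren_blocks (pmf P) (avg r (Yseq \<omega>))"
      using gren_blocks_avg[OF p pp r, of "Yseq \<omega>"] U(3) t by (auto simp: fun_eq_iff)
    then have "lnorm k (gren_blocks (pmf P) (Yseq \<omega>)) \<le> lnorm k (avg r (Yseq \<omega>))"
      using gren_blocks_lnorm_le[OF p pp avg_l2(1)[OF s] k] by simp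
    also have "\<dots> \<le> l2 (avg r (Yseq \<omega>))" by (rule lnorm_le_l2[OF avg_l2(1)[OF s] k])
    finally show "lnorm k (gren_blocks (pmf P) (Yseq \<omega>)) < t" using U(2) by simp
    show "t < lnorm k (Yseq \<omega>)"
      using abs_le_lnorm[OF s k, of r] abs_le_lnorm[OF s k, of "Suc r"] U(3) by linarith
  qed
  ultimately show ?thesis using pos by blast
qed

end

section \<open>Convergence of the norms\<close>

lemma emp_est_cong: "(\<And>i. i \<in> {1..n} \<Longrightarrow> xs i = ys i) \<Longrightarrow> emp_est xs n = emp_est ys n"
  by (auto simp: emp_est_def fun_eq_iff intro!: arg_cong[where f = card])

lemma emp_vec_cong:
  assumes "\<And>i. i \<in> {1..n} \<Longrightarrow> xs i = ys i" shows "emp_vec xs n = emp_vec ys n"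
proof -
  have "xs ` {1..n} = ys ` {1..n}" using assms by (intro image_cong) auto
  then show ?thesis using emp_est_cong[OF assms] by (simp add: emp_vec_def)
qed

lemma est_cong:
  assumes "est \<in> {emp_est, rear_est, gren_est}" "\<And>i. i \<in> {1..n} \<Longrightarrow> xs i = ys i"
  shows "est xs n = est ys n"
  using assms(1) emp_est_cong[of n xs ys, OF assms(2)] emp_vec_cong[of n xs ys, OF assms(2)]
  by (auto simp: rear_est_def gren_est_def)

lemma weak_conv_compose:
  fixes F :: "nat \<Rightarrow> 'a \<Rightarrow> real" and G :: "'b \<Rightarrow> real" and g :: "real \<Rightarrow> real"
  assumes M: "prob_space M" and N: "prob_space N"
    and F: "\<And>n. F n \<in> borel_measurable M" and G: "G \<in> borel_measurable N"
    and wc: "weak_conv_m (\<lambda>n. distr M borel (F n)) (distr N borel G)"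
    and g: "continuous_on UNIV g"
  shows "weak_conv_m (\<lambda>n. distr M borel (\<lambda>\<omega>. g (F n \<omega>))) (distr N borel (\<lambda>\<omega>. g (G \<omega>)))"
proof (rule integral_bdd_continuous_conv_imp_weak_conv)
  interpret M: prob_space M by fact
  interpret N: prob_space N by fact
  have gm: "g \<in> borel_measurable borel" by (rule borel_measurable_continuous_onI[OF g])
  have gF: "(\<lambda>\<omega>. g (F n \<omega>)) \<in> borel_measurable M" for n by (rule measurable_compose[OF F gm])
  have gG: "(\<lambda>\<omega>. g (G \<omega>)) \<in> borel_measurable N" by (rule measurable_compose[OF G gm])
  show "real_distribution (distr M borel (\<lambda>\<omega>. g (F n \<omega>)))" for n by (rule M.real_distribution_distr[OF gF])
  show "real_distribution (distr N borel (\<lambda>\<omega>. g (G \<omega>)))" by (rule N.real_distribution_distr[OF gG])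
  fix f :: "real \<Rightarrow> real" assume f: "\<And>x. isCont f x" "\<And>x. \<bar>f x\<bar> \<le> 1"
  have fm: "f \<in> borel_measurable borel"
    using f by (intro borel_measurable_continuous_onI continuous_at_imp_continuous_on) auto
  have fg: "(\<lambda>y. f (g y)) \<in> borel_measurable borel" by (rule measurable_compose[OF gm fm])
  have gc: "isCont g x" for x using g by (simp add: continuous_on_eq_continuous_at)
  have "(\<lambda>n. integral\<^sup>L (distr M borel (F n)) (\<lambda>y. f (g y))) \<longlonglongrightarrow> integral\<^sup>L (distr N borel G) (\<lambda>y. f (g y))"
    by (rule weak_conv_imp_integral_bdd_continuous_conv[OF M.real_distribution_distr[OF F]
          N.real_distribution_distr[OF G] wc, where B = 1])
       (use f gc in \<open>auto intro: isCont_o2\<close>)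
  then show "(\<lambda>n. integral\<^sup>L (distr M borel (\<lambda>\<omega>. g (F n \<omega>))) f) \<longlonglongrightarrow> integral\<^sup>L (distr N borel (\<lambda>\<omega>. g (G \<omega>))) f"
    using F G gF gG fm fg by (simp add: integral_distr)
qed

context
  fixes P :: "nat pmf"
  assumes mono: "monotone_decreasing (pmf P)"
begin

lemma pmf_facts: "monotone_decreasing (pmf P)" "\<And>x. 0 \<le> pmf P x" "summable (pmf P)" "pmf P \<longlonglongrightarrow> 0"
  using mono pmf_nat_sums(1)[of P] summable_LIMSEQ_zero[OF pmf_nat_sums(1)[of P]] by auto

text \<open>If there is no drop beyond \<open>K\<close>, the mass function vanishes from
  \<open>K\<close> on, and the cut is placed at the end of the support, behind which the tail is
  zero.\<close>

lemma small_tail_cut: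
  assumes "0 < \<eta>" shows "\<exists>m>0. pmf P m < pmf P (m - 1) \<and> (\<Sum>x. pmf P (x + m)) < \<eta>"
proof -
  obtain K where K: "\<And>n. n \<ge> K \<Longrightarrow> norm (\<Sum>x. pmf P (x + n)) < \<eta>"
    using suminf_exist_split[OF assms pmf_facts(3)] by blast
  have anti: "pmf P j \<le> pmf P i" if "i \<le> j" for i j by (rule monotone_decreasing_le[OF mono that])
  show ?thesis
  proof (cases "\<exists>m>K. pmf P m < pmf P (m - 1)")
    case True
    then obtain m where "m > K" "pmf P m < pmf P (m - 1)" by blast
    then show ?thesis using K[of m] by (intro exI[of _ m]) auto
  next
    case False
    have const: "pmf P x = pmf P K" if "x \<ge> K" for x
      using that
    proof (induction x rule: dec_induct)
      case (step x)
      have "\<not> pmf P (Suc x) < pmf P x" using False step(1) by (metis diff_Suc_1 le_imp_less_Suc)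
      then show ?case using step anti[of x "Suc x"] by simp
    qed simp
    have "pmf P \<longlonglongrightarrow> pmf P K"
      by (rule tendsto_eventually, rule eventually_sequentiallyI) (rule const)
    then have K0: "pmf P K = 0" using pmf_facts(4) LIMSEQ_unique by blast
    define m where "m = (LEAST m. pmf P m = 0)"
    have m0: "pmf P m = 0" unfolding m_def by (rule LeastI[where P = "\<lambda>m. pmf P m = 0", OF K0])
    have zero: "pmf P (x + m) = 0" for x using anti[of m "x + m"] m0 pmf_nonneg[of P "x + m"] by simp
    have "m \<noteq> 0"
    proof
      assume "m = 0"
      then have "pmf P x = 0" for x using zero[of x] by simp
      then show False using pmf_nat_sums(2)[of P] by simp
    qed
    moreover have "pmf P (m - 1) \<noteq> 0"
    proof
      assume "pmf P (m - 1) = 0"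
      then have "m \<le> m - 1" unfolding m_def by (rule Least_le)
      then show False using \<open>m \<noteq> 0\<close> by simp
    qed
    then have "pmf P m < pmf P (m - 1)" using m0 pmf_nonneg[of P "m - 1"] by simp
    ultimately show ?thesis using zero assms by (intro exI[of _ m]) simp
  qed
qed

lemma est_sq_summable:
  assumes "est \<in> {emp_est, rear_est, gren_est}"
  shows "sq_summable (\<lambda>x. est xs n x - pmf P x)" "sq_summable (scaled_err (pmf P) est xs n)"
    "l2 (scaled_err (pmf P) est xs n) \<le> l2 (scaled_err (pmf P) emp_est xs n)"
  using assms sq_summable_emp[OF pmf_facts(1,2,3)] rear_est_contraction[OF pmf_facts(1,2,3)]
    gren_est_contraction[OF pmf_facts(1,2,3)] scaled_err_sq_summable[OF pmf_facts(1,2,3)]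
    scaled_err_l2_le[OF pmf_facts(1,2,3)] by auto


text \<open>Uniform integrability of the \<open>K\<close>-th power calls for its square. Rounding
  \<open>2 * K\<close> up to \<open>2 * q\<close> leads to the available moments, and the added one
  covers norms below one.\<close>

lemma lnorm_power_sq_le:
  assumes v: "sq_summable v" and K: "2 \<le> K" and q: "K \<le> real q"
  shows "(lnorm (ereal K) v powr K)\<^sup>2 \<le> 1 + l2 v ^ (2 * q)"
proof -
  let ?l = "l2 v"
  have l0: "0 \<le> ?l" by (rule l2_nonneg[OF v])
  have k: "2 \<le> ereal K" using K by simp
  have "(lnorm (ereal K) v powr K)\<^sup>2 \<le> (?l powr K)\<^sup>2"
    using lnorm_nonneg[OF v k] lnorm_le_l2[OF v k] K by (intro power_mono powr_mono2) auto
  also have "\<dots> = ?l powr (2 * K)" by (simp add: power2_eq_square powr_add[symmetric])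
  also have "\<dots> \<le> 1 + ?l ^ (2 * q)"
  proof (cases "?l \<le> 1")
    case True
    then have "?l powr (2 * K) \<le> 1 powr (2 * K)" using l0 K by (intro powr_mono2) auto
    moreover have "0 \<le> ?l ^ (2 * q)" using l0 by simp
    ultimately show ?thesis unfolding powr_one_eq_one by linarith
  next
    case False
    then have "?l powr (2 * K) \<le> ?l powr real (2 * q)" using q by (intro powr_mono) auto
    also have "\<dots> = ?l ^ (2 * q)" using False by (intro powr_realpow) simp
    finally show ?thesis by simp
  qed
  finally show ?thesis .
qed

text \<open>One argument for all three estimators: \<open>G\<close> is the identity for the
  empirical and the rearrangement estimator and \<open>gren_blocks\<close> for the Grenander
  estimator.\<close>

lemma estimator_conv:
  fixes M :: "'a measure" and N :: "'b measure"
  assumes S: "iid_sample M X P" and L: "gaussian_limit N Y P"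
    and est: "est \<in> {emp_est, rear_est, gren_est}" and k: "2 \<le> k"
    and lip: "l2_lipschitz 1 (\<lambda>z. lnorm k (G z))" and G: "\<And>z. sq_summable z \<Longrightarrow> sq_summable (G z)"
    and approx: "\<And>m. \<lbrakk>0 < m; pmf P m < pmf P (m - 1)\<rbrakk> \<Longrightarrow> \<exists>\<epsilon>>0. \<forall>xs n. 0 < n \<longrightarrow>
      l2 (\<lambda>x. emp_est xs n x - pmf P x) < \<epsilon> \<longrightarrow>
      \<bar>lnorm k (scaled_err (pmf P) est xs n) - lnorm k (G (scaled_err (pmf P) emp_est xs n))\<bar>
        \<le> 2 * l2 (\<lambda>x. scaled_err (pmf P) emp_est xs n x - trunc m (scaled_err (pmf P) emp_est xs n) x)"
  shows "conv_in_distr M (\<lambda>n \<omega>. lnorm k (scaled_err (pmf P) est (\<lambda>i. X i \<omega>) n)) N (\<lambda>\<omega>. lnorm k (G (\<lambda>x. Y x \<omega>)))"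
    "conv_in_expectation M (\<lambda>n \<omega>. lnorm_pow k (scaled_err (pmf P) est (\<lambda>i. X i \<omega>) n))
      N (\<lambda>\<omega>. lnorm_pow k (G (\<lambda>x. Y x \<omega>)))"
proof -
  interpret S: iid_sample M X P by fact
  interpret L: gaussian_limit N Y P by fact
  define F where "F n \<omega> = lnorm k (scaled_err (pmf P) est (\<lambda>i. X i \<omega>) n)" for n \<omega>
  define H where "H \<omega> = lnorm k (G (\<lambda>x. Y x \<omega>))" for \<omega>
  have Fm: "F n \<in> borel_measurable M" for n
    unfolding F_def[abs_def]
  proof (rule S.sample_measurable[of n "\<lambda>xs. lnorm k (scaled_err (pmf P) est xs n)"])
    fix xs ys :: "nat \<Rightarrow> nat" assume eq: "\<And>i. i \<in> {1..n} \<Longrightarrow> xs i = ys i"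
    have "est xs n = est ys n" using est eq by (rule est_cong)
    then show "lnorm k (scaled_err (pmf P) est xs n) = lnorm k (scaled_err (pmf P) est ys n)"
      by (simp only: scaled_err_def[abs_def])
  qed
  have Hm: "H \<in> borel_measurable N"
    unfolding H_def[abs_def] by (rule L.lipschitz_Y_measurable[OF lip])
  have wc: "weak_conv_m (\<lambda>n. distr M borel (F n)) (distr N borel H)"
    unfolding H_def[abs_def]
  proof (rule S.functional_weak_conv[OF L.sq_bounded_axioms _ lip Fm])
    show "(\<integral>\<omega>. cos ((\<Sum>x<m. a x * Y x \<omega>) + \<theta>) \<partial>N) =
      exp (- ((\<Sum>x<m. (a x)\<^sup>2 * pmf P x) - (\<Sum>x<m. a x * pmf P x)\<^sup>2) / 2) * cos \<theta>" for m a \<theta>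
      using L.Y_cos unfolding cov_form_def .
    fix \<eta> :: real assume "0 < \<eta>"
    then obtain m where m: "0 < m" "pmf P m < pmf P (m - 1)" "(\<Sum>x. pmf P (x + m)) < \<eta>"
      using small_tail_cut by blast
    obtain \<epsilon> where e: "\<epsilon> > 0" "\<And>xs n. \<lbrakk>0 < n; l2 (\<lambda>x. emp_est xs n x - pmf P x) < \<epsilon>\<rbrakk> \<Longrightarrow>
      \<bar>lnorm k (scaled_err (pmf P) est xs n) - lnorm k (G (scaled_err (pmf P) emp_est xs n))\<bar>
        \<le> 2 * l2 (\<lambda>x. scaled_err (pmf P) emp_est xs n x - trunc m (scaled_err (pmf P) emp_est xs n) x)"
      using approx[OF m(1,2)] by blast
    have "\<bar>F n \<omega> - lnorm k (G (S.Yn n \<omega>))\<bar> \<le> 2 * l2 (\<lambda>x. S.Yn n \<omega> x - trunc m (S.Yn n \<omega>) x)"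
      if n: "0 < n" and small: "l2 (S.Yn n \<omega>) < \<epsilon> * sqrt n" for n \<omega>
    proof -
      have "l2 (S.Yn n \<omega>) = sqrt n * l2 (\<lambda>x. emp_est (\<lambda>i. X i \<omega>) n x - pmf P x)"
        unfolding scaled_err_def[abs_def]
        by (rule l2_scale[OF est_sq_summable(1)[of emp_est "\<lambda>i. X i \<omega>" n]]) auto
      then have "l2 (\<lambda>x. emp_est (\<lambda>i. X i \<omega>) n x - pmf P x) * sqrt n < \<epsilon> * sqrt n"
        using small by (simp add: mult.commute)
      then have "l2 (\<lambda>x. emp_est (\<lambda>i. X i \<omega>) n x - pmf P x) < \<epsilon>"
        using n by (simp add: mult_less_cancel_right)
      from e(2)[OF n this] show ?thesis by (simp add: F_def)
    qed
    then show "\<exists>m. (\<Sum>x. pmf P (x + m)) < \<eta> \<and> (\<exists>\<epsilon>>0. \<forall>n>0. \<forall>\<omega>\<in>space M.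
      l2 (S.Yn n \<omega>) < \<epsilon> * sqrt n \<longrightarrow>
      \<bar>F n \<omega> - lnorm k (G (S.Yn n \<omega>))\<bar> \<le> 2 * l2 (\<lambda>x. S.Yn n \<omega> x - trunc m (S.Yn n \<omega>) x))"
      using m(3) e(1) by blast
  qed
  then show "conv_in_distr M (\<lambda>n \<omega>. lnorm k (scaled_err (pmf P) est (\<lambda>i. X i \<omega>) n)) N (\<lambda>\<omega>. lnorm k (G (\<lambda>x. Y x \<omega>)))"
    by (simp add: conv_in_distr_def F_def[abs_def] H_def[abs_def])
  note sqF = est_sq_summable(2)[OF est]
  have F0: "0 \<le> F n \<omega>" for n \<omega> unfolding F_def by (rule lnorm_nonneg[OF sqF k])
  have FY: "F n \<omega> \<le> l2 (S.Yn n \<omega>)" for n \<omega>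
    unfolding F_def using lnorm_le_l2[OF sqF k] est_sq_summable(3)[OF est] by (rule order_trans)
  have H0: "0 \<le> H \<omega>" if "\<omega> \<in> space N" for \<omega>
    unfolding H_def by (rule lnorm_nonneg[OF G[OF L.sq[OF that]] k])
  show "conv_in_expectation M (\<lambda>n \<omega>. lnorm_pow k (scaled_err (pmf P) est (\<lambda>i. X i \<omega>) n))
      N (\<lambda>\<omega>. lnorm_pow k (G (\<lambda>x. Y x \<omega>)))"
    using k
  proof (cases rule: ereal_ge_2_cases)
    case 1
    obtain C where C: "\<And>n. (\<integral>\<omega>. l2 (S.Yn n \<omega>) ^ (2 * 1) \<partial>M) \<le> C" using S.l2_Yn_moments(2) by blast
    note iY = S.l2_Yn_moments(1)[where q = 1]
    have sq: "(F n \<omega>)\<^sup>2 \<le> l2 (S.Yn n \<omega>) ^ (2 * 1)" for n \<omega>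
      using F0[of n \<omega>] FY[of n \<omega>] by (simp add: power_mono)
    have i: "integrable M (\<lambda>\<omega>. (F n \<omega>)\<^sup>2)" for n
      by (rule Bochner_Integration.integrable_bound[OF iY[of n]])
         (use Fm sq order_trans[OF sq abs_ge_self] in auto)
    have "(\<integral>\<omega>. (F n \<omega>)\<^sup>2 \<partial>M) \<le> C" for n
      using integral_mono[OF i iY sq] C by (rule order_trans)
    from expectation_conv[OF S.prob_space_axioms L.prob_space_axioms Fm F0 Hm H0 i this wc] 1
    show ?thesis by (simp add: conv_in_expectation_def lnorm_pow_def F_def[abs_def] H_def[abs_def])
  next
    case (2 K)
    obtain q :: nat where q: "K \<le> real q" using real_arch_simple by blast
    obtain C where C: "\<And>n. (\<integral>\<omega>. l2 (S.Yn n \<omega>) ^ (2 * q) \<partial>M) \<le> C" using S.l2_Yn_moments(2) by blast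
    note iY = S.l2_Yn_moments(1)[where q = q]
    \<comment> \<open>With the absolute value this is continuous on the whole line, as continuous
      mapping requires; on norms it is the plain power.\<close>
    define g where "g y = \<bar>y\<bar> powr K" for y :: real
    have g: "continuous_on UNIV g"
      unfolding g_def using 2 by (intro continuous_on_powr' continuous_intros) auto
    have gm: "g \<in> borel_measurable borel" by (rule borel_measurable_continuous_onI[OF g])
    have gF: "(\<lambda>\<omega>. g (F n \<omega>)) \<in> borel_measurable M" for n by (rule measurable_compose[OF Fm gm])
    have gH: "(\<lambda>\<omega>. g (H \<omega>)) \<in> borel_measurable N" by (rule measurable_compose[OF Hm gm])
    have l2mono: "l2 (scaled_err (pmf P) est (\<lambda>i. X i \<omega>) n) ^ (2 * q) \<le> l2 (S.Yn n \<omega>) ^ (2 * q)" for n \<omega>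
      using est_sq_summable(3)[OF est] l2_nonneg[OF sqF] by (rule power_mono)
    have sq: "(g (F n \<omega>))\<^sup>2 \<le> 1 + l2 (S.Yn n \<omega>) ^ (2 * q)" for n \<omega>
      using lnorm_power_sq_le[OF sqF 2(1) q, of "\<lambda>i. X i \<omega>" n] l2mono[of \<omega> n] F0[of n \<omega>] 2(2)
      by (simp add: g_def F_def)
    have iR: "integrable M (\<lambda>\<omega>. 1 + l2 (S.Yn n \<omega>) ^ (2 * q))" for n using iY[of n] by simp
    have i: "integrable M (\<lambda>\<omega>. (g (F n \<omega>))\<^sup>2)" for n
      by (rule Bochner_Integration.integrable_bound[OF iR[of n]])
         (use gF sq order_trans[OF sq abs_ge_self] in auto)
    have ER: "(\<integral>\<omega>. 1 + l2 (S.Yn n \<omega>) ^ (2 * q) \<partial>M) \<le> 1 + C" for n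
      using iY[of n] C[of n] by (simp add: S.prob_space)
    have "(\<integral>\<omega>. (g (F n \<omega>))\<^sup>2 \<partial>M) \<le> 1 + C" for n
      using integral_mono[OF i iR sq] ER by (rule order_trans)
    from expectation_conv[OF S.prob_space_axioms L.prob_space_axioms gF _ gH _ i this
        weak_conv_compose[OF S.prob_space_axioms L.prob_space_axioms Fm Hm wc g]]
    have c: "integrable M (\<lambda>\<omega>. g (F n \<omega>))" "integrable N (\<lambda>\<omega>. g (H \<omega>))"
      "(\<lambda>n. \<integral>\<omega>. g (F n \<omega>) \<partial>M) \<longlonglongrightarrow> (\<integral>\<omega>. g (H \<omega>) \<partial>N)" for n
      by (auto simp: g_def)
    have "lnorm_pow k v = g (lnorm k v)" for v
      using 2 by (simp add: lnorm_pow_def g_def lnorm_ereal)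
    then show ?thesis using c by (simp add: conv_in_expectation_def F_def[abs_def] H_def[abs_def])
  qed
qed

end

theorem corollary4p1:
  fixes M :: "'a measure" and X :: "nat \<Rightarrow> 'a \<Rightarrow> nat" and P :: "nat pmf"
    and N :: "'b measure" and Y :: "nat \<Rightarrow> 'b \<Rightarrow> real"
  assumes "prob_space M"
    and "prob_space.indep_vars M (\<lambda>_. count_space UNIV) X {1..}"
    and "\<And>i. i \<ge> 1 \<Longrightarrow> distr M (count_space UNIV) (X i) = measure_pmf P"
    and "monotone_decreasing (pmf P)"
    and "prob_space N"
    and "limit_process (pmf P) N Y"
  shows "(\<forall>k::ereal. 2 \<le> k \<longrightarrow>
      (\<forall>est \<in> {emp_est, rear_est, gren_est}. \<forall>n. \<forall>\<omega> \<in> space M.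
         sqrt (real n) * lnorm k (\<lambda>x. est (\<lambda>i. X i \<omega>) n x - pmf P x)
           = lnorm k (scaled_err (pmf P) est (\<lambda>i. X i \<omega>) n))
    \<and> conv_in_distr M (\<lambda>n \<omega>. lnorm k (scaled_err (pmf P) emp_est (\<lambda>i. X i \<omega>) n))
        N (\<lambda>\<omega>. lnorm k (\<lambda>x. Y x \<omega>))
    \<and> conv_in_distr M (\<lambda>n \<omega>. lnorm k (scaled_err (pmf P) rear_est (\<lambda>i. X i \<omega>) n))
        N (\<lambda>\<omega>. lnorm k (\<lambda>x. Y x \<omega>))
    \<and> conv_in_distr M (\<lambda>n \<omega>. lnorm k (scaled_err (pmf P) gren_est (\<lambda>i. X i \<omega>) n))
        N (\<lambda>\<omega>. lnorm k (gren_blocks (pmf P) (\<lambda>x. Y x \<omega>)))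
    \<and> stoch_le N (\<lambda>\<omega>. lnorm k (gren_blocks (pmf P) (\<lambda>x. Y x \<omega>)))
        N (\<lambda>\<omega>. lnorm k (\<lambda>x. Y x \<omega>))
    \<and> (\<not> strictly_monotone (pmf P) \<longrightarrow>
        stoch_less N (\<lambda>\<omega>. lnorm k (gren_blocks (pmf P) (\<lambda>x. Y x \<omega>)))
          N (\<lambda>\<omega>. lnorm k (\<lambda>x. Y x \<omega>)))
    \<and> conv_in_expectation M (\<lambda>n \<omega>. lnorm_pow k (scaled_err (pmf P) emp_est (\<lambda>i. X i \<omega>) n))
        N (\<lambda>\<omega>. lnorm_pow k (\<lambda>x. Y x \<omega>))
    \<and> conv_in_expectation M (\<lambda>n \<omega>. lnorm_pow k (scaled_err (pmf P) rear_est (\<lambda>i. X i \<omega>) n))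
        N (\<lambda>\<omega>. lnorm_pow k (\<lambda>x. Y x \<omega>))
    \<and> conv_in_expectation M (\<lambda>n \<omega>. lnorm_pow k (scaled_err (pmf P) gren_est (\<lambda>i. X i \<omega>) n))
        N (\<lambda>\<omega>. lnorm_pow k (gren_blocks (pmf P) (\<lambda>x. Y x \<omega>))))
  \<and> (\<integral>\<omega>. (lnorm 2 (gren_blocks (pmf P) (\<lambda>x. Y x \<omega>)))\<^sup>2 \<partial>N) \<le> (\<integral>\<omega>. (lnorm 2 (\<lambda>x. Y x \<omega>))\<^sup>2 \<partial>N)
  \<and> (\<integral>\<omega>. (lnorm 2 (\<lambda>x. Y x \<omega>))\<^sup>2 \<partial>N) = (\<Sum>x. pmf P x * (1 - pmf P x))
  \<and> ((\<integral>\<omega>. (lnorm 2 (gren_blocks (pmf P) (\<lambda>x. Y x \<omega>)))\<^sup>2 \<partial>N) = (\<integral>\<omega>. (lnorm 2 (\<lambda>x. Y x \<omega>))\<^sup>2 \<partial>N)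
       \<longleftrightarrow> strictly_monotone (pmf P))"
proof -
  let ?p = "pmf P" and ?Y = "\<lambda>\<omega> x. Y x \<omega>"
  let ?G = "\<lambda>\<omega>. gren_blocks ?p (\<lambda>x. Y x \<omega>)"
  interpret S: iid_sample M X P
    using assms(1-3) by (simp add: iid_sample_def iid_sample_axioms_def)
  interpret L: gaussian_limit N Y P
    using assms(5,6) by (simp add: gaussian_limit_def gaussian_limit_axioms_def)
  note mono = assms(4)
  note p = pmf_facts[OF mono]
  note p3 = p(1,2,4)
  have Gm: "(\<lambda>\<omega>. lnorm k (?G \<omega>)) \<in> borel_measurable N" if "2 \<le> k" for k
    by (rule L.lipschitz_Y_measurable[OF gren_blocks_lipschitz[OF p3 that]])
  have Ym: "(\<lambda>\<omega>. lnorm k (?Y \<omega>)) \<in> borel_measurable N" if "2 \<le> k" for k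
    by (rule L.lipschitz_Y_measurable[OF lnorm_lipschitz[OF that]])
  have le: "lnorm k (?G \<omega>) \<le> lnorm k (?Y \<omega>)" if "2 \<le> k" "\<omega> \<in> space N" for k \<omega>
    by (rule gren_blocks_lnorm_le[OF p3 L.sq[OF that(2)] that(1)])
  have evG: "{\<omega> \<in> space N. lnorm k (?G \<omega>) > x} \<in> sets N"
    and evY: "{\<omega> \<in> space N. lnorm k (?Y \<omega>) > x} \<in> sets N" if "2 \<le> k" for k x
    using Gm[OF that] Ym[OF that] by measurable
  have stle: "stoch_le N (\<lambda>\<omega>. lnorm k (?G \<omega>)) N (\<lambda>\<omega>. lnorm k (?Y \<omega>))" if k: "2 \<le> k" for k
    unfolding stoch_le_def
    by (intro allI L.finite_measure_mono[OF _ evY[OF k]]) (use le[OF k] in force)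
  have stless: "stoch_less N (\<lambda>\<omega>. lnorm k (?G \<omega>)) N (\<lambda>\<omega>. lnorm k (?Y \<omega>))"
    if k: "2 \<le> k" and ns: "\<not> strictly_monotone ?p" for k
    unfolding stoch_less_def
  proof (intro conjI stle[OF k] allI impI)
    fix x :: real assume x: "x > 0"
    obtain U where U: "U \<in> sets N" "0 < measure N U"
      and lt: "\<And>\<omega>. \<omega> \<in> U \<Longrightarrow> lnorm k (?G \<omega>) < x \<and> x < lnorm k (?Y \<omega>)"
      using L.strict_event[OF mono ns x] k by blast
    let ?A = "{\<omega> \<in> space N. lnorm k (?G \<omega>) > x}" and ?B = "{\<omega> \<in> space N. lnorm k (?Y \<omega>) > x}"
    \<comment> \<open>On \<open>U\<close> the smaller norm stays below \<open>x\<close> and the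
      larger one exceeds it, so \<open>U\<close> is disjoint from \<open>?A\<close> but contained in
      \<open>?B\<close>; its mass makes the inequality strict.\<close>
    have "measure N ?A < measure N ?A + measure N U" using U by simp
    also have "\<dots> = measure N (?A \<union> U)"
      by (rule L.finite_measure_Union[symmetric, OF evG[OF k] U(1)]) (use lt in force)
    also have "\<dots> \<le> measure N ?B"
    proof (rule L.finite_measure_mono[OF _ evY[OF k]])
      show "?A \<union> U \<subseteq> ?B" using le[OF k] lt sets.sets_into_space[OF U(1)] by force
    qed
    finally show "measure N ?A < measure N ?B" .
  qed
  \<comment> \<open>For the empirical estimator the left-hand side is zero, so any radius will
    do.\<close>
  have emp: "\<exists>\<epsilon>>0. \<forall>xs n. 0 < n \<longrightarrow> l2 (\<lambda>x. emp_est xs n x - ?p x) < \<epsilon> \<longrightarrow>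
      \<bar>lnorm k (scaled_err ?p emp_est xs n) - lnorm k (scaled_err ?p emp_est xs n)\<bar>
        \<le> 2 * l2 (\<lambda>x. scaled_err ?p emp_est xs n x - trunc m (scaled_err ?p emp_est xs n) x)" for k m
    using l2_nonneg[OF sq_summable_diff[OF scaled_err_sq_summable(1)[OF p(1,2,3)] sq_summable_trunc]]
    by (auto intro: exI[of _ 1])
  have rg: "\<exists>\<epsilon>>0. \<forall>xs n. 0 < n \<longrightarrow> l2 (\<lambda>x. emp_est xs n x - ?p x) < \<epsilon> \<longrightarrow>
      \<bar>lnorm k (scaled_err ?p rear_est xs n) - lnorm k (scaled_err ?p emp_est xs n)\<bar>
        \<le> 2 * l2 (\<lambda>x. scaled_err ?p emp_est xs n x - trunc m (scaled_err ?p emp_est xs n) x)"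
    "\<exists>\<epsilon>>0. \<forall>xs n. 0 < n \<longrightarrow> l2 (\<lambda>x. emp_est xs n x - ?p x) < \<epsilon> \<longrightarrow>
      \<bar>lnorm k (scaled_err ?p gren_est xs n) - lnorm k (gren_blocks ?p (scaled_err ?p emp_est xs n))\<bar>
        \<le> 2 * l2 (\<lambda>x. scaled_err ?p emp_est xs n x - trunc m (scaled_err ?p emp_est xs n) x)"
    if "2 \<le> k" "0 < m" "?p m < ?p (m - 1)" for k m
    by (rule est_approx[OF p(1,2,3) that(2,3)], use that(1) in blast)+
  note conv = estimator_conv[OF mono S.iid_sample_axioms L.gaussian_limit_axioms]
  have c_emp: "conv_in_distr M (\<lambda>n \<omega>. lnorm k (scaled_err ?p emp_est (\<lambda>i. X i \<omega>) n)) N (\<lambda>\<omega>. lnorm k (?Y \<omega>))"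
    "conv_in_expectation M (\<lambda>n \<omega>. lnorm_pow k (scaled_err ?p emp_est (\<lambda>i. X i \<omega>) n)) N (\<lambda>\<omega>. lnorm_pow k (?Y \<omega>))"
    if k: "2 \<le> k" for k
    using conv[of emp_est k "\<lambda>z. z", OF _ k lnorm_lipschitz[OF k] _ emp] by auto
  have c_rear: "conv_in_distr M (\<lambda>n \<omega>. lnorm k (scaled_err ?p rear_est (\<lambda>i. X i \<omega>) n)) N (\<lambda>\<omega>. lnorm k (?Y \<omega>))"
    "conv_in_expectation M (\<lambda>n \<omega>. lnorm_pow k (scaled_err ?p rear_est (\<lambda>i. X i \<omega>) n)) N (\<lambda>\<omega>. lnorm_pow k (?Y \<omega>))"
    if k: "2 \<le> k" for k
    using conv[of rear_est k "\<lambda>z. z", OF _ k lnorm_lipschitz[OF k] _ rg(1)[OF k]] by auto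
  have c_gren: "conv_in_distr M (\<lambda>n \<omega>. lnorm k (scaled_err ?p gren_est (\<lambda>i. X i \<omega>) n)) N (\<lambda>\<omega>. lnorm k (?G \<omega>))"
    "conv_in_expectation M (\<lambda>n \<omega>. lnorm_pow k (scaled_err ?p gren_est (\<lambda>i. X i \<omega>) n)) N (\<lambda>\<omega>. lnorm_pow k (?G \<omega>))"
    if k: "2 \<le> k" for k
    using conv[of gren_est k "gren_blocks ?p", OF _ k gren_blocks_lipschitz[OF p3 k] gren_blocks_l2(1)[OF p3] rg(2)[OF k]]
    by auto
  have scale: "sqrt (real n) * lnorm k (\<lambda>x. est (\<lambda>i. X i \<omega>) n x - ?p x) = lnorm k (scaled_err ?p est (\<lambda>i. X i \<omega>) n)"
    if "2 \<le> k" "est \<in> {emp_est, rear_est, gren_est}" for k est n \<omega>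
    unfolding scaled_err_def[abs_def]
    by (rule lnorm_scale[OF est_sq_summable(1)[OF mono that(2)] that(1), symmetric]) simp
  have two: "(2::ereal) \<le> 2" by simp
  let ?g2 = "\<lambda>\<omega>. (lnorm 2 (?G \<omega>))\<^sup>2" and ?y2 = "\<lambda>\<omega>. (lnorm 2 (?Y \<omega>))\<^sup>2"
  have y2: "?y2 \<omega> = (l2 (?Y \<omega>))\<^sup>2" if "\<omega> \<in> space N" for \<omega>
    unfolding lnorm_2[OF L.sq[OF that]] ..
  have iy: "integrable N ?y2"
    by (subst Bochner_Integration.integrable_cong[OF refl y2]) (auto intro: L.l2_Y_second_moment)
  have Ey: "(\<integral>\<omega>. ?y2 \<omega> \<partial>N) = (\<Sum>x. ?p x * (1 - ?p x))"
    by (subst Bochner_Integration.integral_cong[OF refl y2]) (auto intro: L.l2_Y_second_moment)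
  have g0: "0 \<le> lnorm 2 (?G \<omega>)" if "\<omega> \<in> space N" for \<omega>
    by (rule lnorm_nonneg[OF gren_blocks_l2(1)[OF p3 L.sq[OF that]] two])
  have gy: "?g2 \<omega> \<le> ?y2 \<omega>" if "\<omega> \<in> space N" for \<omega>
    using le[OF two that] g0[OF that] by (intro power_mono)
  have ig: "integrable N ?g2"
    by (rule Bochner_Integration.integrable_bound[OF iy]) (use Gm[OF two] gy in auto)
  have Egy: "(\<integral>\<omega>. ?g2 \<omega> \<partial>N) \<le> (\<integral>\<omega>. ?y2 \<omega> \<partial>N)" by (rule integral_mono[OF ig iy gy])
  have iff: "(\<integral>\<omega>. ?g2 \<omega> \<partial>N) = (\<integral>\<omega>. ?y2 \<omega> \<partial>N) \<longleftrightarrow> strictly_monotone ?p"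
  proof
    assume sm: "strictly_monotone ?p"
    \<comment> \<open>A flat block begins with a tie, at a positive value because the mass function
      still drops after the block; strict monotonicity excludes this.\<close>
    have nb: "\<not> flat_block ?p r s" for r s
    proof
      assume b: "flat_block ?p r s"
      have s: "?p (Suc s) < ?p s" "r < s" using b unfolding flat_block_def by blast+
      have "?p s = ?p r" "?p (Suc r) = ?p r" using s(2) by (auto intro: flat_block_const[OF b])
      moreover from this have "0 < ?p r" using s(1) pmf_nonneg[of P "Suc s"] by linarith
      ultimately have "0 < ?p r" "?p (Suc r) = ?p r" by auto
      then show False using sm unfolding strictly_monotone_def by force
    qed
    have "?G \<omega> = ?Y \<omega>" for \<omega> by (simp add: gren_blocks_def nb fun_eq_iff)
    then show "(\<integral>\<omega>. ?g2 \<omega> \<partial>N) = (\<integral>\<omega>. ?y2 \<omega> \<partial>N)" by simp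
  next
    assume eq: "(\<integral>\<omega>. ?g2 \<omega> \<partial>N) = (\<integral>\<omega>. ?y2 \<omega> \<partial>N)"
    show "strictly_monotone ?p"
    proof (rule ccontr)
      assume "\<not> strictly_monotone ?p"
      then obtain U where U: "U \<in> sets N" "0 < measure N U"
        and lt: "\<And>\<omega>. \<omega> \<in> U \<Longrightarrow> lnorm 2 (?G \<omega>) < 1 \<and> 1 < lnorm 2 (?Y \<omega>)"
        using L.strict_event[OF mono _ zero_less_one] two by blast
      have "0 < (\<integral>\<omega>. ?y2 \<omega> - ?g2 \<omega> \<partial>N)"
      proof (rule expectation_pos[OF _ _ U(1)])
        show "emeasure N U \<noteq> 0" using U(2) by (simp add: L.emeasure_eq_measure)
        show "0 < ?y2 \<omega> - ?g2 \<omega>" if "\<omega> \<in> U" for \<omega>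
        proof -
          have "\<omega> \<in> space N" using that sets.sets_into_space[OF U(1)] by blast
          then show ?thesis using lt[OF that] g0 by (simp add: power_strict_mono)
        qed
      qed (use iy ig gy in auto)
      then show False using iy ig eq by simp
    qed
  qed
  show ?thesis
    by (intro conjI allI impI ballI scale c_emp c_rear c_gren stle stless Egy Ey iff)
qed

end
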